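(* Suppose $\eta(n)=o(\kappa(n))$ as $n\to\infty$. Then, as $t\to\infty$, $$\frac{u(t,Z^{(1)}_t)}{u(t,-Z^{(1)}_t)}\to 1\qquad\text{in probability.}$$
   Context: Fix $\alpha\ge 2$. Let $(\xi_0(z))_{z\in\mathbb Z}$ be i.i.d. Pareto random variables with parameter $\alpha$, i.e. $\mathrm{Prob}(\xi_0(z)>x)=x^{-\alpha}$ for $x\ge 1$. Let $p:\mathbb N\to[0,1]$ be eventually nondecreasing with $p(n)\to 1$, and $q=1-p$. Define the potential $\xi:\mathbb Z\to[1,\infty)$ by $\xi(n)=\xi_0(n)$ for $n\ge 0$ and, independently for each $n\ge1$ (and independently of $\xi_0$), $\xi(-n)=\xi_0(n)$ with probability $p(n)$ and $\xi(-n)=\xi_0(-n)$ with probability $q(n)$. Let $u$ be the solution of $\partial_t u=\Delta u+\xi u$ on $(0,\infty)\times\mathbb Z$, $u(0,\cdot)=\mathbf 1_{\{0\}}$, with $(\Delta f)(z)=\sum_{|y-z|=1}(f(y)-f(z))$, given by $u(t,z)=\mathbb E[\exp\{\int_0^t\xi(X_s)ds\}\mathbf 1\{X_t=z\}]$ with $(X_s)$ the continuous-time random walk with generator $\Delta$ started at $0$. Let $D=\{z\in\mathbb N_0:\xi(z)=\xi(-z)\}$, $\Psi_t(z)=\xi(z)-\frac{|z|}{t}\log\xi(z)$, and $Z^{(1)}_t$ a maximiser of $\Psi_t$ over $D$. Let $\eta(n)=\sum_{z=1}^n q(z)$ and $\kappa(n)=n^{2/\alpha}$ if $\alpha>2$,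 $\kappa(n)=n/\log n$ if $\alpha=2$. *)

theory Defs
  imports "HOL-Probability.Probability" "HOL-Library.Landau_Symbols"
begin

text \<open>The walk jumps at total rate 2 (rate 1 to each neighbour). We build it from
 i.i.d. pairs (holding time ~ Exp(2), step uniform on {-1,1}).\<close>

definition crw_step :: "(real \<times> int) measure" where
  "crw_step = density lborel (exponential_density 2) \<Otimes>\<^sub>M measure_pmf (pmf_of_set {-1, 1})"

definition crw_space :: "(nat \<Rightarrow> real \<times> int) measure" where
  "crw_space = PiM UNIV (\<lambda>_. crw_step)"

definition jump_time :: "(nat \<Rightarrow> real \<times> int) \<Rightarrow> nat \<Rightarrow> real" where
  "jump_time w k = (\<Sum>i<k. fst (w i))"

definition crw_pos :: "(nat \<Rightarrow> real \<times> int) \<Rightarrow> real \<Rightarrow> int" where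
  "crw_pos w s = (\<Sum>i < (LEAST k. s < jump_time w (Suc k)). snd (w i))"

text \<open>Feynman-Kac solution u(t,z) = E[exp(int_0^t xi(X_s) ds) 1{X_t = z}], X_0 = 0.\<close>
definition pam_u :: "(int \<Rightarrow> real) \<Rightarrow> real \<Rightarrow> int \<Rightarrow> real" where
  "pam_u \<xi> t z = (\<integral>w. exp (LINT s:{0..t}|lborel. \<xi> (crw_pos w s))
                        * (if crw_pos w t = z then 1 else 0) \<partial>crw_space)"

definition potential :: "(int \<Rightarrow> real) \<Rightarrow> (nat \<Rightarrow> bool) \<Rightarrow> int \<Rightarrow> real" where
  "potential x0 c z = (if z \<ge> 0 then x0 z
                       else if c (nat (- z)) then x0 (- z) else x0 z)"

definition Psi :: "(int \<Rightarrow> real) \<Rightarrow> real \<Rightarrow> int \<Rightarrow> real" where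
  "Psi \<xi> t z = \<xi> z - (\<bar>real_of_int z\<bar> / t) * ln (\<xi> z)"

definition Dset :: "(int \<Rightarrow> real) \<Rightarrow> nat set" where
  "Dset \<xi> = {z. \<xi> (int z) = \<xi> (- int z)}"

definition eta :: "(nat \<Rightarrow> real) \<Rightarrow> nat \<Rightarrow> real" where
  "eta q n = (\<Sum>z=1..n. q z)"

definition kappa :: "real \<Rightarrow> nat \<Rightarrow> real" where
  "kappa \<alpha> n = (if \<alpha> > 2 then real n powr (2 / \<alpha>) else real n / ln (real n))"

end

theory Submission
  imports Defs "HOL-Real_Asymp.Real_Asymp"
begin

text \<open>Outside an event of small probability the field at the maximiser \<open>n\<close> exceeds the field on the rest
  of a window containing \<open>0\<close> and \<open>\<plusminus>n\<close> by a gap \<open>w\<close> of the order of the field maximum, and \<open>u(t, n)\<close> is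
  \<open>exp ((\<xi> n - 2) t)\<close> times the weight of the paths from \<open>0\<close> that stay close to \<open>n\<close> after their first
  visit, up to a factor tending to \<open>1\<close>. Since the field agrees near \<open>n\<close> and \<open>-n\<close>, only the way to the first
  visit distinguishes the two.

  Exchanging \<open>\<xi> y\<close> and \<open>\<xi> (-y)\<close> at any set of unduplicated sites \<open>y\<close> preserves the law of the field,
  so the field may be replaced by a uniformly chosen vertex of its cube of exchanges. The logarithm
  of the ratio of these weights for \<open>n\<close> and \<open>-n\<close> is odd under the exchange of all pairs, hence
  centred on the cube, and one exchange at \<open>y\<close> changes it by \<open>O(max (\<xi> y) (\<xi> (-y)) / w)\<close>.
  The Efron-Stein inequality bounds its variance by a sum of squares over the unduplicated sites,
  and \<open>\<eta> = o(\<kappa>)\<close> makes this sum \<open>o(w\<^sup>2)\<close>.\<close>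

subsection \<open>Iterated Volterra integrals and path sums\<close>

text \<open>The sites \<open>n\<close> and \<open>-n\<close> carry the same field value, so no gap
  separates them: a walk may wait at \<open>-n\<close> at no loss on its way to \<open>n\<close>.
  Such walks are removed by counting jumps. They need at least 3 n of them, and walks with n + 2 L
  jumps or more are negligible against the straight one. What remains lives in
  \<open>window n L\<close>, which leaves out \<open>-n\<close>.

  The weights are least solutions of renewal equations, so most upper bounds consist in exhibiting a
  supersolution.

  The maximiser depends on the whole field. The variance bound is therefore proved for each fixed
  \<open>n\<close>, jointly with the event that the field at \<open>n\<close> is of the order a of
  the maximum. With r = a^\<alpha> there are O(r) candidates, and this event costs O(1/r). The
  squares are truncated at order a, so their mean is O(1) for \<alpha> > 2 and O(log a) for \<alpha>
  = 2, and their sum is at most this mean times \<eta>(O(r)). It has to be o(a^2), where a^2 =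
  r^(2/\<alpha>). Up to constants, a^2 divided by the mean is \<kappa>(r), which is how \<kappa>
  arises.\<close>

definition volt :: "real \<Rightarrow> (real \<Rightarrow> ennreal) \<Rightarrow> real \<Rightarrow> ennreal" where
  "volt l f t = (\<integral>\<^sup>+ s. ennreal (exp (l * s)) * f (t - s) * indicator {0..t} s \<partial>lborel)"

lemma volt_measurable [measurable]:
  assumes [measurable]: "f \<in> borel_measurable borel"
  shows "volt l f \<in> borel_measurable borel"
proof -
  have "(\<lambda>t. \<integral>\<^sup>+ s. ennreal (exp (l * s)) * f (t - s) * indicator {x. 0 \<le> snd x \<and> snd x \<le> fst x} (t, s) \<partial>lborel)
     \<in> borel_measurable borel"
    by measurable
  moreover have "(\<lambda>t. \<integral>\<^sup>+ s. ennreal (exp (l * s)) * f (t - s) * indicator {x. 0 \<le> snd x \<and> snd x \<le> fst x} (t, s) \<partial>lborel) = volt l f"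
    by (auto simp: fun_eq_iff volt_def indicator_def intro!: nn_integral_cong)
  ultimately show ?thesis by simp
qed

lemma volt_mono:
  assumes "l \<le> l'" "\<And>s. 0 \<le> s \<Longrightarrow> s \<le> t \<Longrightarrow> f s \<le> g s"
  shows "volt l f t \<le> volt l' g t"
  unfolding volt_def
proof (rule nn_integral_mono)
  fix s :: real
  show "ennreal (exp (l * s)) * f (t - s) * indicator {0..t} s
      \<le> ennreal (exp (l' * s)) * g (t - s) * indicator {0..t} s"
  proof (cases "s \<in> {0..t}")
    case True
    then have "l * s \<le> l' * s" using assms(1) by (auto intro: mult_right_mono)
    then show ?thesis using True assms(2)[of "t - s"]
      by (auto intro!: mult_mono ennreal_leI)
  qed simp
qed

lemma volt_add:
  assumes [measurable]: "f \<in> borel_measurable borel" "g \<in> borel_measurable borel"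
  shows "volt l (\<lambda>s. f s + g s) t = volt l f t + volt l g t"
  unfolding volt_def
  by (subst nn_integral_add[symmetric]) (auto simp: distrib_left distrib_right)

lemma volt_cmult:
  assumes [measurable]: "f \<in> borel_measurable borel"
  shows "volt l (\<lambda>s. c * f s) t = c * volt l f t"
proof -
  have "volt l (\<lambda>s. c * f s) t = (\<integral>\<^sup>+ s. c * (ennreal (exp (l * s)) * f (t - s) * indicator {0..t} s) \<partial>lborel)"
    unfolding volt_def by (simp add: mult_ac)
  also have "\<dots> = c * volt l f t"
    unfolding volt_def by (rule nn_integral_cmult) measurable
  finally show ?thesis .
qed

lemma volt_suminf:
  assumes [measurable]: "\<And>i. f i \<in> borel_measurable borel"
  shows "volt l (\<lambda>s. \<Sum>i. f i s) t = (\<Sum>i. volt l (f i) t)"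
proof -
  have "volt l (\<lambda>s. \<Sum>i. f i s) t = (\<integral>\<^sup>+ s. (\<Sum>i. ennreal (exp (l * s)) * f i (t - s) * indicator {0..t} s) \<partial>lborel)"
    unfolding volt_def by simp
  also have "\<dots> = (\<Sum>i. volt l (f i) t)"
    unfolding volt_def by (rule nn_integral_suminf) measurable
  finally show ?thesis .
qed

lemma volt_exp_shift:
  assumes [measurable]: "f \<in> borel_measurable borel"
  shows
  "volt l (\<lambda>s. ennreal (exp (c * s)) * f s) t = ennreal (exp (c * t)) * volt (l - c) f t"
proof -
  have "volt l (\<lambda>s. ennreal (exp (c * s)) * f s) t =
    (\<integral>\<^sup>+ s. ennreal (exp (c * t)) * (ennreal (exp ((l - c) * s)) * f (t - s) * indicator {0..t} s) \<partial>lborel)"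
    unfolding volt_def
  proof (rule nn_integral_cong)
    fix s :: real
    have "ennreal (exp (l * s)) * ennreal (exp (c * (t - s))) = ennreal (exp (c * t)) * ennreal (exp ((l - c) * s))"
      by (simp add: ennreal_mult'[symmetric] exp_add[symmetric] algebra_simps)
    then show "ennreal (exp (l * s)) * (ennreal (exp (c * (t - s))) * f (t - s)) * indicator {0..t} s =
         ennreal (exp (c * t)) * (ennreal (exp ((l - c) * s)) * f (t - s) * indicator {0..t} s)"
      by (metis (no_types, lifting) mult.assoc)
  qed
  also have "\<dots> = ennreal (exp (c * t)) * volt (l - c) f t"
    unfolding volt_def by (rule nn_integral_cmult) measurable
  finally show ?thesis .
qed

lemma volt_mono_on:
  assumes "mono_on {0..} f"
  shows "mono_on {0..} (volt l f)"
proof (rule mono_onI)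
  fix s t :: real assume st: "s \<in> {0..}" "t \<in> {0..}" "s \<le> t"
  show "volt l f s \<le> volt l f t"
    unfolding volt_def
  proof (rule nn_integral_mono)
    fix u
    show "ennreal (exp (l * u)) * f (s - u) * indicator {0..s} u
      \<le> ennreal (exp (l * u)) * f (t - u) * indicator {0..t} u"
    proof (cases "u \<in> {0..s}")
      case True
      then have "f (s - u) \<le> f (t - u)" using st by (intro mono_onD[OF assms]) auto
      then show ?thesis using True st by (auto intro!: mult_left_mono)
    qed simp
  qed
qed

lemma volt_1:
  assumes "l \<noteq> 0" "0 \<le> t"
  shows "volt l (\<lambda>_. 1) t = ennreal ((exp (l * t) - 1) / l)"
proof -
  have "volt l (\<lambda>_. 1) t = (\<integral>\<^sup>+ s. ennreal (exp (l * s)) * indicator {0..t} s \<partial>lborel)"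
    by (simp add: volt_def)
  also have "\<dots> = ennreal (exp (l * t) / l - exp (l * 0) / l)"
    using assms
    by (intro nn_integral_FTC_Icc[where F="\<lambda>s. exp (l * s) / l"])
       (auto intro!: derivative_eq_intros simp: has_real_derivative_iff_has_vector_derivative[symmetric])
  finally show ?thesis by (simp add: diff_divide_distrib)
qed

text \<open>A monotone \<open>f\<close> is at most \<open>f t\<close> on the whole range and exp(-w
  s) has integral at most 1/w: one stay at rate -w costs a factor 1/w.\<close>

lemma volt_neg_le:
  assumes "w > 0" "mono_on {0..} f" "0 \<le> t"
  shows "volt (- w) f t \<le> ennreal (1 / w) * f t"
proof -
  have "volt (- w) f t \<le> volt (- w) (\<lambda>_. f t * 1) t"
    using assms by (intro volt_mono) (auto intro!: mono_onD[OF assms(2)])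
  also have "\<dots> = f t * volt (- w) (\<lambda>_. 1) t"
    by (subst volt_cmult) auto
  also have "\<dots> \<le> f t * ennreal (1 / w)"
    using assms by (subst volt_1) (auto intro!: mult_left_mono ennreal_leI simp: field_simps)
  finally show ?thesis by (simp add: mult.commute)
qed

text \<open>Keeps only the stays of length at most \<open>s\<close>.\<close>

lemma volt_ge:
  assumes "w > 0" "0 \<le> s" "s \<le> t" "\<And>u. t - s \<le> u \<Longrightarrow> u \<le> t \<Longrightarrow> c \<le> f u"
  shows "ennreal ((1 - exp (- w * s)) / w) * c \<le> volt (- w) f t"
proof -
  have "ennreal ((1 - exp (- w * s)) / w) * c = volt (- w) (\<lambda>_. 1) s * c"
    using assms by (subst volt_1) (auto simp: field_simps minus_divide_left)
  also have "\<dots> = c * volt (- w) (\<lambda>_. 1) s" by (rule mult.commute)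
  also have "\<dots> = volt (- w) (\<lambda>_. c * 1) s"
    by (subst volt_cmult) auto
  also have "\<dots> \<le> volt (- w) f t"
    unfolding volt_def
  proof (rule nn_integral_mono)
    fix x
    show "ennreal (exp (- w * x)) * (c * 1) * indicator {0..s} x
      \<le> ennreal (exp (- w * x)) * f (t - x) * indicator {0..t} x"
      using assms(3) assms(4)[of "t - x"] by (cases "x \<in> {0..s}") (auto intro!: mult_left_mono)
  qed
  finally show ?thesis .
qed

text \<open>Stretching time by w/w' turns one exponential into the other. The integrand then looks
  further back, where a monotone \<open>f\<close> is smaller.\<close>

lemma volt_rate_scale:
  assumes "0 < w'" "w' \<le> w" "mono_on {0..} f" and [measurable]: "f \<in> borel_measurable borel"
  shows "volt (- w') f t \<le> ennreal (w / w') * volt (- w) f t"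
proof -
  let ?c = "w / w'"
  have c: "?c \<ge> 1" using assms by simp
  have "volt (- w') f t = ennreal \<bar>?c\<bar> * (\<integral>\<^sup>+ s. ennreal (exp (- w' * (0 + ?c * s))) * f (t - (0 + ?c * s)) * indicator {0..t} (0 + ?c * s) \<partial>lborel)"
    unfolding volt_def using assms by (intro nn_integral_real_affine) auto
  also have "(\<integral>\<^sup>+ s. ennreal (exp (- w' * (0 + ?c * s))) * f (t - (0 + ?c * s)) * indicator {0..t} (0 + ?c * s) \<partial>lborel)
     \<le> volt (- w) f t"
    unfolding volt_def
  proof (rule nn_integral_mono)
    fix s
    show "ennreal (exp (- w' * (0 + ?c * s))) * f (t - (0 + ?c * s)) * indicator {0..t} (0 + ?c * s)
      \<le> ennreal (exp (- w * s)) * f (t - s) * indicator {0..t} s"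
    proof (cases "0 + ?c * s \<in> {0..t}")
      case True
      then have "0 \<le> ?c * s" by simp
      then have s0: "0 \<le> s" using c by (simp only: zero_le_mult_iff) linarith
      have "s \<le> ?c * s" using c s0 mult_right_mono[of 1 ?c s] by simp
      moreover have "f (t - (0 + ?c * s)) \<le> f (t - s)"
        using True s0 \<open>s \<le> ?c * s\<close> by (intro mono_onD[OF assms(3)]) auto
      ultimately show ?thesis using True s0 assms by (auto intro!: mult_left_mono)
    qed simp
  qed
  finally show ?thesis using c assms(1,2) by (simp add: mult_left_mono)
qed

text \<open>Resolvent identity 1/x = 1/(x + k) + k/((x + k) x), read through the Laplace transform.
  It serves to trade a lower rate at the target for a return term.\<close>

lemma volt_resolvent:
  assumes [measurable]: "q \<in> borel_measurable borel" and k: "k > 0"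
  shows "volt 0 q t = volt (- k) q t + ennreal k * volt (- k) (volt 0 q) t"
proof -
  \<comment> \<open>With p = s + r the total time elapsed becomes the common variable, and Fubini
    applies.\<close>
  have in1: "volt 0 q (t - s) = (\<integral>\<^sup>+ p. q (t - p) * indicator {s..t} p \<partial>lborel)" for s
  proof -
    have "volt 0 q (t - s) = (\<integral>\<^sup>+ r. q (t - s - r) * indicator {0..t - s} r \<partial>lborel)"
      by (simp add: volt_def)
    also have "\<dots> = ennreal \<bar>1\<bar> * (\<integral>\<^sup>+ p. q (t - s - (- s + 1 * p)) * indicator {0..t - s} (- s + 1 * p) \<partial>lborel)"
      by (intro nn_integral_real_affine) auto
    also have "\<dots> = (\<integral>\<^sup>+ p. q (t - p) * indicator {s..t} p \<partial>lborel)"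
      by (auto intro!: nn_integral_cong simp: indicator_def)
    finally show ?thesis .
  qed
  have "volt (- k) (volt 0 q) t =
      (\<integral>\<^sup>+ s. (\<integral>\<^sup>+ p. ennreal (exp (- k * s)) * q (t - p) * indicator {x. 0 \<le> fst x \<and> fst x \<le> snd x \<and> snd x \<le> t} (s, p) \<partial>lborel) \<partial>lborel)"
    unfolding volt_def[of "- k"] in1
    by (subst nn_integral_cmult[symmetric], measurable, subst nn_integral_multc[symmetric], measurable)
       (auto intro!: nn_integral_cong simp: indicator_def mult_ac)
  also have "\<dots> = (\<integral>\<^sup>+ p. (\<integral>\<^sup>+ s. ennreal (exp (- k * s)) * q (t - p) * indicator {x. 0 \<le> fst x \<and> fst x \<le> snd x \<and> snd x \<le> t} (s, p) \<partial>lborel) \<partial>lborel)"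
    by (intro lborel_pair.Fubini') measurable
  also have "\<dots> = (\<integral>\<^sup>+ p. q (t - p) * volt (- k) (\<lambda>_. 1) p * indicator {0..t} p \<partial>lborel)"
    unfolding volt_def
    by (subst nn_integral_cmult[symmetric], measurable, subst nn_integral_multc[symmetric], measurable)
       (auto intro!: nn_integral_cong simp: indicator_def mult_ac)
  also have "\<dots> = (\<integral>\<^sup>+ p. q (t - p) * ennreal ((1 - exp (- k * p)) / k) * indicator {0..t} p \<partial>lborel)"
    using k by (intro nn_integral_cong) (auto simp: indicator_def volt_1 field_simps minus_divide_left)
  finally have "ennreal k * volt (- k) (volt 0 q) t =
     (\<integral>\<^sup>+ p. ennreal k * (q (t - p) * ennreal ((1 - exp (- k * p)) / k) * indicator {0..t} p) \<partial>lborel)"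
    by (simp add: nn_integral_cmult)
  then have "volt (- k) q t + ennreal k * volt (- k) (volt 0 q) t =
     (\<integral>\<^sup>+ p. ennreal (exp (- k * p)) * q (t - p) * indicator {0..t} p
        + ennreal k * (q (t - p) * ennreal ((1 - exp (- k * p)) / k) * indicator {0..t} p) \<partial>lborel)"
    unfolding volt_def[of _ q] by (simp add: nn_integral_add)
  also have "\<dots> = (\<integral>\<^sup>+ p. q (t - p) * indicator {0..t} p \<partial>lborel)"
  proof (rule nn_integral_cong)
    fix p
    show "ennreal (exp (- k * p)) * q (t - p) * indicator {0..t} p
        + ennreal k * (q (t - p) * ennreal ((1 - exp (- k * p)) / k) * indicator {0..t} p)
        = q (t - p) * indicator {0..t} p"
    proof (cases "p \<in> {0..t}")
      case True
      have "ennreal (exp (- k * p)) + ennreal k * ennreal ((1 - exp (- k * p)) / k) = 1"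
        using k True by (simp add: ennreal_mult'[symmetric] ennreal_plus[symmetric] del: ennreal_plus)
      then have "(ennreal (exp (- k * p)) + ennreal k * ennreal ((1 - exp (- k * p)) / k)) * q (t - p) = q (t - p)"
        by simp
      then show ?thesis using True by (simp add: ring_distribs mult_ac)
    qed simp
  qed
  finally show ?thesis by (simp add: volt_def)
qed

text \<open>One more stay at a rate at most \<open>M\<close> integrates s^j/j! once more, with exp(M
  t) as common factor.\<close>

lemma volt_exp_power_le:
  assumes "l \<le> M" "0 \<le> t"
  shows "volt l (\<lambda>s. ennreal (exp (M * s)) * ennreal (s ^ j / fact j)) t
       \<le> ennreal (exp (M * t)) * ennreal (t ^ Suc j / fact (Suc j))"
proof -
  have "volt l (\<lambda>s. ennreal (exp (M * s)) * ennreal (s ^ j / fact j)) t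
      = ennreal (exp (M * t)) * volt (l - M) (\<lambda>s. ennreal (s ^ j / fact j)) t"
    by (subst volt_exp_shift) auto
  also have "\<dots> \<le> ennreal (exp (M * t)) * volt 0 (\<lambda>s. ennreal (s ^ j / fact j)) t"
    using assms by (intro mult_left_mono volt_mono) auto
  also have "volt 0 (\<lambda>s. ennreal (s ^ j / fact j)) t = ennreal (- ((t - t) ^ Suc j / fact (Suc j)) - - ((t - 0) ^ Suc j / fact (Suc j)))"
    unfolding volt_def mult_zero_left exp_zero ennreal_1 mult_1
    using assms
    apply (intro nn_integral_FTC_Icc[where F="\<lambda>s. - ((t - s) ^ Suc j / fact (Suc j))"])
    by (auto intro!: derivative_eq_intros simp: field_simps has_real_derivative_iff_has_vector_derivative[symmetric] simp del: power_Suc fact_Suc)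
       (simp_all add: field_simps)
  finally show ?thesis by simp
qed

text \<open>Term \<open>k\<close> of \<open>green l S g\<close> is the weight of the walks that leave \<open>k\<close> sites of \<open>S\<close> and then collect
  \<open>g\<close> at the remaining time; \<open>l\<close> is the exponential rate accumulated at a site, jump rate included.\<close>

primrec psum :: "(int \<Rightarrow> real) \<Rightarrow> int set \<Rightarrow> (int \<Rightarrow> real \<Rightarrow> ennreal) \<Rightarrow> nat \<Rightarrow> int \<Rightarrow> real \<Rightarrow> ennreal" where
  "psum l S g 0 = g"
| "psum l S g (Suc k) =
     (\<lambda>a t. if a \<in> S then volt (l a) (\<lambda>s. psum l S g k (a - 1) s + psum l S g k (a + 1) s) t else 0)"

definition green :: "(int \<Rightarrow> real) \<Rightarrow> int set \<Rightarrow> (int \<Rightarrow> real \<Rightarrow> ennreal) \<Rightarrow> int \<Rightarrow> real \<Rightarrow> ennreal" where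
  "green l S g a t = (\<Sum>k. psum l S g k a t)"

text \<open>\<open>v\<close> is the reward for arriving at \<open>n\<close>, as a function of the
  time that is left.\<close>

definition src :: "int \<Rightarrow> (real \<Rightarrow> ennreal) \<Rightarrow> int \<Rightarrow> real \<Rightarrow> ennreal" where
  "src n v a t = (if a = n then v t else 0)"

lemma src_measurable [measurable (raw)]: "v \<in> borel_measurable borel \<Longrightarrow> src n v a \<in> borel_measurable borel"
  by (cases "a = n") (auto simp: src_def[abs_def])

lemma src_mono_on: "mono_on {0..} v \<Longrightarrow> mono_on {0..} (src n v a)"
  by (auto simp: src_def mono_on_def)

lemma psum_measurable:
  assumes "\<And>a. g a \<in> borel_measurable borel"
  shows "psum l S g k a \<in> borel_measurable borel"
proof (induction k arbitrary: a)
  case 0 then show ?case using assms by simp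
next
  case (Suc k)
  note [measurable] = Suc
  show ?case by (cases "a \<in> S") simp_all
qed

lemma green_measurable:
  assumes "\<And>a. g a \<in> borel_measurable borel"
  shows "green l S g a \<in> borel_measurable borel"
proof -
  note [measurable] = psum_measurable[OF assms]
  show ?thesis unfolding green_def[abs_def] by measurable
qed

lemma psum_mono_on:
  assumes "\<And>a. mono_on {0..} (g a)"
  shows "mono_on {0..} (psum l S g k a)"
proof (induction k arbitrary: a)
  case 0 then show ?case using assms by simp
next
  case (Suc k)
  have "mono_on {0..} (\<lambda>s. psum l S g k (a - 1) s + psum l S g k (a + 1) s)"
    using Suc by (auto simp: mono_on_def intro!: add_mono)
  then have "mono_on {0..} (volt (l a) (\<lambda>s. psum l S g k (a - 1) s + psum l S g k (a + 1) s))"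
    by (rule volt_mono_on)
  then show ?case by (auto simp: mono_on_def)
qed

lemma green_mono_on:
  assumes "\<And>a. mono_on {0..} (g a)"
  shows "mono_on {0..} (green l S g a)"
  using psum_mono_on[OF assms] by (auto simp: mono_on_def green_def intro!: suminf_le)

lemma ennreal_mult_mult: "0 \<le> c \<Longrightarrow> 0 \<le> d \<Longrightarrow> ennreal c * (ennreal d * x) = ennreal (d * c) * x"
  by (simp add: ennreal_mult mult_ac)

lemma ennreal_suminf_Suc: "(\<Sum>k. f k :: ennreal) = f 0 + (\<Sum>k. f (Suc k))"
proof -
  have "(\<lambda>k. f (Suc k)) sums (\<Sum>k. f (Suc k))" by (rule summable_sums) simp
  then have "f sums ((\<Sum>k. f (Suc k)) + f 0)" by (rule sums_Suc)
  then show ?thesis by (simp add: sums_iff add.commute)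
qed

section \<open>Renewal equation and supersolutions\<close>

lemma green_eq:
  assumes "\<And>a. g a \<in> borel_measurable borel"
  shows "green l S g a t = g a t +
    (if a \<in> S then volt (l a) (\<lambda>s. green l S g (a - 1) s + green l S g (a + 1) s) t else 0)"
proof -
  note [measurable] = psum_measurable[OF assms]
  have "volt (l a) (\<lambda>s. green l S g (a - 1) s + green l S g (a + 1) s) t
    = volt (l a) (\<lambda>s. \<Sum>k. psum l S g k (a - 1) s + psum l S g k (a + 1) s) t"
    unfolding green_def by (simp add: suminf_add)
  also have "\<dots> = (\<Sum>k. volt (l a) (\<lambda>s. psum l S g k (a - 1) s + psum l S g k (a + 1) s) t)"
    by (rule volt_suminf) measurable
  finally have "volt (l a) (\<lambda>s. green l S g (a - 1) s + green l S g (a + 1) s) t = \<dots>" .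
  then show ?thesis unfolding green_def by (subst ennreal_suminf_Suc) auto
qed

text \<open>\<open>green\<close> is the least solution of its renewal equation: partial sums stay
  below any supersolution, by induction on the number of terms, since adding a term amounts to
  applying the equation once. Most upper bounds below are instances, with \<open>\<phi>\<close> as
  the guess.\<close>

lemma green_le:
  assumes g: "\<And>a. g a \<in> borel_measurable borel"
    and sup: "\<And>a t. 0 \<le> t \<Longrightarrow> g a t +
      (if a \<in> S then volt (l a) (\<lambda>s. \<phi> (a - 1) s + \<phi> (a + 1) s) t else 0) \<le> \<phi> a t"
    and t: "0 \<le> t"
  shows "green l S g a t \<le> \<phi> a t"
proof -
  note [measurable] = psum_measurable[OF g]
  have "(\<Sum>k<K. psum l S g k a t) \<le> \<phi> a t" if "0 \<le> t" for K a t
    using that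
  proof (induction K arbitrary: a t)
    case (Suc K)
    have *: "volt (l a) (\<lambda>s. \<Sum>k<K. psum l S g k (a - 1) s + psum l S g k (a + 1) s) t
      = (\<Sum>k<K. volt (l a) (\<lambda>s. psum l S g k (a - 1) s + psum l S g k (a + 1) s) t)"
    proof (induction K)
      case 0 then show ?case by (simp add: volt_def)
    next
      case (Suc K) then show ?case by (simp, subst volt_add) auto
    qed
    have "(\<Sum>k<Suc K. psum l S g k a t) = g a t +
      (if a \<in> S then volt (l a) (\<lambda>s. \<Sum>k<K. psum l S g k (a - 1) s + psum l S g k (a + 1) s) t else 0)"
      unfolding * by (subst sum.lessThan_Suc_shift) simp
    also have "\<dots> \<le> g a t +
      (if a \<in> S then volt (l a) (\<lambda>s. \<phi> (a - 1) s + \<phi> (a + 1) s) t else 0)"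
      using Suc by (auto intro!: add_left_mono volt_mono add_mono simp: sum.distrib)
    also have "\<dots> \<le> \<phi> a t" using sup Suc by simp
    finally show ?case .
  qed simp
  then show ?thesis unfolding green_def using t by (intro suminf_le_const) auto
qed

text \<open>The right side is a supersolution of the equation of the left side.\<close>

lemma green_mono_set:
  assumes g: "\<And>a. g a \<in> borel_measurable borel" and "S \<subseteq> S'" "\<And>a. a \<in> S \<Longrightarrow> l a \<le> l' a" "0 \<le> t"
  shows "green l S g a t \<le> green l' S' g a t"
proof (rule green_le[OF g _ \<open>0 \<le> t\<close>])
  fix a t
  show "g a t + (if a \<in> S then volt (l a) (\<lambda>s. green l' S' g (a - 1) s + green l' S' g (a + 1) s) t else 0)
     \<le> green l' S' g a t"
    using assms by (subst (3) green_eq[OF g]) (auto intro!: add_left_mono volt_mono)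
qed

text \<open>Each stay costs 1/w by \<open>volt_neg_le\<close> and is followed by one of two jumps,
  so (2/w)^distance is a supersolution. The bound \<open>w \<ge> 2\<close> makes these powers
  decrease with the distance.\<close>

lemma green_src_le:
  assumes v[measurable]: "v \<in> borel_measurable borel" and mv: "mono_on {0..} v"
    and n: "n \<notin> S" and w: "w \<ge> 2" "\<And>a. a \<in> S \<Longrightarrow> l a \<le> - w" and t: "0 \<le> t"
  shows "green l S (src n v) a t \<le> ennreal ((2 / w) ^ nat \<bar>a - n\<bar>) * v t"
proof (rule green_le[OF _ _ t])
  fix a t assume t: "0 \<le> (t::real)"
  let ?r = "\<lambda>a. (2 / w) ^ nat \<bar>a - n\<bar>"
  show "src n v a t + (if a \<in> S then volt (l a) (\<lambda>s. ennreal (?r (a - 1)) * v s + ennreal (?r (a + 1)) * v s) t else 0)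
    \<le> ennreal (?r a) * v t"
  proof (cases "a \<in> S")
    case True
    then have an: "a \<noteq> n" using n by auto
    have le1: "(2 / w) \<le> 1" "0 \<le> 2 / w" using w by auto
    have "?r (a - 1) \<le> (2 / w) ^ (nat \<bar>a - n\<bar> - 1)" "?r (a + 1) \<le> (2 / w) ^ (nat \<bar>a - n\<bar> - 1)"
      using le1 by (auto intro!: power_decreasing)
    then have "?r (a - 1) + ?r (a + 1) \<le> 2 * (2 / w) ^ (nat \<bar>a - n\<bar> - 1)" by linarith
    then have "(1 / w) * (?r (a - 1) + ?r (a + 1)) \<le> (1 / w) * (2 * (2 / w) ^ (nat \<bar>a - n\<bar> - 1))"
      using w by (intro mult_left_mono) auto
    also have "\<dots> = (2 / w) ^ Suc (nat \<bar>a - n\<bar> - 1)" by simp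
    also have "\<dots> = ?r a" using an by (metis Suc_pred' zero_less_nat_eq zero_less_abs_iff right_minus_eq diff_Suc_1 Suc_diff_1)
    finally have *: "(1 / w) * (?r (a - 1) + ?r (a + 1)) \<le> ?r a" .
    have "volt (l a) (\<lambda>s. ennreal (?r (a - 1)) * v s + ennreal (?r (a + 1)) * v s) t
      \<le> volt (- w) (\<lambda>s. ennreal (?r (a - 1)) * v s + ennreal (?r (a + 1)) * v s) t"
      using w True by (intro volt_mono) auto
    also have "\<dots> = volt (- w) (\<lambda>s. ennreal (?r (a - 1) + ?r (a + 1)) * v s) t"
      using w by (simp add: distrib_right)
    also have "\<dots> = ennreal (?r (a - 1) + ?r (a + 1)) * volt (- w) v t"
      by (rule volt_cmult) measurable
    also have "\<dots> \<le> ennreal (?r (a - 1) + ?r (a + 1)) * (ennreal (1 / w) * v t)"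
      using w mv t by (intro mult_left_mono volt_neg_le) auto
    also have "\<dots> = ennreal ((1 / w) * (?r (a - 1) + ?r (a + 1))) * v t"
      using w by (intro ennreal_mult_mult) auto
    also have "\<dots> \<le> ennreal (?r a) * v t"
      using * by (intro mult_right_mono ennreal_leI) auto
    finally show ?thesis using True an by (simp add: src_def)
  qed (auto simp: src_def)
qed measurable

lemma ennreal_distrib_real: "0 \<le> c \<Longrightarrow> 0 \<le> d \<Longrightarrow> ennreal c * x + ennreal d * x = ennreal (c + d) * x"
  by (simp add: distrib_right)

text \<open>Only walks through \<open>y\<close> feel the change, so the guess is the old weight
  \<open>\<psi>\<close> plus \<open>e\<close> times the part \<open>\<theta>\<close> of it that
  visits \<open>y\<close>. Visits may be repeated, but each return costs at most 2/w, hence at most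
  1/2, and the factor 2 in \<open>2 * h / w\<close> absorbs the resulting geometric sum.\<close>

lemma green_single_site:
  assumes v[measurable]: "v \<in> borel_measurable borel" and mv: "mono_on {0..} v"
    and n: "n \<notin> S" and w: "w \<ge> 4" "\<And>a. a \<in> S \<Longrightarrow> l a \<le> - w" "\<And>a. a \<in> S \<Longrightarrow> l' a \<le> - w"
    and y: "y \<in> S" "\<And>a. a \<noteq> y \<Longrightarrow> l' a = l a" "0 \<le> h" "l' y = l y + h" and t: "0 \<le> t"
  shows "green l' S (src n v) a t \<le> ennreal (1 + 2 * h / w) * green l S (src n v) a t"
proof -
  define \<psi> where "\<psi> = green l S (src n v)"
  have [measurable]: "src n v b \<in> borel_measurable borel" for b by measurable
  have [measurable]: "\<psi> b \<in> borel_measurable borel" for b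
    unfolding \<psi>_def by (rule green_measurable) measurable
  have m\<psi>: "mono_on {0..} (\<psi> b)" for b
    unfolding \<psi>_def using mv by (intro green_mono_on src_mono_on)
  have \<psi>_eq: "\<psi> b s = src n v b s + (if b \<in> S then volt (l b) (\<lambda>s. \<psi> (b - 1) s + \<psi> (b + 1) s) s else 0)" for b s
    unfolding \<psi>_def by (rule green_eq) measurable
  \<comment> \<open>First passage to \<open>y\<close>, followed by the old weight from
    \<open>y\<close>.\<close>
  define \<theta> where "\<theta> = green l (S - {y}) (src y (\<psi> y))"
  have [measurable]: "\<theta> b \<in> borel_measurable borel" for b
    unfolding \<theta>_def by (rule green_measurable) measurable
  have \<theta>_eq: "\<theta> b s = src y (\<psi> y) b s + (if b \<in> S - {y} then volt (l b) (\<lambda>s. \<theta> (b - 1) s + \<theta> (b + 1) s) s else 0)" for b s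
    unfolding \<theta>_def by (rule green_eq) measurable
  have \<theta>_le_\<psi>: "\<theta> b s \<le> \<psi> b s" if "0 \<le> s" for b s
    unfolding \<theta>_def
  proof (rule green_le[OF _ _ that])
    fix b s
    show "src y (\<psi> y) b s + (if b \<in> S - {y} then volt (l b) (\<lambda>s. \<psi> (b - 1) s + \<psi> (b + 1) s) s else 0) \<le> \<psi> b s"
      by (cases "b = y") (auto simp: src_def \<psi>_eq[of b s])
  qed measurable
  have \<theta>_le_y: "\<theta> b s \<le> \<psi> y s" if "0 \<le> s" for b s
  proof -
    have "\<theta> b s \<le> ennreal ((2 / w) ^ nat \<bar>b - y\<bar>) * \<psi> y s"
      unfolding \<theta>_def using w that by (intro green_src_le m\<psi>) auto
    also have "\<dots> \<le> 1 * \<psi> y s"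
      using w by (intro mult_right_mono) (auto intro!: power_le_one)
    finally show ?thesis by simp
  qed
  have \<theta>y: "\<theta> y s = \<psi> y s" for s
    by (subst \<theta>_eq) (simp add: src_def)
  have yn: "y \<noteq> n" using y n by auto
  define e where "e = 2 * h / w"
  have e0: "e \<ge> 0" unfolding e_def using y w by auto
  define \<phi> where "\<phi> b s = \<psi> b s + ennreal e * \<theta> b s" for b s
  have volt_\<phi>: "volt r (\<lambda>s. \<phi> (b - 1) s + \<phi> (b + 1) s) s
     = volt r (\<lambda>s. \<psi> (b - 1) s + \<psi> (b + 1) s) s + ennreal e * volt r (\<lambda>s. \<theta> (b - 1) s + \<theta> (b + 1) s) s" for r b s
  proof -
    have "volt r (\<lambda>s. \<phi> (b - 1) s + \<phi> (b + 1) s) s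
      = volt r (\<lambda>s. (\<psi> (b - 1) s + \<psi> (b + 1) s) + ennreal e * (\<theta> (b - 1) s + \<theta> (b + 1) s)) s"
      unfolding \<phi>_def by (simp add: algebra_simps)
    also have "\<dots> = volt r (\<lambda>s. \<psi> (b - 1) s + \<psi> (b + 1) s) s + volt r (\<lambda>s. ennreal e * (\<theta> (b - 1) s + \<theta> (b + 1) s)) s"
      by (rule volt_add) measurable
    also have "volt r (\<lambda>s. ennreal e * (\<theta> (b - 1) s + \<theta> (b + 1) s)) s = ennreal e * volt r (\<lambda>s. \<theta> (b - 1) s + \<theta> (b + 1) s) s"
      by (rule volt_cmult) measurable
    finally show ?thesis .
  qed
  have "green l' S (src n v) a t \<le> \<phi> a t"
  proof (rule green_le[OF _ _ t])
    fix b s assume s: "0 \<le> (s::real)"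
    show "src n v b s + (if b \<in> S then volt (l' b) (\<lambda>s. \<phi> (b - 1) s + \<phi> (b + 1) s) s else 0) \<le> \<phi> b s"
    proof (cases "b = y")
      case False
      then show ?thesis
        unfolding volt_\<phi>
        unfolding \<phi>_def
        by (subst \<psi>_eq, subst \<theta>_eq)
           (auto simp: y(2) src_def ennreal_zero_less_mult_iff intro!: add_mono)
    next
      case True
      have wy: "- l y \<ge> - l' y" "- l' y \<ge> w" "- l' y > 0" using y w w(3)[OF y(1)] by auto
      have "volt (l' y) (\<lambda>s. \<psi> (y - 1) s + \<psi> (y + 1) s) s = volt (- (- l' y)) (\<lambda>s. \<psi> (y - 1) s + \<psi> (y + 1) s) s" by simp
      \<comment> \<open>Raising the rate from \<open>l y\<close> to \<open>l' y\<close> costs their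
        quotient, which is 1 + h / (- l' y).\<close>
      also have "\<dots> \<le> ennreal (- l y / - l' y) * volt (- (- l y)) (\<lambda>s. \<psi> (y - 1) s + \<psi> (y + 1) s) s"
        using wy m\<psi> by (intro volt_rate_scale) (auto simp: mono_on_def intro!: add_mono)
      also have "volt (- (- l y)) (\<lambda>s. \<psi> (y - 1) s + \<psi> (y + 1) s) s = \<psi> y s"
        using y yn by (subst \<psi>_eq) (simp add: src_def)
      also have "ennreal (- l y / - l' y) * \<psi> y s \<le> ennreal (1 + h / w) * \<psi> y s"
      proof (intro mult_right_mono ennreal_leI)
        have "- l y / - l' y = 1 + h / (- l' y)" using wy y(4) by (simp add: field_simps)
        also have "\<dots> \<le> 1 + h / w" using wy y(3) w(1) by (intro add_left_mono divide_left_mono) (auto simp: mult_neg_pos)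
        finally show "- l y / - l' y \<le> 1 + h / w" .
      qed simp
      finally have 1: "volt (l' y) (\<lambda>s. \<psi> (y - 1) s + \<psi> (y + 1) s) s \<le> ennreal (1 + h / w) * \<psi> y s" .
      have "volt (l' y) (\<lambda>s. \<theta> (y - 1) s + \<theta> (y + 1) s) s \<le> volt (- w) (\<lambda>s. ennreal 2 * \<psi> y s) s"
        using wy \<theta>_le_y by (intro volt_mono) (auto intro!: add_mono simp: mult_2)
      also have "\<dots> \<le> ennreal (1 / w) * (ennreal 2 * \<psi> y s)"
        using w s m\<psi>[of y] by (intro volt_neg_le) (auto simp: mono_on_def intro!: mult_left_mono)
      finally have 2: "ennreal e * volt (l' y) (\<lambda>s. \<theta> (y - 1) s + \<theta> (y + 1) s) s \<le> ennreal e * (ennreal (1 / w) * (ennreal 2 * \<psi> y s))"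
        by (rule mult_left_mono) simp
      have 3: "ennreal e * (ennreal (1 / w) * (ennreal 2 * \<psi> y s)) = ennreal (2 * (1 / w) * e) * \<psi> y s"
        using e0 w ennreal_mult_mult[of e "1 / w" "ennreal 2 * \<psi> y s"] ennreal_mult_mult[of "1 / w * e" 2 "\<psi> y s"]
          by (simp only: mult.assoc) simp
      \<comment> \<open>This fixes \<open>e\<close>: with e = 2 h / w, the direct cost h / w and
        half of \<open>e\<close> add up to \<open>e\<close>.\<close>
      have "2 * (1 / w) * e \<le> (1 / 2) * e" using w(1) e0 by (intro mult_right_mono) (auto simp: field_simps)
      then have 4: "h / w + 2 * (1 / w) * e \<le> e" unfolding e_def by simp
      have "src n v b s + (if b \<in> S then volt (l' b) (\<lambda>s. \<phi> (b - 1) s + \<phi> (b + 1) s) s else 0)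
         \<le> ennreal (1 + h / w) * \<psi> y s + ennreal (2 * (1 / w) * e) * \<psi> y s"
        using y True yn 1 2 unfolding 3 volt_\<phi> by (auto simp: src_def intro!: add_mono)
      also have "\<dots> = ennreal (1 + h / w + 2 * (1 / w) * e) * \<psi> y s"
        using y w e0 by (intro ennreal_distrib_real) auto
      also have "\<dots> \<le> ennreal (1 + e) * \<psi> y s" using 4 by (intro mult_right_mono ennreal_leI) auto
      also have "\<dots> = \<phi> b s" using True e0 by (simp add: \<phi>_def \<theta>y distrib_right)
      finally show ?thesis .
    qed
  qed measurable
  also have "\<phi> a t \<le> \<psi> a t + ennreal e * \<psi> a t"
    unfolding \<phi>_def using t by (intro add_left_mono mult_left_mono \<theta>_le_\<psi>) auto
  also have "\<dots> = ennreal (1 + e) * \<psi> a t" using e0 by (simp add: distrib_right)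
  finally show ?thesis unfolding \<psi>_def e_def .
qed

section \<open>First passage to the target and loops around it\<close>

text \<open>Walks are cut at their first visit to \<open>n\<close>. Confining the loops made
  afterwards to \<open>J\<close> only loses weight.\<close>

lemma green_first_passage_le:
  assumes I: "n \<in> I" "J \<subseteq> I" and t: "0 \<le> t"
  shows "green l (I - {n}) (src n (green l J (src n (\<lambda>_. 1)) n)) a t \<le> green l I (src n (\<lambda>_. 1)) a t"
proof (rule green_le[OF _ _ t])
  have [measurable]: "src n (\<lambda>_. 1) b \<in> borel_measurable borel" for b by measurable
  have [measurable]: "green l J (src n (\<lambda>_. 1)) b \<in> borel_measurable borel" for b
    by (rule green_measurable) measurable
  show "src n (green l J (src n (\<lambda>_. 1)) n) b \<in> borel_measurable borel" for b by measurable
  fix b s assume s: "0 \<le> (s::real)"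
  show "src n (green l J (src n (\<lambda>_. 1)) n) b s + (if b \<in> I - {n} then volt (l b)
     (\<lambda>s. green l I (src n (\<lambda>_. 1)) (b - 1) s + green l I (src n (\<lambda>_. 1)) (b + 1) s) s else 0)
    \<le> green l I (src n (\<lambda>_. 1)) b s"
  proof (cases "b = n")
    case True
    then show ?thesis using I s by (auto simp: src_def[of n "green l J (src n (\<lambda>_. 1)) n"] intro!: green_mono_set)
  next
    case False
    then show ?thesis by (subst green_eq) (auto simp: src_def)
  qed
qed

text \<open>A loop at \<open>n\<close> that leaves \<open>J\<close> makes at least 2 K - 1 stays
  away from \<open>n\<close>, each paid with 2/w; the stay at \<open>n\<close> itself has rate 0 and
  is free. With two directions to start in, such excursions occur at rate at most
  \<open>\<kappa>\<close>, and over time \<open>t\<close> they account for the factor exp(\<kappa>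
  t).\<close>

lemma green_le_exp_first_passage:
  fixes K :: nat
  assumes I: "n \<in> I" and w: "w \<ge> 2" "\<And>a. a \<in> I - {n} \<Longrightarrow> l a \<le> - w" and ln: "l n = 0"
    and K: "K \<ge> 1" "J = {a. \<bar>a - n\<bar> < int K}" "J \<subseteq> I" and t: "0 \<le> t"
  defines "v \<equiv> green l J (src n (\<lambda>_. 1)) n" and "\<kappa> \<equiv> 2 * (2 / w) ^ (2 * K - 1)"
  shows "green l I (src n (\<lambda>_. 1)) a t \<le> ennreal (exp (\<kappa> * t)) * green l (I - {n}) (src n v) a t"
proof -
  define h where "h = green l J (src n (\<lambda>_. 1))"
  have [measurable]: "src n (\<lambda>_. 1) b \<in> borel_measurable borel" for b by measurable
  have [measurable]: "h b \<in> borel_measurable borel" for b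
    unfolding h_def by (rule green_measurable) measurable
  have vh: "v = h n" by (simp add: v_def h_def)
  have [measurable]: "v \<in> borel_measurable borel" unfolding vh by measurable
  have mv: "mono_on {0..} v" unfolding v_def by (intro green_mono_on src_mono_on) (simp add: mono_on_def)
  have h_eq: "h b s = src n (\<lambda>_. 1) b s + (if b \<in> J then volt (l b) (\<lambda>s. h (b - 1) s + h (b + 1) s) s else 0)" for b s
    unfolding h_def by (rule green_eq) measurable
  define H where "H = green l (I - {n}) (src n v)"
  have [measurable]: "H b \<in> borel_measurable borel" for b
    unfolding H_def by (rule green_measurable) measurable
  have H_eq: "H b s = src n v b s + (if b \<in> I - {n} then volt (l b) (\<lambda>s. H (b - 1) s + H (b + 1) s) s else 0)" for b s
    unfolding H_def by (rule green_eq) measurable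
  define r where "r = 2 / w"
  have r: "0 < r" "r \<le> 1" using w by (auto simp: r_def)
  have Hn: "H n s = v s" for s by (subst H_eq) (simp add: src_def)
  have H_le: "H b s \<le> ennreal (r ^ nat \<bar>b - n\<bar>) * v s" if "0 \<le> s" for b s
    unfolding H_def r_def using w that mv by (intro green_src_le) auto
  \<comment> \<open>The price of going from \<open>b\<close> out to distance \<open>K\<close> and
    back to \<open>n\<close>: K - |b - n| plus \<open>K\<close> factors \<open>r\<close>.\<close>
  define e where "e b = r ^ (2 * K - nat \<bar>b - n\<bar>)" for b
  have e0: "0 \<le> e b" for b using r by (simp add: e_def)
  \<comment> \<open>The minimum makes the guess a supersolution across the edge of \<open>J\<close>.
    Next to \<open>J\<close> it must lie below \<open>H\<close> so that the equation of
    \<open>H\<close> can be used; inside, the equation of \<open>h\<close> is used as well.\<close>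
  define \<phi> where "\<phi> b s = (if b \<in> J then min (H b s) (h b s + ennreal (e b) * v s) else H b s)" for b s
  have \<phi>_H: "\<phi> b s \<le> H b s" for b s by (simp add: \<phi>_def)
  have \<phi>_h: "\<phi> b s \<le> h b s + ennreal (e b) * v s" if "\<bar>b - n\<bar> \<le> int K" "0 \<le> s" for b s
  proof (cases "b \<in> J")
    case False
    then have "nat \<bar>b - n\<bar> = K" using that K by auto
    \<comment> \<open>At distance exactly \<open>K\<close> the decay r^K of \<open>H\<close> equals
      \<open>e b\<close>, so the bound reaches one site beyond \<open>J\<close>, as the neighbours
      of sites in \<open>J\<close> require.\<close>
    then have "ennreal (r ^ nat \<bar>b - n\<bar>) = ennreal (e b)" by (simp add: e_def)
    then have "H b s \<le> ennreal (e b) * v s" using H_le[OF that(2), of b] by simp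
    then show ?thesis using False by (simp add: \<phi>_def add_increasing)
  qed (simp add: \<phi>_def)
  have "H b s \<le> \<phi> b s" if "0 \<le> s" for b s
    unfolding H_def
  proof (rule green_le[OF _ _ that])
    fix b s assume s: "0 \<le> (s::real)"
    show "src n v b s + (if b \<in> I - {n} then volt (l b) (\<lambda>s. \<phi> (b - 1) s + \<phi> (b + 1) s) s else 0) \<le> \<phi> b s"
    proof (cases "b = n")
      case True
      then show ?thesis using K by (auto simp: \<phi>_def src_def Hn vh min_def)
    next
      case False
      have "volt (l b) (\<lambda>s. \<phi> (b - 1) s + \<phi> (b + 1) s) s \<le> volt (l b) (\<lambda>s. H (b - 1) s + H (b + 1) s) s"
        by (intro volt_mono add_mono \<phi>_H) auto
      then have 1: "src n v b s + (if b \<in> I - {n} then volt (l b) (\<lambda>s. \<phi> (b - 1) s + \<phi> (b + 1) s) s else 0) \<le> H b s"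
        using False by (subst H_eq) (auto simp: src_def)
      have 2: "src n v b s + (if b \<in> I - {n} then volt (l b) (\<lambda>s. \<phi> (b - 1) s + \<phi> (b + 1) s) s else 0)
           \<le> h b s + ennreal (e b) * v s" if bJ: "b \<in> J"
      proof -
        have bI: "b \<in> I - {n}" using bJ K False by auto
        have ab: "\<bar>b - 1 - n\<bar> \<le> int K" "\<bar>b + 1 - n\<bar> \<le> int K" using bJ K by auto
        define m where "m = nat \<bar>b - n\<bar>"
        have m: "1 \<le> m" "m < K" using bJ K False by (auto simp: m_def)
        have mm: "e (b - 1) + e (b + 1) \<le> 2 * r ^ (2 * K - m - 1)"
        proof -
          have "nat \<bar>b - 1 - n\<bar> \<le> m + 1" "nat \<bar>b + 1 - n\<bar> \<le> m + 1" by (auto simp: m_def)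
          then have "e (b - 1) \<le> r ^ (2 * K - m - 1)" "e (b + 1) \<le> r ^ (2 * K - m - 1)"
            unfolding e_def using r m by (auto intro!: power_decreasing)
          then show ?thesis by simp
        qed
        have "(1 / w) * (e (b - 1) + e (b + 1)) \<le> (1 / w) * (2 * r ^ (2 * K - m - 1))"
          using mm w by (intro mult_left_mono) auto
        also have "\<dots> = r ^ Suc (2 * K - m - 1)" by (simp add: r_def)
        also have "Suc (2 * K - m - 1) = 2 * K - m" using m by simp
        finally have *: "(1 / w) * (e (b - 1) + e (b + 1)) \<le> e b" by (simp add: e_def m_def)
        have "volt (l b) (\<lambda>s. \<phi> (b - 1) s + \<phi> (b + 1) s) s
          \<le> volt (l b) (\<lambda>s. (h (b - 1) s + h (b + 1) s) + (ennreal (e (b - 1) + e (b + 1)) * v s)) s"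
        proof (rule volt_mono)
          fix u assume u: "0 \<le> u" "u \<le> s"
          have "\<phi> (b - 1) u + \<phi> (b + 1) u \<le> (h (b - 1) u + ennreal (e (b - 1)) * v u) + (h (b + 1) u + ennreal (e (b + 1)) * v u)"
            using u ab by (intro add_mono \<phi>_h) auto
          also have "\<dots> = (h (b - 1) u + h (b + 1) u) + (ennreal (e (b - 1)) * v u + ennreal (e (b + 1)) * v u)"
            by (simp add: add_ac)
          finally show "\<phi> (b - 1) u + \<phi> (b + 1) u \<le> (h (b - 1) u + h (b + 1) u) + (ennreal (e (b - 1) + e (b + 1)) * v u)"
            using ennreal_distrib_real[OF e0 e0] by simp
        qed simp
        also have "\<dots> = volt (l b) (\<lambda>s. h (b - 1) s + h (b + 1) s) s + volt (l b) (\<lambda>s. ennreal (e (b - 1) + e (b + 1)) * v s) s"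
          by (rule volt_add) measurable
        also have "volt (l b) (\<lambda>s. h (b - 1) s + h (b + 1) s) s = h b s"
          using bJ False by (subst h_eq) (simp add: src_def)
        also have "volt (l b) (\<lambda>s. ennreal (e (b - 1) + e (b + 1)) * v s) s = ennreal (e (b - 1) + e (b + 1)) * volt (l b) v s"
          by (rule volt_cmult) measurable
        also have "\<dots> \<le> ennreal (e (b - 1) + e (b + 1)) * volt (- w) v s"
          using w bI by (intro mult_left_mono volt_mono) auto
        also have "\<dots> \<le> ennreal (e (b - 1) + e (b + 1)) * (ennreal (1 / w) * v s)"
          using w mv s by (intro mult_left_mono volt_neg_le) auto
        also have "\<dots> = ennreal ((1 / w) * (e (b - 1) + e (b + 1))) * v s"
          using w e0 by (intro ennreal_mult_mult) (auto intro: add_nonneg_nonneg)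
        also have "\<dots> \<le> ennreal (e b) * v s"
          using * by (intro mult_right_mono ennreal_leI) auto
        finally show ?thesis using bI False by (simp add: src_def add_left_mono)
      qed
      show ?thesis using 1 2 unfolding \<phi>_def[of b s] by auto
    qed
  qed measurable
  then have H_h: "H b s \<le> h b s + ennreal (e b) * v s" if "\<bar>b - n\<bar> \<le> int K" "0 \<le> s" for b s
    using \<phi>_h[OF that] that by (meson order_trans)
  have \<kappa>: "\<kappa> > 0" unfolding \<kappa>_def using w by simp
  have "green l I (src n (\<lambda>_. 1)) a t \<le> ennreal (exp (\<kappa> * t)) * H a t"
  proof (rule green_le[OF _ _ t])
    fix b s assume s: "0 \<le> (s::real)"
    have *: "volt (l b) (\<lambda>s. ennreal (exp (\<kappa> * s)) * H (b - 1) s + ennreal (exp (\<kappa> * s)) * H (b + 1) s) s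
       = ennreal (exp (\<kappa> * s)) * volt (l b - \<kappa>) (\<lambda>s. H (b - 1) s + H (b + 1) s) s"
      unfolding distrib_left[symmetric] by (rule volt_exp_shift) measurable
    show "src n (\<lambda>_. 1) b s + (if b \<in> I then volt (l b) (\<lambda>s. ennreal (exp (\<kappa> * s)) * H (b - 1) s + ennreal (exp (\<kappa> * s)) * H (b + 1) s) s else 0)
      \<le> ennreal (exp (\<kappa> * s)) * H b s"
    proof (cases "b = n")
      case False
      have "volt (l b - \<kappa>) (\<lambda>s. H (b - 1) s + H (b + 1) s) s \<le> volt (l b) (\<lambda>s. H (b - 1) s + H (b + 1) s) s"
        using \<kappa> by (intro volt_mono) auto
      then show ?thesis unfolding * using False
        by (subst H_eq) (auto simp: src_def intro!: mult_left_mono)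
    next
      case True
      \<comment> \<open>At \<open>n\<close> the neighbours return \<open>q\<close> plus at most
        \<kappa> v. Since v = 1 + \<open>volt 0 q\<close>, the resolvent identity shows that
        exp(\<kappa> s) v satisfies the resulting equation with equality.\<close>
      define q where "q u = h (n - 1) u + h (n + 1) u" for u
      have [measurable]: "q \<in> borel_measurable borel" unfolding q_def by measurable
      have v_eq: "v u = 1 + volt 0 q u" for u
        unfolding vh q_def using K ln by (subst h_eq) (simp add: src_def)
      have e1: "e (n - 1) + e (n + 1) = \<kappa>" unfolding e_def \<kappa>_def r_def by simp
      have "volt (- \<kappa>) (\<lambda>s. H (n - 1) s + H (n + 1) s) s \<le> volt (- \<kappa>) (\<lambda>s. q s + ennreal \<kappa> * v s) s"
      proof (rule volt_mono)
        fix u assume u: "0 \<le> u" "u \<le> s"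
        have "H (n - 1) u + H (n + 1) u \<le> (h (n - 1) u + ennreal (e (n - 1)) * v u) + (h (n + 1) u + ennreal (e (n + 1)) * v u)"
          using u K by (intro add_mono H_h) auto
        also have "\<dots> = q u + (ennreal (e (n - 1)) * v u + ennreal (e (n + 1)) * v u)"
          by (simp add: add_ac q_def)
        finally show "H (n - 1) u + H (n + 1) u \<le> q u + ennreal \<kappa> * v u"
          using ennreal_distrib_real[OF e0 e0, of "n - 1" "v u" "n + 1"] e1 by simp
      qed simp
      also have "\<dots> = volt (- \<kappa>) q s + volt (- \<kappa>) (\<lambda>s. ennreal \<kappa> * v s) s"
        by (rule volt_add) measurable
      also have "volt (- \<kappa>) (\<lambda>s. ennreal \<kappa> * v s) s = ennreal \<kappa> * volt (- \<kappa>) (\<lambda>s. 1 + volt 0 q s) s"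
        unfolding v_eq by (rule volt_cmult) measurable
      also have "volt (- \<kappa>) (\<lambda>s. 1 + volt 0 q s) s = volt (- \<kappa>) (\<lambda>_. 1) s + volt (- \<kappa>) (volt 0 q) s"
        by (rule volt_add) measurable
      also have "volt (- \<kappa>) q s + ennreal \<kappa> * (volt (- \<kappa>) (\<lambda>_. 1) s + volt (- \<kappa>) (volt 0 q) s)
         = volt 0 q s + ennreal \<kappa> * volt (- \<kappa>) (\<lambda>_. 1) s"
        using \<kappa> by (subst volt_resolvent[of q \<kappa> s]) (auto simp: distrib_left add_ac)
      also have "ennreal \<kappa> * volt (- \<kappa>) (\<lambda>_. 1) s = ennreal (1 - exp (- \<kappa> * s))"
        using \<kappa> s by (subst volt_1) (auto simp: ennreal_mult'[symmetric] field_simps)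
      finally have "1 + ennreal (exp (\<kappa> * s)) * volt (- \<kappa>) (\<lambda>s. H (n - 1) s + H (n + 1) s) s
        \<le> 1 + ennreal (exp (\<kappa> * s)) * (volt 0 q s + ennreal (1 - exp (- \<kappa> * s)))"
        by (intro add_left_mono mult_left_mono) auto
      also have "\<dots> = (1 + ennreal (exp (\<kappa> * s)) * ennreal (1 - exp (- \<kappa> * s))) + ennreal (exp (\<kappa> * s)) * volt 0 q s"
        by (simp add: distrib_left add_ac)
      also have "1 + ennreal (exp (\<kappa> * s)) * ennreal (1 - exp (- \<kappa> * s)) = ennreal (exp (\<kappa> * s))"
      proof -
        have "exp (\<kappa> * s) * (1 - exp (- \<kappa> * s)) = exp (\<kappa> * s) - 1"
          by (simp add: right_diff_distrib exp_minus field_simps)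
        moreover have "exp (\<kappa> * s) \<ge> 1" using \<kappa> s by simp
        ultimately show ?thesis by (simp add: ennreal_mult'[symmetric] ennreal_1[symmetric] ennreal_plus[symmetric] del: ennreal_1 ennreal_plus)
      qed
      also have "ennreal (exp (\<kappa> * s)) + ennreal (exp (\<kappa> * s)) * volt 0 q s = ennreal (exp (\<kappa> * s)) * v s"
        unfolding v_eq by (simp add: distrib_left)
      finally show ?thesis unfolding * using True I ln by (simp add: src_def Hn)
    qed
  qed measurable
  then show ?thesis unfolding H_def .
qed

section \<open>Bounds by the number of jumps\<close>

lemma psum_src_eq_0:
  assumes "\<bar>b - n\<bar> > int k"
  shows "psum l S (src n v) k b t = 0"
  using assms
proof (induction k arbitrary: b t)
  case 0 then show ?case by (simp add: src_def)
next
  case (Suc k)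
  then have "psum l S (src n v) k (b - 1) s = 0" "psum l S (src n v) k (b + 1) s = 0" for s by auto
  then show ?case by (simp add: volt_def)
qed

text \<open>A walk of \<open>k\<close> jumps from 0 to \<open>n\<close> meets only sites with |b| +
  |b - n| at most \<open>k\<close>. In the induction \<open>j\<close> jumps are left, so k - j have
  been made and bound |b|.\<close>

lemma psum_UNIV_eq:
  assumes "{b. \<bar>b\<bar> + \<bar>b - n\<bar> \<le> int k} \<subseteq> S" "j \<le> k" "\<bar>b\<bar> \<le> int k - int j"
  shows "psum l UNIV (src n v) j b t = psum l S (src n v) j b t"
  using assms(2,3)
proof (induction j arbitrary: b t)
  case (Suc j)
  show ?case
  proof (cases "\<bar>b - n\<bar> > int (Suc j)")
    case True
    then show ?thesis by (simp only: psum_src_eq_0)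
  next
    case False
    then have "b \<in> S" using Suc assms(1) by auto
    moreover have "psum l UNIV (src n v) j (b - 1) s = psum l S (src n v) j (b - 1) s"
       "psum l UNIV (src n v) j (b + 1) s = psum l S (src n v) j (b + 1) s" for s
      using Suc.prems by (intro Suc.IH; simp)+
    ultimately show ?thesis by simp
  qed
qed simp

text \<open>There are 2^j walks, and their jump times fill a simplex of volume t^j/j!. The bound
  \<open>M\<close> is asked only on sites that a walk of \<open>k\<close> jumps from 0 to
  \<open>n\<close> can meet.\<close>

lemma psum_le_crude:
  assumes l: "\<And>b. \<bar>b\<bar> + \<bar>b - n\<bar> \<le> int k \<Longrightarrow> l b \<le> M" and M: "0 \<le> M"
    and "j \<le> k" "\<bar>b\<bar> \<le> int k - int j" "0 \<le> t"
  shows "psum l S (src n (\<lambda>_. 1)) j b t \<le> ennreal (2 ^ j) * (ennreal (exp (M * t)) * ennreal (t ^ j / fact j))"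
  using assms(3-)
proof (induction j arbitrary: b t)
  case 0
  have "1 \<le> ennreal (exp (M * t))" using M 0 by (auto simp: ennreal_1[symmetric] simp del: ennreal_1)
  then show ?case by (simp add: src_def)
next
  case (Suc j)
  show ?case
  proof (cases "\<bar>b - n\<bar> > int (Suc j)")
    case True
    then show ?thesis by (subst psum_src_eq_0) auto
  next
    case False
    then have lb: "l b \<le> M" using Suc by (intro l) auto
    let ?f = "\<lambda>s. ennreal (exp (M * s)) * ennreal (s ^ j / fact j)"
    have "volt (l b) (\<lambda>s. psum l S (src n (\<lambda>_. 1)) j (b - 1) s + psum l S (src n (\<lambda>_. 1)) j (b + 1) s) t
      \<le> volt (l b) (\<lambda>s. ennreal (2 ^ Suc j) * ?f s) t"
    proof (rule volt_mono)
      fix s assume s: "0 \<le> s" "s \<le> t"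
      have "psum l S (src n (\<lambda>_. 1)) j (b - 1) s + psum l S (src n (\<lambda>_. 1)) j (b + 1) s
        \<le> ennreal (2 ^ j) * ?f s + ennreal (2 ^ j) * ?f s"
        using Suc.prems s by (intro add_mono Suc.IH) auto
      also have "\<dots> = ennreal (2 ^ Suc j) * ?f s"
        by (subst ennreal_distrib_real) auto
      finally show "psum l S (src n (\<lambda>_. 1)) j (b - 1) s + psum l S (src n (\<lambda>_. 1)) j (b + 1) s
        \<le> ennreal (2 ^ Suc j) * ?f s" .
    qed simp
    also have "\<dots> = ennreal (2 ^ Suc j) * volt (l b) ?f t"
      by (rule volt_cmult) measurable
    also have "\<dots> \<le> ennreal (2 ^ Suc j) * (ennreal (exp (M * t)) * ennreal (t ^ Suc j / fact (Suc j)))"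
      using lb Suc.prems by (intro mult_left_mono volt_exp_power_le) auto
    finally show ?thesis by auto
  qed
qed

text \<open>Only the straight walk to the right is kept, with every stay of length at most
  \<open>s\<close>, so that the time \<open>t\<close> cannot run out.\<close>

lemma psum_direct_ge:
  assumes "m > 0" "0 \<le> s" "\<And>b. n - int k \<le> b \<Longrightarrow> b < n \<Longrightarrow> b \<in> S \<and> - m \<le> l b" "real k * s \<le> t"
  shows "ennreal (((1 - exp (- m * s)) / m) ^ k) \<le> psum l S (src n (\<lambda>_. 1)) k (n - int k) t"
  using assms(3,4)
proof (induction k arbitrary: t)
  case 0 then show ?case by (simp add: src_def)
next
  case (Suc k)
  let ?c = "(1 - exp (- m * s)) / m"
  have c: "0 \<le> ?c" using assms by simp
  have st: "0 + s \<le> real k * s + s" using assms(2) by (intro add_right_mono) simp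
  have kt: "real k * s + s \<le> t" using Suc.prems(2) by (simp add: distrib_right)
  have st': "s \<le> t" using st kt by simp
  have S: "n - int (Suc k) \<in> S" "- m \<le> l (n - int (Suc k))"
    using Suc.prems(1)[of "n - int (Suc k)"] by auto
  have e: "n - int (Suc k) + 1 = n - int k" by simp
  have "ennreal (?c ^ Suc k) = ennreal ?c * ennreal (?c ^ k)"
    using c by (simp add: ennreal_mult'[symmetric])
  also have "\<dots> \<le> volt (- m) (psum l S (src n (\<lambda>_. 1)) k (n - int k)) t"
    using assms(1,2) st' kt Suc.prems(1) by (intro volt_ge Suc.IH) auto
  also have "\<dots> \<le> psum l S (src n (\<lambda>_. 1)) (Suc k) (n - int (Suc k)) t"
    using S unfolding psum.simps e by (auto intro!: volt_mono add_increasing)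
  finally show ?case .
qed

text \<open>All stays and the time left on arrival add up to \<open>t\<close>, so lowering every
  rate by \<open>c\<close> takes out the same factor exp(c t) for all walks.\<close>

lemma psum_exp_shift:
  assumes [measurable]: "v \<in> borel_measurable borel"
  shows "psum l S (src n (\<lambda>t. ennreal (exp (c * t)) * v t)) k a t
     = ennreal (exp (c * t)) * psum (\<lambda>b. l b - c) S (src n v) k a t"
proof (induction k arbitrary: a t)
  case 0 then show ?case by (simp add: src_def)
next
  case (Suc k)
  have [measurable]: "psum (\<lambda>b. l b - c) S (src n v) k b \<in> borel_measurable borel" for b
    by (rule psum_measurable) measurable
  show ?case
    unfolding psum.simps Suc distrib_left[symmetric] by (auto simp: volt_exp_shift)
qed

lemma psum_reflect:
  "psum (\<lambda>b. l (- b)) UNIV (src (- n) v) k a t = psum l UNIV (src n v) k (- a) t"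
proof (induction k arbitrary: a t)
  case 0 then show ?case by (auto simp: src_def)
next
  case (Suc k)
  have "- (a - 1) = - a + 1" "- (a + 1) = - a - 1" by auto
  then show ?case unfolding psum.simps Suc by (simp only: UNIV_I if_True add.commute)
qed

text \<open>Walks with fewer than \<open>k0\<close> jumps cannot leave \<open>S\<close>. For the
  others the geometric series has sum at most 2 exp(-k0), because 1/(1 - 1/e) is below 2.\<close>

lemma green_UNIV_le:
  assumes S: "{b. \<bar>b\<bar> + \<bar>b - n\<bar> < int k0} \<subseteq> S"
    and bound: "\<And>k. k0 \<le> k \<Longrightarrow> psum l UNIV (src n v) k 0 t \<le> ennreal (exp (- real k)) * green l S (src n v) 0 t"
  shows "green l UNIV (src n v) 0 t \<le> ennreal (1 + 2 * exp (- real k0)) * green l S (src n v) 0 t"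
proof -
  let ?G = "green l S (src n v) 0 t"
  let ?e = "\<lambda>k. ennreal (if k0 \<le> k then exp (- real k) else 0)"
  have "psum l UNIV (src n v) k 0 t \<le> psum l S (src n v) k 0 t + ?e k * ?G" for k
  proof (cases "k0 \<le> k")
    case True then show ?thesis using bound[OF True] by (simp add: add_increasing)
  next
    case False
    have "psum l UNIV (src n v) k 0 t = psum l S (src n v) k 0 t"
      using S False by (intro psum_UNIV_eq[of n k]) auto
    then show ?thesis by simp
  qed
  then have "green l UNIV (src n v) 0 t \<le> (\<Sum>k. psum l S (src n v) k 0 t + ?e k * ?G)"
    unfolding green_def[of l UNIV] by (intro suminf_le) auto
  also have "\<dots> = ?G + (\<Sum>k. ?e k) * ?G"
    by (subst suminf_add[symmetric]) (auto simp: green_def)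
  also have "(\<Sum>k. ?e k) \<le> ennreal (2 * exp (- real k0))"
  proof -
    have g: "(\<lambda>k. exp (- real k)) = (\<lambda>k. exp (- 1) ^ k)"
      by (auto simp: exp_of_nat_mult[symmetric])
    have e2: "exp (1::real) \<ge> 2" using exp_ge_add_one_self[of 1] by simp
    have e1: "exp (- 1 :: real) \<le> 1 / 2" using e2 by (simp add: exp_minus field_simps)
    have "(\<lambda>k. exp (- 1 :: real) ^ k * exp (- real k0)) sums (1 / (1 - exp (- 1)) * exp (- real k0))"
      using e1 by (intro sums_mult2 geometric_sums) auto
    then have "(\<lambda>k. (if k0 \<le> k + k0 then exp (- real (k + k0)) else 0)) sums (1 / (1 - exp (- 1)) * exp (- real k0))"
      by (simp add: g[THEN fun_cong, symmetric] exp_add[symmetric])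
    then have s: "(\<lambda>k. (if k0 \<le> k then exp (- real k) else 0)) sums (1 / (1 - exp (- 1)) * exp (- real k0))"
      by (subst (asm) sums_iff_shift) simp
    then have "(\<Sum>k. ?e k) = ennreal (1 / (1 - exp (- 1)) * exp (- real k0))"
      by (intro suminf_ennreal_eq) auto
    also have "\<dots> \<le> ennreal (2 * exp (- real k0))"
      using e1 by (intro ennreal_leI mult_right_mono) (auto simp: field_simps)
    finally show ?thesis .
  qed
  finally show ?thesis by (simp add: distrib_right mult_right_mono add_left_mono)
qed

subsection \<open>The Feynman--Kac formula as a path sum\<close>

lemma prob_space_crw_step: "prob_space crw_step"
proof -
  interpret a: prob_space "density lborel (exponential_density 2)"
    by (rule prob_space_exponential_density) simp
  interpret pair_prob_space "density lborel (exponential_density 2)" "measure_pmf (pmf_of_set {-1, 1 :: int})" ..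
  show ?thesis unfolding crw_step_def by (rule P.prob_space_axioms)
qed

interpretation crw: sequence_space crw_step
  by (simp add: sequence_space_def product_prob_space_def product_prob_space_axioms_def
      product_sigma_finite_def prob_space_crw_step prob_space_imp_sigma_finite)

lemma sets_crw_step [measurable_cong]: "sets crw_step = sets (borel \<Otimes>\<^sub>M count_space UNIV)"
  by (auto simp: crw_step_def intro!: sets_pair_measure_cong)

lemma sets_crw_space [measurable_cong]: "sets crw_space = sets (PiM UNIV (\<lambda>_. crw_step))"
  by (simp add: crw_space_def)

lemma space_crw_step [simp]: "space crw_step = UNIV"
  by (simp add: sets_eq_imp_space_eq[OF sets_crw_step] space_pair_measure)

lemma space_crw_space [simp]: "space crw_space = UNIV"
  by (simp add: crw_space_def space_PiM)

text \<open>The density 2 exp(-2 s) of the stay meets probability 1/2 for each direction. This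
  leaves the weight exp(-2 s) per neighbour, the form used in \<open>psum\<close>.\<close>

lemma nn_integral_crw_step:
  assumes [measurable]: "f \<in> borel_measurable (borel \<Otimes>\<^sub>M count_space UNIV)"
  shows "(\<integral>\<^sup>+x. f x \<partial>crw_step) = (\<integral>\<^sup>+s. ennreal (exp (- 2 * s)) * (f (s, -1) + f (s, 1)) * indicator {0..} s \<partial>lborel)"
proof -
  let ?p = "pmf_of_set {-1, 1 :: int}"
  have "(\<integral>\<^sup>+x. f x \<partial>crw_step) = (\<integral>\<^sup>+s. \<integral>\<^sup>+e. f (s, e) \<partial>?p \<partial>density lborel (exponential_density 2))"
    unfolding crw_step_def by (rule measure_pmf.nn_integral_fst[symmetric]) simp
  also have "\<dots> = (\<integral>\<^sup>+s. (f (s, -1) + f (s, 1)) / 2 \<partial>density lborel (exponential_density 2))"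
    by (intro nn_integral_cong) (simp add: nn_integral_pmf_of_set divide_ennreal_def)
  also have "\<dots> = (\<integral>\<^sup>+s. ennreal (exponential_density 2 s) * ((f (s, -1) + f (s, 1)) / 2) \<partial>lborel)"
    by (subst nn_integral_density) auto
  also have "\<dots> = (\<integral>\<^sup>+s. ennreal (exp (- 2 * s)) * (f (s, -1) + f (s, 1)) * indicator {0..} s \<partial>lborel)"
  proof (rule nn_integral_cong)
    fix s :: real
    have half: "ennreal (2 * exp (- 2 * s)) * (x / 2) = ennreal (exp (- 2 * s)) * x" for x
    proof -
      have "2 * (x / 2) = (x * 2) / 2" by (subst ennreal_times_divide) (simp only: mult.commute)
      also have "\<dots> = x" by (rule ennreal_mult_divide_eq) auto
      finally have 1: "2 * (x / 2) = x" .
      have "ennreal (2 * exp (- 2 * s)) = ennreal (exp (- 2 * s)) * 2"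
        by (simp add: ennreal_mult' mult.commute)
      then show ?thesis by (simp only: mult.assoc 1)
    qed
    show "ennreal (exponential_density 2 s) * ((f (s, -1) + f (s, 1)) / 2) = ennreal (exp (- 2 * s)) * (f (s, -1) + f (s, 1)) * indicator {0..} s"
    proof (cases "s < 0")
      case False
      then have "exponential_density 2 s = 2 * exp (- 2 * s)" by (simp add: exponential_density_def)
      then show ?thesis using False by (simp only: half) simp
    qed (simp add: exponential_density_def)
  qed
  finally show ?thesis .
qed

lemma crw_case_measurable [measurable]:
  "(\<lambda>(x, w). case_nat x w) \<in> measurable (crw_step \<Otimes>\<^sub>M crw_space) crw_space"
  unfolding crw_space_def split_beta' by (rule measurable_case_nat') measurable

text \<open>Conditioning on the first step: the remaining sequence is independent of it and has the
  same law.\<close>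

lemma nn_integral_crw_space:
  assumes [measurable]: "f \<in> borel_measurable crw_space"
  shows "(\<integral>\<^sup>+w. f w \<partial>crw_space) = (\<integral>\<^sup>+x. \<integral>\<^sup>+w. f (case_nat x w) \<partial>crw_space \<partial>crw_step)"
proof -
  interpret b: prob_space crw_space unfolding crw_space_def by (rule crw.prob_space_axioms)
  have "crw_space = distr (crw_step \<Otimes>\<^sub>M crw_space) crw_space (\<lambda>(x, w). case_nat x w)"
    unfolding crw_space_def by (rule crw.PiM_iter[symmetric])
  then have "(\<integral>\<^sup>+w. f w \<partial>crw_space) = (\<integral>\<^sup>+w. f w \<partial>distr (crw_step \<Otimes>\<^sub>M crw_space) crw_space (\<lambda>(x, w). case_nat x w))"
    by simp
  also have "\<dots> = (\<integral>\<^sup>+y. f (case y of (x, w) \<Rightarrow> case_nat x w) \<partial>(crw_step \<Otimes>\<^sub>M crw_space))"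
    by (rule nn_integral_distr) auto
  also have "\<dots> = (\<integral>\<^sup>+x. \<integral>\<^sup>+w. f (case (x, w) of (x, w) \<Rightarrow> case_nat x w) \<partial>crw_space \<partial>crw_step)"
    by (rule b.nn_integral_fst[symmetric]) measurable
  finally show ?thesis by simp
qed

lemma AE_crw_step_pos: "AE x in crw_step. 0 < fst x"
proof -
  have "(\<integral>\<^sup>+x. indicator {..0::real} (fst x) \<partial>crw_step)
      = (\<integral>\<^sup>+s. ennreal (exp (- 2 * s)) * (indicator {..0} s + indicator {..0} s) * indicator {0..} s \<partial>lborel)"
    by (subst nn_integral_crw_step) simp_all
  also have "\<dots> = (\<integral>\<^sup>+s. 0 \<partial>(lborel :: real measure))"
    by (rule nn_integral_cong_AE, rule AE_mp[OF AE_lborel_singleton[of 0]]) (auto simp: indicator_def)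
  finally have "(\<integral>\<^sup>+x. indicator {..0::real} (fst x) \<partial>crw_step) = 0" by simp
  then have "AE x in crw_step. indicator {..0::real} (fst x) = (0 :: ennreal)"
    by (subst (asm) nn_integral_0_iff_AE) measurable
  then show ?thesis by eventually_elim (auto simp: indicator_def split: if_splits)
qed

lemma AE_crw_space_pos: "AE w in crw_space. \<forall>i. 0 < fst (w i)"
  unfolding crw_space_def
  by (intro AE_all_countable[THEN iffD2] allI AE_PiM_component) (auto simp: AE_crw_step_pos prob_space_crw_step)

lemma jump_time_measurable [measurable]: "(\<lambda>w. jump_time w k) \<in> borel_measurable crw_space"
  unfolding jump_time_def crw_space_def by measurable

lemma jump_time_case: "jump_time (case_nat x w) (Suc k) = fst x + jump_time w k"
  unfolding jump_time_def by (subst sum.lessThan_Suc_shift) simp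

text \<open>Each stay contributes its Laplace transform at 1, which is 2/(2 + 1).\<close>

lemma nn_integral_exp_jump_time:
  "(\<integral>\<^sup>+w. ennreal (exp (- jump_time w k)) \<partial>crw_space) = ennreal ((2 / 3) ^ k)"
proof (induction k)
  case 0
  interpret b: prob_space crw_space unfolding crw_space_def by (rule crw.prob_space_axioms)
  show ?case using b.emeasure_space_1 by (simp add: jump_time_def)
next
  case (Suc k)
  have "(\<integral>\<^sup>+w. ennreal (exp (- jump_time w (Suc k))) \<partial>crw_space) =
     (\<integral>\<^sup>+x. \<integral>\<^sup>+w. ennreal (exp (- fst x)) * ennreal (exp (- jump_time w k)) \<partial>crw_space \<partial>crw_step)"
    by (subst nn_integral_crw_space) (auto simp: jump_time_case ennreal_mult'[symmetric] exp_add[symmetric])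
  also have "\<dots> = (\<integral>\<^sup>+x. ennreal (exp (- fst x)) * ennreal ((2 / 3) ^ k) \<partial>crw_step)"
    by (subst nn_integral_cmult) (auto simp: Suc)
  also have "\<dots> = (\<integral>\<^sup>+x. ennreal (exp (- fst x)) \<partial>crw_step) * ennreal ((2 / 3) ^ k)"
    by (rule nn_integral_multc) measurable
  finally have step: "(\<integral>\<^sup>+w. ennreal (exp (- jump_time w (Suc k))) \<partial>crw_space) = \<dots>" .
  have e: "exp (- (2 * x)) * (2 * exp (- x)) = 2 * exp (- (3 * x))" for x :: real
    by (simp add: exp_add[symmetric])
  have "(\<integral>\<^sup>+x. ennreal (exp (- fst x)) \<partial>crw_step) = (\<integral>\<^sup>+s. ennreal (2 * exp (- 3 * s)) * indicator {0..} s \<partial>lborel)"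
    by (subst nn_integral_crw_step)
       (auto intro!: nn_integral_cong simp: ennreal_plus[symmetric] ennreal_mult'[symmetric] e simp del: ennreal_plus)
  also have "\<dots> = ennreal (0 - (- (2 / 3) * exp (- 3 * 0)))"
  proof (rule nn_integral_FTC_atLeast)
    show "((\<lambda>x::real. - (2 / 3) * exp (- 3 * x)) \<longlongrightarrow> 0) at_top" by real_asymp
  qed (auto intro!: derivative_eq_intros)
  finally have E1: "(\<integral>\<^sup>+x. ennreal (exp (- fst x)) \<partial>crw_step) = \<dots>" .
  have "ennreal (0 - (- (2 / 3) * exp (- 3 * 0))) * ennreal ((2 / 3) ^ k) = ennreal ((2 / 3) ^ Suc k)"
    by (subst ennreal_mult[symmetric]) auto
  then show ?case unfolding step E1 .
qed

text \<open>Non-explosion, by Markov's inequality for exp(- jump time). It guarantees that the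
  \<open>LEAST\<close> in \<open>crw_pos\<close> refers to an existing index.\<close>

lemma AE_jump_time_gt: "AE w in crw_space. \<exists>k. t < jump_time w (Suc k)"
proof -
  let ?B = "{w. \<forall>k. jump_time w (Suc k) \<le> t}"
  have B: "?B \<in> sets crw_space"
  proof -
    have "?B = {w \<in> space crw_space. \<forall>k. jump_time w (Suc k) \<le> t}" by simp
    also have "\<dots> \<in> sets crw_space" by measurable
    finally show ?thesis .
  qed
  have le: "emeasure crw_space ?B \<le> ennreal (exp t * (2 / 3) ^ Suc k)" for k
  proof -
    have "emeasure crw_space ?B = (\<integral>\<^sup>+w. indicator ?B w \<partial>crw_space)"
      using B by simp
    also have "\<dots> \<le> (\<integral>\<^sup>+w. ennreal (exp t) * ennreal (exp (- jump_time w (Suc k))) \<partial>crw_space)"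
    proof (rule nn_integral_mono)
      fix w
      show "indicator ?B w \<le> ennreal (exp t) * ennreal (exp (- jump_time w (Suc k)))"
      proof (cases "w \<in> ?B")
        case True
        then have "jump_time w (Suc k) \<le> t" by simp
        then have "1 \<le> exp t * exp (- jump_time w (Suc k))" by (simp add: exp_add[symmetric])
        then show ?thesis using True by (simp add: ennreal_mult'[symmetric] ennreal_1[symmetric] del: ennreal_1)
      qed simp
    qed
    also have "\<dots> = ennreal (exp t * (2 / 3) ^ Suc k)"
      by (subst nn_integral_cmult) (auto simp: nn_integral_exp_jump_time ennreal_mult' simp del: power_Suc)
    finally show ?thesis .
  qed
  have "(\<lambda>k. ennreal (exp t * (2 / 3) ^ Suc k)) \<longlonglongrightarrow> ennreal 0"
    by (rule tendsto_ennrealI) real_asymp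
  then have "emeasure crw_space ?B \<le> ennreal 0"
    by (rule LIMSEQ_le_const) (use le in auto)
  then show ?thesis using B
    by (intro AE_I[of _ _ ?B]) (auto simp: not_less)
qed

section \<open>Expansion of the Feynman-Kac integral by the number of jumps\<close>

definition crw_chain :: "(nat \<Rightarrow> real \<times> int) \<Rightarrow> nat \<Rightarrow> int" where
  "crw_chain w k = (\<Sum>i<k. snd (w i))"

text \<open>The start \<open>a\<close> is kept general for an induction on the first jump.\<close>

definition fk_term :: "(int \<Rightarrow> real) \<Rightarrow> int \<Rightarrow> nat \<Rightarrow> int \<Rightarrow> real \<Rightarrow> (nat \<Rightarrow> real \<times> int) \<Rightarrow> ennreal" where
  "fk_term \<xi> z k a t w =
     (if jump_time w k \<le> t \<and> t < jump_time w (Suc k) \<and> a + crw_chain w k = z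
      then ennreal (exp ((\<Sum>i<k. \<xi> (a + crw_chain w i) * fst (w i)) + \<xi> (a + crw_chain w k) * (t - jump_time w k)))
      else 0)"

lemma crw_coord_measurable: "(\<lambda>w. w i) \<in> measurable crw_space (borel \<Otimes>\<^sub>M count_space UNIV)"
  unfolding crw_space_def by measurable

lemma crw_chain_measurable [measurable]: "(\<lambda>w. crw_chain w k) \<in> measurable crw_space (count_space UNIV)"
proof (induction k)
  case 0 then show ?case by (simp add: crw_chain_def)
next
  case (Suc k)
  note [measurable] = Suc crw_coord_measurable
  have "(\<lambda>w. (\<lambda>(x, y). x + y) (crw_chain w k, snd (w k))) \<in> measurable crw_space (count_space UNIV)"
    by measurable
  then show ?case by (simp add: crw_chain_def)
qed

lemma fk_term_measurable [measurable]: "fk_term \<xi> z k a t \<in> borel_measurable crw_space"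
  unfolding fk_term_def[abs_def] by measurable

lemma crw_chain_0: "crw_chain w 0 = 0"
  by (simp add: crw_chain_def)

lemma crw_chain_case: "crw_chain (case_nat x w) (Suc k) = snd x + crw_chain w k"
  unfolding crw_chain_def by (subst sum.lessThan_Suc_shift) simp

lemma jump_time_nonneg: "(\<And>i. 0 < fst (w i)) \<Longrightarrow> 0 \<le> jump_time w k"
  unfolding jump_time_def by (intro sum_nonneg) (auto simp: less_imp_le)

lemma fk_term_case:
  assumes "0 < fst x" "\<And>i. 0 < fst (w i)"
  shows "fk_term \<xi> z (Suc k) a t (case_nat x w)
    = ennreal (exp (\<xi> a * fst x)) * fk_term \<xi> z k (a + snd x) (t - fst x) w * indicator {0..t} (fst x)"
proof -
  have "(\<Sum>i<Suc k. \<xi> (a + crw_chain (case_nat x w) i) * fst (case_nat x w i))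
     = \<xi> a * fst x + (\<Sum>i<k. \<xi> (a + snd x + crw_chain w i) * fst (w i))"
    by (subst sum.lessThan_Suc_shift) (simp add: crw_chain_case add.assoc crw_chain_0)
  then show ?thesis
    using assms(1) jump_time_nonneg[of w k, OF assms(2)]
    by (auto simp: fk_term_def jump_time_case crw_chain_case ennreal_mult'[symmetric] exp_add[symmetric] algebra_simps)
qed

text \<open>Induction by the first jump. The last stay, at \<open>z\<close>, has to outlast the time
  left, which has probability exp(-2 t); together with the reward exp(\<xi> z t) this is the
  source.\<close>

lemma nn_integral_fk_term:
  assumes t: "0 \<le> t"
  shows "(\<integral>\<^sup>+w. fk_term \<xi> z k a t w \<partial>crw_space)
    = psum (\<lambda>b. \<xi> b - 2) UNIV (src z (\<lambda>t. ennreal (exp ((\<xi> z - 2) * t)))) k a t"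
  using t
proof (induction k arbitrary: a t)
  interpret b: prob_space crw_space unfolding crw_space_def by (rule crw.prob_space_axioms)
  case 0
  have "(\<integral>\<^sup>+w. fk_term \<xi> z 0 a t w \<partial>crw_space)
     = (\<integral>\<^sup>+x. \<integral>\<^sup>+w. (if a = z then ennreal (exp (\<xi> z * t)) * indicator {t<..} (fst x) else 0) \<partial>crw_space \<partial>crw_step)"
    using 0 by (subst nn_integral_crw_space[OF fk_term_measurable])
      (auto simp: fk_term_def crw_chain_def jump_time_def indicator_def intro!: nn_integral_cong)
  also have "\<dots> = (\<integral>\<^sup>+x. (if a = z then ennreal (exp (\<xi> z * t)) else 0) * indicator {t<..} (fst x) \<partial>crw_step)"
    using b.emeasure_space_1 by (auto intro!: nn_integral_cong)
  also have "\<dots> = (if a = z then ennreal (exp (\<xi> z * t)) else 0) * (\<integral>\<^sup>+x. indicator {t<..} (fst x) \<partial>crw_step)"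
    by (rule nn_integral_cmult) measurable
  also have "(\<integral>\<^sup>+x. indicator {t<..} (fst x) \<partial>crw_step) = (\<integral>\<^sup>+s. ennreal (2 * exp (- 2 * s)) * indicator {t..} s \<partial>lborel)"
    apply (subst nn_integral_crw_step)
     apply simp
    \<comment> \<open>The open and the closed half-line at \<open>t\<close> differ by a null
      set.\<close>
    apply (rule nn_integral_cong_AE, rule AE_mp[OF AE_lborel_singleton[of t]])
    using 0 by (auto simp: indicator_def ennreal_mult' mult.commute)
  also have "\<dots> = ennreal (0 - (- exp (- 2 * t)))"
  proof (rule nn_integral_FTC_atLeast)
    show "((\<lambda>x::real. - exp (- 2 * x)) \<longlongrightarrow> 0) at_top" by real_asymp
  qed (auto intro!: derivative_eq_intros)
  finally show ?case
    by (auto simp: src_def ennreal_mult'[symmetric] exp_add[symmetric] algebra_simps)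
next
  case (Suc k)
  define p where "p = psum (\<lambda>b. \<xi> b - 2) UNIV (src z (\<lambda>t. ennreal (exp ((\<xi> z - 2) * t)))) k"
  have [measurable]: "p b \<in> borel_measurable borel" for b
    unfolding p_def by (rule psum_measurable) measurable
  have [measurable]: "(\<lambda>x. p (a + snd x) (t - fst x)) \<in> borel_measurable (borel \<Otimes>\<^sub>M count_space UNIV)"
    by (rule measurable_compose_countable[where f = "\<lambda>b x. p b (t - fst x)" and g = "\<lambda>x. a + snd x"]) measurable
  have "(\<integral>\<^sup>+w. fk_term \<xi> z (Suc k) a t w \<partial>crw_space)
     = (\<integral>\<^sup>+x. \<integral>\<^sup>+w. fk_term \<xi> z (Suc k) a t (case_nat x w) \<partial>crw_space \<partial>crw_step)"
    by (rule nn_integral_crw_space) measurable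
  also have "\<dots> = (\<integral>\<^sup>+x. ennreal (exp (\<xi> a * fst x)) * p (a + snd x) (t - fst x) * indicator {0..t} (fst x) \<partial>crw_step)"
  proof (rule nn_integral_cong_AE, rule AE_mp[OF AE_crw_step_pos], rule AE_I2, rule impI)
    fix x :: "real \<times> int" assume x: "0 < fst x"
    have "(\<integral>\<^sup>+w. fk_term \<xi> z (Suc k) a t (case_nat x w) \<partial>crw_space)
       = (\<integral>\<^sup>+w. (ennreal (exp (\<xi> a * fst x)) * indicator {0..t} (fst x)) * fk_term \<xi> z k (a + snd x) (t - fst x) w \<partial>crw_space)"
    proof (rule nn_integral_cong_AE, rule AE_mp[OF AE_crw_space_pos], rule AE_I2, rule impI)
      fix w :: "nat \<Rightarrow> real \<times> int" assume "\<forall>i. 0 < fst (w i)"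
      then show "fk_term \<xi> z (Suc k) a t (case_nat x w)
         = (ennreal (exp (\<xi> a * fst x)) * indicator {0..t} (fst x)) * fk_term \<xi> z k (a + snd x) (t - fst x) w"
        using x by (subst fk_term_case) (auto simp: mult_ac)
    qed
    also have "\<dots> = (ennreal (exp (\<xi> a * fst x)) * indicator {0..t} (fst x)) * (\<integral>\<^sup>+w. fk_term \<xi> z k (a + snd x) (t - fst x) w \<partial>crw_space)"
      by (rule nn_integral_cmult) measurable
    also have "\<dots> = ennreal (exp (\<xi> a * fst x)) * p (a + snd x) (t - fst x) * indicator {0..t} (fst x)"
      using Suc.IH[of "t - fst x" "a + snd x"] by (auto simp: indicator_def p_def)
    finally show "(\<integral>\<^sup>+w. fk_term \<xi> z (Suc k) a t (case_nat x w) \<partial>crw_space)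
      = ennreal (exp (\<xi> a * fst x)) * p (a + snd x) (t - fst x) * indicator {0..t} (fst x)" .
  qed
  also have "\<dots> = volt (\<xi> a - 2) (\<lambda>s. p (a - 1) s + p (a + 1) s) t"
  proof -
    have "ennreal (exp (- 2 * s)) * (ennreal (exp (\<xi> a * s)) * x) = ennreal (exp ((\<xi> a - 2) * s)) * x" for s x
    proof -
      have "ennreal (exp ((\<xi> a - 2) * s)) = ennreal (exp (- 2 * s)) * ennreal (exp (\<xi> a * s))"
        by (simp add: ennreal_mult'[symmetric] exp_add[symmetric] algebra_simps)
      then show ?thesis by (simp only: mult.assoc)
    qed
    then show ?thesis unfolding volt_def
      by (subst nn_integral_crw_step) (auto simp: indicator_def distrib_left intro!: nn_integral_cong)
  qed
  finally show ?case by (simp add: p_def)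
qed

text \<open>As all stays are positive the jump times are ordered, so up to time \<open>t\<close> the
  path is a step function with finitely many pieces.\<close>

lemma crw_integrand:
  assumes pos: "\<And>i. 0 < fst (w i)" and k: "jump_time w k \<le> t" "t < jump_time w (Suc k)" and t: "0 \<le> t"
  shows "ennreal (exp (LINT s:{0..t}|lborel. \<xi> (crw_pos w s)) * (if crw_pos w t = z then 1 else 0))
    = fk_term \<xi> z k 0 t w"
proof -
  have step: "jump_time w (Suc i) = jump_time w i + fst (w i)" for i by (simp add: jump_time_def)
  have mono: "jump_time w i \<le> jump_time w j" if "i \<le> j" for i j
    unfolding jump_time_def using that pos by (intro sum_mono2) (auto simp: less_imp_le)
  have chain: "crw_pos w s = crw_chain w i" if "jump_time w i \<le> s" "s < jump_time w (Suc i)" for s i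
  proof -
    have "(LEAST k. s < jump_time w (Suc k)) = i"
    proof (rule Least_equality)
      fix j assume "s < jump_time w (Suc j)"
      show "i \<le> j"
      proof (rule ccontr)
        assume "\<not> i \<le> j"
        then have "jump_time w (Suc j) \<le> jump_time w i" by (intro mono) auto
        then show False using that \<open>s < jump_time w (Suc j)\<close> by simp
      qed
    qed (rule that)
    then show ?thesis by (simp add: crw_pos_def crw_chain_def)
  qed
  have J0: "jump_time w 0 = 0" by (simp add: jump_time_def)
  define g where "g s = (\<Sum>i<k. \<xi> (crw_chain w i) * indicator {jump_time w i..<jump_time w (Suc i)} s)
      + \<xi> (crw_chain w k) * indicator {jump_time w k..t} s" for s
  have ind: "indicator {0..t} s * \<xi> (crw_pos w s) = g s" for s
  proof (cases "s \<in> {0..t}")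
    case False
    have "s \<notin> {jump_time w i..<jump_time w (Suc i)}" if "i < k" for i
      using False mono[of 0 i] mono[of "Suc i" k] that k J0 by auto
    moreover have "s \<notin> {jump_time w k..t}" using False mono[of 0 k] J0 by auto
    ultimately show ?thesis using False by (simp add: g_def)
  next
    case s: True
    show ?thesis
    proof (cases "jump_time w k \<le> s")
      case True
      have "s \<notin> {jump_time w i..<jump_time w (Suc i)}" if "i < k" for i
        using True mono[of "Suc i" k] that by auto
      then show ?thesis using s True k chain[of k s] by (simp add: g_def)
    next
      case False
      define m where "m = (LEAST i. s < jump_time w (Suc i))"
      have ex: "s < jump_time w (Suc k)" using s k by auto
      have m1: "s < jump_time w (Suc m)" unfolding m_def by (rule LeastI) (rule ex)
      have m2: "jump_time w m \<le> s"
      proof (cases m)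
        case 0 then show ?thesis using s J0 by simp
      next
        case (Suc j)
        then have "\<not> s < jump_time w (Suc j)" using not_less_Least[of j "\<lambda>i. s < jump_time w (Suc i)"] unfolding m_def by simp
        then show ?thesis using Suc by simp
      qed
      have mk: "m < k"
      proof (rule ccontr)
        assume "\<not> m < k"
        then have "jump_time w k \<le> jump_time w m" by (intro mono) auto
        then show False using m2 False by simp
      qed
      have "(\<Sum>i<k. \<xi> (crw_chain w i) * indicator {jump_time w i..<jump_time w (Suc i)} s)
         = (\<Sum>i<k. if i = m then \<xi> (crw_chain w m) else 0)"
      proof (intro sum.cong refl)
        fix i assume "i \<in> {..<k}"
        show "\<xi> (crw_chain w i) * indicator {jump_time w i..<jump_time w (Suc i)} s = (if i = m then \<xi> (crw_chain w m) else 0)"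
        proof (cases i m rule: linorder_cases)
          case less then show ?thesis using m2 mono[of "Suc i" m] by auto
        next
          case equal then show ?thesis using m1 m2 by simp
        next
          case greater then show ?thesis using m1 mono[of "Suc m" i] by auto
        qed
      qed
      also have "\<dots> = \<xi> (crw_chain w m)" using mk by simp
      finally show ?thesis using s False chain[OF m2 m1] by (simp add: g_def)
    qed
  qed
  have "(LINT s:{0..t}|lborel. \<xi> (crw_pos w s)) = (LINT s|lborel. g s)"
    unfolding set_lebesgue_integral_def using ind by simp
  also have "\<dots> = (\<Sum>i<k. \<xi> (crw_chain w i) * fst (w i)) + \<xi> (crw_chain w k) * (t - jump_time w k)"
  proof (rule has_bochner_integral_integral_eq)
    have *: "has_bochner_integral lborel (\<lambda>s. c * indicator A s) (c * measure lborel A)"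
      if "A \<in> sets lborel" "emeasure lborel A < \<infinity>" for c :: real and A :: "real set"
      using has_bochner_integral_mult_right[OF has_bochner_integral_real_indicator[OF that]] by simp
    have "has_bochner_integral lborel g ((\<Sum>i<k. \<xi> (crw_chain w i) * measure lborel {jump_time w i..<jump_time w (Suc i)}) + \<xi> (crw_chain w k) * measure lborel {jump_time w k..t})"
      unfolding g_def
      by (intro has_bochner_integral_add has_bochner_integral_sum *) (use mono k in auto)
    also have "(\<Sum>i<k. \<xi> (crw_chain w i) * measure lborel {jump_time w i..<jump_time w (Suc i)}) = (\<Sum>i<k. \<xi> (crw_chain w i) * fst (w i))"
      using mono by (intro sum.cong refl) (simp add: step less_imp_le pos)
    also have "measure lborel {jump_time w k..t} = t - jump_time w k" using k by simp
    finally show "has_bochner_integral lborel g ((\<Sum>i<k. \<xi> (crw_chain w i) * fst (w i)) + \<xi> (crw_chain w k) * (t - jump_time w k))" .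
  qed
  finally show ?thesis using k chain[of k t] by (simp add: fk_term_def)
qed

lemma crw_pos_measurable [measurable]:
  "(\<lambda>(w, s). crw_pos w s) \<in> measurable (crw_space \<Otimes>\<^sub>M borel) (count_space UNIV)"
proof -
  have [measurable]: "(\<lambda>x. crw_chain (fst x) i) \<in> measurable (crw_space \<Otimes>\<^sub>M borel) (count_space UNIV)" for i
    by measurable
  have "(\<lambda>x. crw_chain (fst x) (LEAST k. snd x < jump_time (fst x) (Suc k))) \<in> measurable (crw_space \<Otimes>\<^sub>M (borel :: real measure)) (count_space UNIV)"
    by (rule measurable_compose_countable) measurable
  then show ?thesis by (simp add: crw_pos_def crw_chain_def split_beta')
qed

text \<open>Almost surely exactly one number of jumps is right at time \<open>t\<close>. The
  identity also covers an infinite expectation: a divergent Bochner integral and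
  \<open>enn2real\<close> of infinity are both 0.\<close>

theorem pam_u_eq_green:
  assumes t: "0 \<le> t"
  shows "pam_u \<xi> t z = enn2real (green (\<lambda>b. \<xi> b - 2) UNIV (src z (\<lambda>t. ennreal (exp ((\<xi> z - 2) * t)))) 0 t)"
proof -
  let ?f = "\<lambda>w. exp (LINT s:{0..t}|lborel. \<xi> (crw_pos w s)) * (if crw_pos w t = z then 1 else 0)"
  have cw[measurable]: "(\<lambda>w. crw_pos w t) \<in> measurable crw_space (count_space UNIV)"
    using measurable_compose[OF _ crw_pos_measurable, of "\<lambda>w. (w, t)" crw_space] by simp
  have [measurable]: "?f \<in> borel_measurable crw_space"
    unfolding set_lebesgue_integral_def by measurable
  have "pam_u \<xi> t z = enn2real (\<integral>\<^sup>+w. ennreal (?f w) \<partial>crw_space)"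
    unfolding pam_u_def by (rule integral_eq_nn_integral) auto
  also have "(\<integral>\<^sup>+w. ennreal (?f w) \<partial>crw_space) = (\<integral>\<^sup>+w. (\<Sum>k. fk_term \<xi> z k 0 t w) \<partial>crw_space)"
  proof (rule nn_integral_cong_AE)
    show "AE w in crw_space. ennreal (?f w) = (\<Sum>k. fk_term \<xi> z k 0 t w)"
      using AE_crw_space_pos AE_jump_time_gt[of t]
    proof eventually_elim
      fix w assume pos: "\<forall>i. 0 < fst (w i)" and ex: "\<exists>k. t < jump_time w (Suc k)"
      have mono: "jump_time w i \<le> jump_time w j" if "i \<le> j" for i j
        unfolding jump_time_def using that pos by (intro sum_mono2) (auto simp: less_imp_le)
      define k where "k = (LEAST i. t < jump_time w (Suc i))"
      have k1: "t < jump_time w (Suc k)" unfolding k_def using ex by (rule LeastI_ex)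
      have k2: "jump_time w k \<le> t"
      proof (cases k)
        case 0 then show ?thesis using t by (simp add: jump_time_def)
      next
        case (Suc j)
        then have "\<not> t < jump_time w (Suc j)" using not_less_Least[of j "\<lambda>i. t < jump_time w (Suc i)"] unfolding k_def by simp
        then show ?thesis using Suc by simp
      qed
      have other: "fk_term \<xi> z i 0 t w = 0" if "i \<noteq> k" for i
        using that k1 k2 mono[of "Suc i" k] mono[of "Suc k" i] unfolding fk_term_def
        by (cases i k rule: linorder_cases) auto
      have "(\<Sum>i. fk_term \<xi> z i 0 t w) = (\<Sum>i\<in>{k}. fk_term \<xi> z i 0 t w)"
        by (rule suminf_finite) (use other in auto)
      also have "\<dots> = ennreal (?f w)" using crw_integrand[of w k t \<xi> z] pos k1 k2 t by simp
      finally show "ennreal (?f w) = (\<Sum>k. fk_term \<xi> z k 0 t w)" by simp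
    qed
  qed
  also have "\<dots> = (\<Sum>k. \<integral>\<^sup>+w. fk_term \<xi> z k 0 t w \<partial>crw_space)"
    by (rule nn_integral_suminf) measurable
  finally show ?thesis using t by (simp add: nn_integral_fk_term green_def)
qed

subsection \<open>Exchanging the two values of an unduplicated pair\<close>

lemma sum_Pow_insert:
  fixes f :: "'a set \<Rightarrow> 'b :: comm_monoid_add"
  assumes "finite I" "x \<notin> I"
  shows "(\<Sum>A\<in>Pow (insert x I). f A) = (\<Sum>A\<in>Pow I. f A) + (\<Sum>A\<in>Pow I. f (insert x A))"
proof -
  have inj: "inj_on (insert x) (Pow I)" using assms(2) by (auto simp: inj_on_def)
  have "(\<Sum>A\<in>Pow (insert x I). f A) = (\<Sum>A\<in>Pow I. f A) + (\<Sum>A\<in>insert x ` Pow I. f A)"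
    unfolding Pow_insert using assms by (intro sum.union_disjoint) auto
  also have "(\<Sum>A\<in>insert x ` Pow I. f A) = (\<Sum>A\<in>Pow I. f (insert x A))"
    by (simp add: sum.reindex[OF inj])
  finally show ?thesis .
qed

text \<open>Efron-Stein for fair bits. Splitting on the bit of \<open>x\<close>, the variance is the
  mean of the two conditional variances plus a quarter of the squared difference of the conditional
  means, and that difference is at most \<open>d x\<close>.\<close>

lemma cube_variance_le:
  fixes g :: "'a set \<Rightarrow> real"
  assumes "finite I" "\<And>A y. y \<in> I \<Longrightarrow> A \<subseteq> I - {y} \<Longrightarrow> \<bar>g (insert y A) - g A\<bar> \<le> d y"
  shows "(\<Sum>A\<in>Pow I. (g A)\<^sup>2) / 2 ^ card I - ((\<Sum>A\<in>Pow I. g A) / 2 ^ card I)\<^sup>2 \<le> (\<Sum>y\<in>I. (d y)\<^sup>2) / 4"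
  using assms
proof (induction I arbitrary: g rule: finite_induct)
  case empty then show ?case by simp
next
  case (insert x I)
  define N :: real where "N = 2 ^ card I"
  have N: "N > 0" by (simp add: N_def)
  have cN: "real (card (Pow I)) = N" using insert by (simp add: card_Pow N_def)
  let ?g1 = "\<lambda>A. g (insert x A)"
  define a where "a = (\<Sum>A\<in>Pow I. g A) / N"
  define b where "b = (\<Sum>A\<in>Pow I. ?g1 A) / N"
  define p where "p = (\<Sum>A\<in>Pow I. (g A)\<^sup>2) / N"
  define q where "q = (\<Sum>A\<in>Pow I. (?g1 A)\<^sup>2) / N"
  define D where "D = (\<Sum>y\<in>I. (d y)\<^sup>2) / 4"
  have 1: "p - a\<^sup>2 \<le> D" unfolding p_def a_def D_def N_def
  proof (rule insert.IH)
    fix A y assume "y \<in> I" "A \<subseteq> I - {y}"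
    then show "\<bar>g (insert y A) - g A\<bar> \<le> d y" using insert.prems[of y A] by auto
  qed
  have 2: "q - b\<^sup>2 \<le> D" unfolding q_def b_def D_def N_def
  proof (rule insert.IH)
    fix A y assume "y \<in> I" "A \<subseteq> I - {y}"
    then show "\<bar>?g1 (insert y A) - ?g1 A\<bar> \<le> d y"
      using insert.prems[of y "insert x A"] insert.hyps by (auto simp: insert_commute)
  qed
  have "\<bar>b - a\<bar> \<le> d x"
  proof -
    have "b - a = (\<Sum>A\<in>Pow I. ?g1 A - g A) / N" by (simp add: a_def b_def sum_subtractf diff_divide_distrib)
    also have "\<bar>\<dots>\<bar> \<le> (\<Sum>A\<in>Pow I. d x) / N"
    proof -
      have "\<bar>\<Sum>A\<in>Pow I. ?g1 A - g A\<bar> \<le> (\<Sum>A\<in>Pow I. d x)"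
        using insert.prems[of x] insert.hyps(2)
        by (intro order_trans[OF sum_abs] sum_mono) auto
      then show ?thesis using N by (simp only: abs_divide) (auto intro!: divide_right_mono)
    qed
    also have "\<dots> = d x" using N cN by simp
    finally show ?thesis .
  qed
  then have 3: "(b - a)\<^sup>2 \<le> (d x)\<^sup>2" by (metis abs_ge_zero power2_abs power_mono)
  have "(\<Sum>A\<in>Pow (insert x I). (g A)\<^sup>2) / 2 ^ card (insert x I) - ((\<Sum>A\<in>Pow (insert x I). g A) / 2 ^ card (insert x I))\<^sup>2
     = (p + q) / 2 - ((a + b) / 2)\<^sup>2"
    using insert.hyps N by (simp add: sum_Pow_insert p_def q_def a_def b_def N_def add_divide_distrib mult.commute)
  also have "\<dots> = ((p - a\<^sup>2) + (q - b\<^sup>2)) / 2 + (b - a)\<^sup>2 / 4"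
    by (simp add: power2_sum power2_diff power_divide add_divide_distrib diff_divide_distrib)
  also have "\<dots> \<le> (D + D) / 2 + (d x)\<^sup>2 / 4" using 1 2 3 by (intro add_mono divide_right_mono) auto
  also have "\<dots> = D + (d x)\<^sup>2 / 4" by simp
  also have "\<dots> = (\<Sum>y\<in>insert x I. (d y)\<^sup>2) / 4" using insert.hyps by (simp add: D_def)
  finally show ?case .
qed

text \<open>Complementation is a bijection of the cube, so an odd function has mean 0, and
  Chebyshev's inequality applies with the variance bound.\<close>

lemma cube_odd_tail:
  fixes g :: "'a set \<Rightarrow> real"
  assumes I: "finite I" and lip: "\<And>A y. y \<in> I \<Longrightarrow> A \<subseteq> I - {y} \<Longrightarrow> \<bar>g (insert y A) - g A\<bar> \<le> d y"
    and odd: "\<And>A. A \<subseteq> I \<Longrightarrow> g (I - A) = - g A" and e: "e > 0"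
  shows "real (card {A \<in> Pow I. e < \<bar>g A\<bar>}) \<le> 2 ^ card I * ((\<Sum>y\<in>I. (d y)\<^sup>2) / (4 * e\<^sup>2))"
proof -
  have "(\<Sum>A\<in>Pow I. g A) = (\<Sum>A\<in>Pow I. g (I - A))"
    by (rule sum.reindex_bij_witness[of _ "\<lambda>A. I - A" "\<lambda>A. I - A"]) (auto simp: double_diff)
  also have "\<dots> = - (\<Sum>A\<in>Pow I. g A)" using odd by (simp add: sum_negf)
  finally have 0: "(\<Sum>A\<in>Pow I. g A) = 0" by simp
  have "real (card {A \<in> Pow I. e < \<bar>g A\<bar>}) * e\<^sup>2 = (\<Sum>A\<in>{A \<in> Pow I. e < \<bar>g A\<bar>}. e\<^sup>2)" by simp
  also have "\<dots> \<le> (\<Sum>A\<in>{A \<in> Pow I. e < \<bar>g A\<bar>}. (g A)\<^sup>2)"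
    using e by (intro sum_mono) (auto intro!: abs_le_square_iff[THEN iffD1])
  also have "\<dots> \<le> (\<Sum>A\<in>Pow I. (g A)\<^sup>2)"
    using I by (intro sum_mono2) auto
  also have "\<dots> \<le> 2 ^ card I * ((\<Sum>y\<in>I. (d y)\<^sup>2) / 4)"
    using cube_variance_le[OF I lip] 0 by (simp add: field_simps)
  finally show ?thesis using e by (simp add: field_simps)
qed

text \<open>A configuration assigns to \<open>Inl z\<close> the value of the i.i.d. field at \<open>z\<close> and to \<open>Inr n\<close>
  the coin at \<open>n\<close>, with \<open>0\<close> for tails (no duplication).\<close>

definition swap_cfg :: "nat set \<Rightarrow> (int + nat \<Rightarrow> real) \<Rightarrow> int + nat \<Rightarrow> real" where
  "swap_cfg A x i = (case i of
       Inl z \<Rightarrow> if nat \<bar>z\<bar> \<in> A \<and> x (Inr (nat \<bar>z\<bar>)) = 0 then x (Inl (- z)) else x (Inl z)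
     | Inr n \<Rightarrow> x (Inr n))"

definition cfg_pot :: "(int + nat \<Rightarrow> real) \<Rightarrow> int \<Rightarrow> real" where
  "cfg_pot x = potential (\<lambda>z. x (Inl z)) (\<lambda>n. x (Inr n) \<noteq> 0)"

text \<open>Unlike \<open>swap_cfg\<close> this consults no coin: at a duplicated site the two
  values agree, so exchanging them is harmless.\<close>

definition flip_pot :: "nat set \<Rightarrow> (int \<Rightarrow> real) \<Rightarrow> int \<Rightarrow> real" where
  "flip_pot A V z = (if nat \<bar>z\<bar> \<in> A then V (- z) else V z)"

lemma cfg_pot_swap: "cfg_pot (swap_cfg A x) = flip_pot A (cfg_pot x)"
  by (auto simp: fun_eq_iff cfg_pot_def potential_def swap_cfg_def flip_pot_def)

lemma flip_pot_insert: "y \<notin> A \<Longrightarrow> flip_pot (insert y A) V = flip_pot {y} (flip_pot A V)"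
  by (auto simp: fun_eq_iff flip_pot_def)

lemma swap_cfg_insert: "y \<notin> A \<Longrightarrow> swap_cfg (insert y A) x = swap_cfg {y} (swap_cfg A x)"
  by (auto simp: fun_eq_iff swap_cfg_def split: sum.split)

lemma swap_cfg_measurable [measurable]:
  "swap_cfg A \<in> measurable (PiM UNIV (\<lambda>_. borel)) (PiM UNIV (\<lambda>_. borel))"
proof (rule measurable_PiM_single')
  fix i :: "int + nat"
  show "(\<lambda>x. swap_cfg A x i) \<in> borel_measurable (PiM UNIV (\<lambda>_. borel))"
    by (cases i) (auto simp: swap_cfg_def)
qed auto

text \<open>The swap at \<open>y\<close> leaves the coins alone. It is a permutation
  \<open>\<tau>\<close> of identically distributed coordinates on the
  \<open>\<tau>\<close>-invariant event that coin \<open>y\<close> shows tails, and the identity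
  elsewhere. Larger sets are reached one site at a time.\<close>

lemma distr_swap_cfg:
  assumes N: "\<And>i. prob_space (N i)" "\<And>i. sets (N i) = sets borel" "\<And>z z'. N (Inl z) = N (Inl z')"
    and "finite A"
  shows "distr (PiM UNIV N) (PiM UNIV N) (swap_cfg A) = PiM UNIV N"
  using \<open>finite A\<close>
proof (induction A rule: finite_induct)
  let ?P = "PiM UNIV N"
  have sP [measurable_cong]: "sets ?P = sets (PiM UNIV (\<lambda>_. borel))"
    by (intro sets_PiM_cong) (auto simp: N(2))
  {
    case empty
    have "swap_cfg {} x = x" for x by (auto simp: fun_eq_iff swap_cfg_def split: sum.split)
    then have "swap_cfg {} = (\<lambda>x. x)" by auto
    then show ?case by (simp add: distr_id)
  next
    case (insert y A)
    define \<pi> :: "int + nat \<Rightarrow> int + nat" where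
      "\<pi> i = (case i of Inl z \<Rightarrow> if nat \<bar>z\<bar> = y then Inl (- z) else Inl z | Inr n \<Rightarrow> Inr n)" for i
    have inj: "inj \<pi>" by (auto simp: inj_on_def \<pi>_def split: sum.splits if_splits)
    have N\<pi>: "N (\<pi> i) = N i" for i
    proof (cases i)
      case (Inl z)
      have "N (Inl (- z)) = N (Inl z)" by (rule N(3))
      then show ?thesis using Inl by (simp add: \<pi>_def)
    qed (simp add: \<pi>_def)
    define \<tau> where "\<tau> = (\<lambda>x::int + nat \<Rightarrow> real. \<lambda>i. x (\<pi> i))"
    have \<tau>: "distr ?P ?P \<tau> = ?P"
      using distr_PiM_reindex[of UNIV N \<pi> UNIV] N(1) inj by (simp add: N\<pi> \<tau>_def restrict_def)
    have [measurable]: "\<tau> \<in> measurable ?P ?P"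
    proof -
      have "\<tau> \<in> measurable (PiM UNIV (\<lambda>_. borel)) (PiM UNIV (\<lambda>_. borel))"
        unfolding \<tau>_def by (rule measurable_PiM_single') auto
      then show ?thesis by (simp only: measurable_cong_sets[OF sP sP])
    qed
    have sm [measurable]: "swap_cfg B \<in> measurable ?P ?P" for B
      using swap_cfg_measurable[of B] by (simp only: measurable_cong_sets[OF sP sP])
    have step: "distr ?P ?P (swap_cfg {y}) = ?P"
    proof (rule measure_eqI)
      fix B assume "B \<in> sets (distr ?P ?P (swap_cfg {y}))"
      then have B [measurable]: "B \<in> sets ?P" by simp
      define C where "C = {x \<in> space ?P. x (Inr y) = 0}"
      have C [measurable]: "C \<in> sets ?P" unfolding C_def by measurable
      have spB: "x \<in> space ?P" for x by (simp add: space_PiM sets_eq_imp_space_eq[OF N(2)])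
      have eq: "swap_cfg {y} -` B \<inter> space ?P = (B - C) \<union> (\<tau> -` (B \<inter> C) \<inter> space ?P)"
      proof -
        have sw: "swap_cfg {y} x = (if x \<in> C then \<tau> x else x)" for x
          using spB[of x] by (auto simp: fun_eq_iff swap_cfg_def C_def \<tau>_def \<pi>_def split: sum.split)
        have \<tau>C: "\<tau> x \<in> C \<longleftrightarrow> x \<in> C" for x
          using spB by (simp add: C_def \<tau>_def \<pi>_def)
        show ?thesis
        proof (rule set_eqI)
          fix x
          show "x \<in> swap_cfg {y} -` B \<inter> space ?P \<longleftrightarrow> x \<in> (B - C) \<union> (\<tau> -` (B \<inter> C) \<inter> space ?P)"
            by (cases "x \<in> C") (simp_all add: sw \<tau>C spB)
        qed
      qed
      have disj: "(B - C) \<inter> (\<tau> -` (B \<inter> C) \<inter> space ?P) = {}"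
        using spB by (auto simp: C_def \<tau>_def \<pi>_def)
      have "emeasure (distr ?P ?P (swap_cfg {y})) B = emeasure ?P (swap_cfg {y} -` B \<inter> space ?P)"
        by (rule emeasure_distr) auto
      also have "\<dots> = emeasure ?P (B - C) + emeasure ?P (\<tau> -` (B \<inter> C) \<inter> space ?P)"
        unfolding eq using disj by (intro plus_emeasure[symmetric]) auto
      also have "emeasure ?P (\<tau> -` (B \<inter> C) \<inter> space ?P) = emeasure (distr ?P ?P \<tau>) (B \<inter> C)"
        by (rule emeasure_distr[symmetric]) auto
      also have "\<dots> = emeasure ?P (B \<inter> C)" unfolding \<tau> ..
      also have "emeasure ?P (B - C) + emeasure ?P (B \<inter> C) = emeasure ?P ((B - C) \<union> (B \<inter> C))"
        by (rule plus_emeasure) auto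
      also have "(B - C) \<union> (B \<inter> C) = B" by auto
      finally show "emeasure (distr ?P ?P (swap_cfg {y})) B = emeasure ?P B" .
    qed simp
    have "swap_cfg (insert y A) = swap_cfg {y} \<circ> swap_cfg A"
      by (rule ext) (simp only: o_apply swap_cfg_insert[OF insert.hyps(2)])
    then have "distr ?P ?P (swap_cfg (insert y A)) = distr (distr ?P ?P (swap_cfg A)) ?P (swap_cfg {y})"
      by (simp add: distr_distr)
    then show ?case using insert.IH step by simp
  }
qed

text \<open>Averaging over the swaps turns the measure-preserving symmetry into an estimate by a
  pointwise count on the cube.\<close>

lemma emeasure_swap_average:
  assumes N: "\<And>i. prob_space (N i)" "\<And>i. sets (N i) = sets borel" "\<And>z z'. N (Inl z) = N (Inl z')"
    and I: "finite I" and \<Phi>: "\<Phi> \<in> sets (PiM UNIV N)" and [measurable]: "h \<in> borel_measurable (PiM UNIV N)"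
    and card: "\<And>x. real (card {A \<in> Pow I. swap_cfg A x \<in> \<Phi>}) \<le> 2 ^ card I * h x"
  shows "emeasure (PiM UNIV N) \<Phi> \<le> (\<integral>\<^sup>+x. ennreal (h x) \<partial>PiM UNIV N)"
proof -
  let ?P = "PiM UNIV N"
  have sP: "sets ?P = sets (PiM UNIV (\<lambda>_. borel))"
    by (intro sets_PiM_cong) (auto simp: N(2))
  have sp: "space ?P = UNIV" by (auto simp: space_PiM sets_eq_imp_space_eq[OF N(2)])
  have sm [measurable]: "swap_cfg B \<in> measurable ?P ?P" for B
    using swap_cfg_measurable[of B] by (simp only: measurable_cong_sets[OF sP sP])
  note [measurable] = \<Phi>
  have h0: "0 \<le> h x" for x
  proof -
    have "0 \<le> 2 ^ card I * h x" using card[of x] by (meson of_nat_0_le_iff order_trans)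
    moreover have "(0::real) < 2 ^ card I" by simp
    ultimately show ?thesis using mult_pos_neg[of "2 ^ card I" "h x"] by linarith
  qed
  have fin: "finite (Pow I)" using I by simp
  have "ennreal (2 ^ card I) * emeasure ?P \<Phi> = (\<Sum>A\<in>Pow I. emeasure ?P \<Phi>)"
    using I by (simp only: sum_constant ennreal_of_nat_eq_real_of_nat card_Pow) simp
  also have "\<dots> = (\<Sum>A\<in>Pow I. emeasure (distr ?P ?P (swap_cfg A)) \<Phi>)"
  proof (intro sum.cong refl)
    fix A assume "A \<in> Pow I"
    then have "finite A" using I by (auto intro: finite_subset)
    have "distr ?P ?P (swap_cfg A) = ?P" by (rule distr_swap_cfg) fact+
    then show "emeasure ?P \<Phi> = emeasure (distr ?P ?P (swap_cfg A)) \<Phi>" by simp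
  qed
  also have "\<dots> = (\<Sum>A\<in>Pow I. \<integral>\<^sup>+x. indicator (swap_cfg A -` \<Phi>) x \<partial>?P)"
  proof (intro sum.cong refl)
    fix A
    have "swap_cfg A -` \<Phi> \<inter> space ?P \<in> sets ?P" by measurable
    then have "swap_cfg A -` \<Phi> \<in> sets ?P" by (simp add: sp)
    then show "emeasure (distr ?P ?P (swap_cfg A)) \<Phi> = (\<integral>\<^sup>+x. indicator (swap_cfg A -` \<Phi>) x \<partial>?P)"
      by (simp add: emeasure_distr sp)
  qed
  also have "\<dots> = (\<integral>\<^sup>+x. (\<Sum>A\<in>Pow I. indicator (swap_cfg A -` \<Phi>) x) \<partial>?P)"
  proof (rule nn_integral_sum[symmetric])
    fix A
    have "swap_cfg A -` \<Phi> \<inter> space ?P \<in> sets ?P" by measurable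
    then have [measurable]: "swap_cfg A -` \<Phi> \<in> sets ?P" by (simp add: sp)
    show "indicator (swap_cfg A -` \<Phi>) \<in> borel_measurable ?P" by measurable
  qed
  also have "\<dots> \<le> (\<integral>\<^sup>+x. ennreal (2 ^ card I) * ennreal (h x) \<partial>?P)"
  proof (rule nn_integral_mono)
    fix x
    have "(\<Sum>A\<in>Pow I. indicator (swap_cfg A -` \<Phi>) x) = (\<Sum>A\<in>{A \<in> Pow I. swap_cfg A x \<in> \<Phi>}. 1 :: ennreal)"
      using fin by (intro sum.mono_neutral_cong_right) (auto simp: indicator_def)
    then have eq: "(\<Sum>A\<in>Pow I. indicator (swap_cfg A -` \<Phi>) x) = ennreal (real (card {A \<in> Pow I. swap_cfg A x \<in> \<Phi>}))"
      by (simp only: sum_constant ennreal_of_nat_eq_real_of_nat mult_1_right)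
    have le: "ennreal (real (card {A \<in> Pow I. swap_cfg A x \<in> \<Phi>})) \<le> ennreal (2 ^ card I * h x)"
      using card[of x] by (rule ennreal_leI)
    show "(\<Sum>A\<in>Pow I. indicator (swap_cfg A -` \<Phi>) x) \<le> ennreal (2 ^ card I) * ennreal (h x)"
      unfolding eq using le h0[of x] ennreal_mult[of "2 ^ card I" "h x"] by simp
  qed
  also have "\<dots> = ennreal (2 ^ card I) * (\<integral>\<^sup>+x. ennreal (h x) \<partial>?P)"
    by (rule nn_integral_cmult) measurable
  finally show ?thesis
    by (subst (asm) ennreal_mult_le_mult_iff) auto
qed

section \<open>Joint measurability in the field and in time\<close>

lemma psum_rate_cong: "(\<And>a. a \<in> S \<Longrightarrow> l a = l' a) \<Longrightarrow> psum l S g k = psum l' S g k"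
  by (induction k) (auto simp: fun_eq_iff)

lemma green_rate_cong: "(\<And>a. a \<in> S \<Longrightarrow> l a = l' a) \<Longrightarrow> green l S g = green l' S g"
  using psum_rate_cong[of S l l' g] by (auto simp: fun_eq_iff green_def)

text \<open>The next convolution integrates over the time argument, so measurability in the field
  for each fixed time would not survive the iteration; joint measurability does.\<close>

lemma volt_param_measurable:
  assumes [measurable]: "l \<in> borel_measurable N" "case_prod f \<in> borel_measurable (N \<Otimes>\<^sub>M borel)"
  shows "(\<lambda>(x, t). volt (l x) (f x) t) \<in> borel_measurable (N \<Otimes>\<^sub>M borel)"
proof -
  have [measurable]: "(\<lambda>p. f (fst (fst p)) (snd (fst p) - snd p)) \<in> borel_measurable ((N \<Otimes>\<^sub>M borel) \<Otimes>\<^sub>M lborel)"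
  proof -
    have "(\<lambda>p. case_prod f (fst (fst p), snd (fst p) - snd p)) \<in> borel_measurable ((N \<Otimes>\<^sub>M borel) \<Otimes>\<^sub>M lborel)"
      by (rule measurable_compose[OF _ assms(2)]) measurable
    then show ?thesis by simp
  qed
  have "(\<lambda>p. \<integral>\<^sup>+ s. ennreal (exp (l (fst p) * s)) * f (fst p) (snd p - s) * indicator {q. 0 \<le> snd q \<and> snd q \<le> fst q} (snd p, s) \<partial>lborel)
    \<in> borel_measurable (N \<Otimes>\<^sub>M borel)"
    by (rule lborel.borel_measurable_nn_integral) measurable
  moreover have "(\<lambda>p. \<integral>\<^sup>+ s. ennreal (exp (l (fst p) * s)) * f (fst p) (snd p - s) * indicator {q. 0 \<le> snd q \<and> snd q \<le> fst q} (snd p, s) \<partial>lborel)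
     = (\<lambda>(x, t). volt (l x) (f x) t)"
    by (auto simp: fun_eq_iff volt_def indicator_def intro!: nn_integral_cong)
  ultimately show ?thesis by simp
qed

lemma psum_param_measurable:
  assumes l: "\<And>b. (\<lambda>x. l x b) \<in> borel_measurable N"
    and v: "case_prod v \<in> borel_measurable (N \<Otimes>\<^sub>M borel)"
  shows "(\<lambda>(x, t). psum (l x) S (src n (v x)) k a t) \<in> borel_measurable (N \<Otimes>\<^sub>M borel)"
proof (induction k arbitrary: a)
  case 0
  then show ?case using v by (cases "a = n") (auto simp: src_def split_beta')
next
  case (Suc k)
  note [measurable] = Suc
  have "(\<lambda>(x, t). volt (l x a) (\<lambda>s. psum (l x) S (src n (v x)) k (a - 1) s + psum (l x) S (src n (v x)) k (a + 1) s) t)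
     \<in> borel_measurable (N \<Otimes>\<^sub>M borel)"
    by (rule volt_param_measurable[OF l]) measurable
  then show ?case by (cases "a \<in> S") auto
qed

lemma green_param_measurable:
  assumes "\<And>b. (\<lambda>x. l x b) \<in> borel_measurable N" "case_prod v \<in> borel_measurable (N \<Otimes>\<^sub>M borel)"
  shows "(\<lambda>(x, t). green (l x) S (src n (v x)) a t) \<in> borel_measurable (N \<Otimes>\<^sub>M borel)"
proof -
  note [measurable] = psum_param_measurable[OF assms]
  show ?thesis unfolding green_def split_beta' by measurable
qed

subsection \<open>Reduction to first passages\<close>

text \<open>Rates are centred at the value of the target site, which removes the factor
  \<open>exp ((V n - 2) * t)\<close> from the solution.\<close>

definition rate :: "(int \<Rightarrow> real) \<Rightarrow> int \<Rightarrow> int \<Rightarrow> real" where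
  "rate V n b = V b - V n"

definition near :: "int \<Rightarrow> nat \<Rightarrow> int set" where
  "near n K = {b. \<bar>b - n\<bar> < int K}"

text \<open>For positive \<open>n\<close>, the integers in it are exactly those with |b| + |b - n| <
  n + 2 L, so a walk from 0 to \<open>n\<close> with fewer jumps than that stays inside. For
  \<open>L < n\<close> it misses \<open>-n\<close>.\<close>

definition window :: "int \<Rightarrow> nat \<Rightarrow> int set" where
  "window n L = {- int L <..< n + int L}"

definition loops :: "(int \<Rightarrow> real) \<Rightarrow> int \<Rightarrow> nat \<Rightarrow> real \<Rightarrow> ennreal" where
  "loops V n K = green (rate V n) (near n K) (src n (\<lambda>_. 1)) n"

definition passage :: "(int \<Rightarrow> real) \<Rightarrow> int \<Rightarrow> nat \<Rightarrow> nat \<Rightarrow> real \<Rightarrow> ennreal" where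
  "passage V n K L = green (rate V n) (window n L - {n}) (src n (loops V n K)) 0"

definition log_passage :: "(int \<Rightarrow> real) \<Rightarrow> int \<Rightarrow> nat \<Rightarrow> nat \<Rightarrow> real \<Rightarrow> real" where
  "log_passage V n K L t = ln (enn2real (passage V n K L t))"

text \<open>The range of \<open>b\<close> is symmetric about 0, larger than \<open>window\<close>,
  so that the condition is invariant under reflection and under all exchanges. The last conjunct
  makes \<open>loops\<close> insensitive to both operations.\<close>

definition gap :: "(int \<Rightarrow> real) \<Rightarrow> int \<Rightarrow> nat \<Rightarrow> nat \<Rightarrow> real \<Rightarrow> bool" where
  "gap V n K L w \<longleftrightarrow> V (- n) = V n \<and> 0 < V n \<and>
     (\<forall>b. \<bar>b\<bar> < n + int L \<longrightarrow> \<bar>b\<bar> \<noteq> n \<longrightarrow> 0 \<le> V b \<and> V b \<le> V n - w) \<and>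
     (\<forall>b\<in>near n K. V (- b) = V b)"

lemma gapD: "gap V n K L w \<Longrightarrow> \<bar>b\<bar> < n + int L \<Longrightarrow> \<bar>b\<bar> \<noteq> n \<Longrightarrow> 0 \<le> V b \<and> V b \<le> V n - w"
  by (simp add: gap_def)

lemma log_passage_measurable:
  assumes [measurable]: "\<And>b. (\<lambda>x. V x b) \<in> borel_measurable N"
  shows "(\<lambda>x. log_passage (V x) n K L t) \<in> borel_measurable N"
proof -
  have r: "(\<lambda>x. rate (V x) n b) \<in> borel_measurable N" for b
    unfolding rate_def by measurable
  have "(\<lambda>(x, t). loops (V x) n K t) \<in> borel_measurable (N \<Otimes>\<^sub>M borel)"
    unfolding loops_def by (rule green_param_measurable[OF r]) simp
  then have "(\<lambda>(x, t). passage (V x) n K L t) \<in> borel_measurable (N \<Otimes>\<^sub>M borel)"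
    unfolding passage_def by (intro green_param_measurable[OF r])
  from measurable_compose[OF _ this, of "\<lambda>x. (x, t)" N] have "(\<lambda>x. passage (V x) n K L t) \<in> borel_measurable N"
    by simp
  then show ?thesis unfolding log_passage_def by measurable
qed

lemma loops_cong: "(\<And>b. b \<in> near n K \<Longrightarrow> V b = V' b) \<Longrightarrow> V n = V' n \<Longrightarrow> loops V n K = loops V' n K"
  unfolding loops_def by (auto simp: rate_def intro!: green_rate_cong[THEN fun_cong])

lemma passage_cong:
  assumes "\<And>b. b \<in> window n L \<Longrightarrow> V b = V' b" "K \<le> L" "0 < n" "0 < L"
  shows "passage V n K L = passage V' n K L"
proof -
  have "near n K \<subseteq> window n L" "n \<in> window n L" using assms by (auto simp: near_def window_def)
  then have "loops V n K = loops V' n K" using assms by (intro loops_cong) auto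
  moreover have "green (rate V n) (window n L - {n}) g = green (rate V' n) (window n L - {n}) g" for g
    using assms \<open>n \<in> window n L\<close> by (intro green_rate_cong) (auto simp: rate_def)
  ultimately show ?thesis by (simp add: passage_def)
qed

section \<open>Sensitivity of first-passage weights to one exchange\<close>

text \<open>exp(2 t) is 1 plus the integral of 2 exp(2 s): it solves the equation when every rate is
  0. This is what keeps \<open>loops\<close> finite.\<close>

lemma green_src_le_exp:
  assumes l: "\<And>a. a \<in> S \<Longrightarrow> l a \<le> 0" and t: "0 \<le> t"
  shows "green l S (src n (\<lambda>_. 1)) a t \<le> ennreal (exp (2 * t))"
proof (rule green_le[OF _ _ t])
  fix b s assume s: "0 \<le> (s::real)"
  have v: "volt 0 (\<lambda>s. ennreal (exp (2 * s)) + ennreal (exp (2 * s))) s = ennreal (exp (2 * s) - 1)"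
  proof -
    have "volt 0 (\<lambda>s. ennreal (exp (2 * s)) + ennreal (exp (2 * s))) s = volt 0 (\<lambda>s. ennreal (exp (2 * s)) * 2) s"
      by (simp add: mult_2_right)
    also have "\<dots> = ennreal (exp (2 * s)) * (volt (0 - 2) (\<lambda>_. 2 * 1) s)"
      by (subst volt_exp_shift) auto
    also have "volt (0 - 2) (\<lambda>_. 2 * 1) s = 2 * ennreal ((1 - exp (- 2 * s)) / 2)"
      using s by (subst volt_cmult) (auto simp: volt_1 minus_divide_left)
    also have "\<dots> = ennreal (2 * ((1 - exp (- 2 * s)) / 2))"
      using s by (subst ennreal_mult) auto
    also have "ennreal (exp (2 * s)) * \<dots> = ennreal (exp (2 * s) * (1 - exp (- 2 * s)))"
      using s by (subst ennreal_mult[symmetric]) auto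
    also have "exp (2 * s) * (1 - exp (- 2 * s)) = exp (2 * s) - 1"
      by (simp add: right_diff_distrib exp_add[symmetric])
    finally show ?thesis .
  qed
  have "(if b \<in> S then volt (l b) (\<lambda>s. ennreal (exp (2 * s)) + ennreal (exp (2 * s))) s else 0) \<le> ennreal (exp (2 * s) - 1)"
    using l unfolding v[symmetric] by (auto intro!: volt_mono)
  moreover have "src n (\<lambda>_. 1) b s \<le> ennreal 1" by (simp add: src_def)
  ultimately have "src n (\<lambda>_. 1) b s + (if b \<in> S then volt (l b) (\<lambda>s. ennreal (exp (2 * s)) + ennreal (exp (2 * s))) s else 0)
    \<le> ennreal 1 + ennreal (exp (2 * s) - 1)" by (intro add_mono)
  also have "\<dots> = ennreal (exp (2 * s))" using s by (subst ennreal_plus[symmetric]) auto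
  finally show "src n (\<lambda>_. 1) b s + (if b \<in> S then volt (l b) (\<lambda>s. ennreal (exp (2 * s)) + ennreal (exp (2 * s))) s else 0)
    \<le> ennreal (exp (2 * s))" .
qed measurable

lemma psum_le_green: "psum l S g k a t \<le> green l S g a t"
proof -
  have "(\<Sum>k\<in>{k}. psum l S g k a t) \<le> (\<Sum>k. psum l S g k a t)"
    by (rule sum_le_suminf) auto
  then show ?thesis by (simp add: green_def)
qed

lemma psum_mono_src: "(\<And>s. 0 \<le> s \<Longrightarrow> v s \<le> v' s) \<Longrightarrow> 0 \<le> t \<Longrightarrow> psum l S (src n v) k a t \<le> psum l S (src n v') k a t"
  by (induction k arbitrary: a t) (auto simp: src_def intro!: volt_mono add_mono)

text \<open>The straight walk alone has positive weight; logarithms need this.\<close>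

lemma green_direct_pos:
  assumes n: "0 < n" "{0..<n} \<subseteq> S" and l: "\<And>b. b \<in> S \<Longrightarrow> - m \<le> l b" "m > 0" and t: "0 < t"
    and v: "\<And>s. 0 \<le> s \<Longrightarrow> 1 \<le> v s"
  shows "0 < green l S (src n v) 0 t"
proof -
  let ?s = "t / real (nat n)"
  have "0 < ((1 - exp (- m * ?s)) / m) ^ nat n"
    using n l t by (intro zero_less_power divide_pos_pos) auto
  then have "0 < ennreal (((1 - exp (- m * ?s)) / m) ^ nat n)" by (simp del: zero_less_power)
  also have "\<dots> \<le> psum l S (src n (\<lambda>_. 1)) (nat n) (n - int (nat n)) t"
    using n l t by (intro psum_direct_ge) (auto simp: subset_eq)
  also have "\<dots> \<le> psum l S (src n v) (nat n) 0 t"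
    using n t v by (auto intro!: psum_mono_src)
  also have "\<dots> \<le> green l S (src n v) 0 t" by (rule psum_le_green)
  finally show ?thesis .
qed

lemma one_le_loops: "1 \<le> loops V n K t"
  unfolding loops_def using psum_le_green[of "rate V n" "near n K" "src n (\<lambda>_. 1)" 0 n t] by (simp add: src_def)

lemma ln_enn2real_diff_le:
  assumes X: "0 < X" "X < \<infinity>" and XX': "X \<le> X'" "X' \<le> ennreal (1 + c) * X" and c: "0 \<le> c"
  shows "\<bar>ln (enn2real X') - ln (enn2real X)\<bar> \<le> c"
proof -
  obtain x where x: "X = ennreal x" "0 < x" using X by (cases X) auto
  have cX: "ennreal (1 + c) * X = ennreal ((1 + c) * x)" using x c ennreal_mult[of "1 + c" x] by simp
  have "X' < \<infinity>" using XX'(2) unfolding cX by (rule le_less_trans) simp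
  then obtain x' where x': "X' = ennreal x'" "0 \<le> x'" by (cases X') auto
  have 1: "x \<le> x'" using XX'(1) x x' by simp
  have 2: "x' \<le> (1 + c) * x" using XX'(2) x x' c unfolding cX by simp
  have "ln x \<le> ln x'" using 1 x by simp
  moreover have "ln x' \<le> ln ((1 + c) * x)" using 1 2 x c by simp
  moreover have "ln ((1 + c) * x) = ln (1 + c) + ln x" using x c by (simp add: ln_mult)
  moreover have "ln (1 + c) \<le> c" using c by (simp add: ln_add_one_self_le_self)
  ultimately show ?thesis using x x' by simp
qed

text \<open>\<open>green_single_site\<close> on a logarithmic scale, with old and new rate
  interchanged when the rate drops. The lower bound \<open>- m\<close> on the rates serves
  positivity, the upper bound \<open>- w\<close> serves finiteness and the estimate.\<close>

lemma log_green_upd_le: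
  assumes v: "v \<in> borel_measurable borel" "mono_on {0..} v" "\<And>s. 0 \<le> s \<Longrightarrow> 1 \<le> v s" "v t < \<infinity>"
    and n: "0 < n" "{0..<n} \<subseteq> S" "n \<notin> S" and w: "w \<ge> 4"
    and l: "\<And>b. b \<in> S \<Longrightarrow> - m \<le> l b \<and> l b \<le> - w" "y \<in> S \<Longrightarrow> - m \<le> c \<and> c \<le> - w" "m > 0" and t: "0 < t"
  shows "\<bar>ln (enn2real (green (l(y := c)) S (src n v) 0 t)) - ln (enn2real (green l S (src n v) 0 t))\<bar> \<le> 2 * \<bar>c - l y\<bar> / w"
proof (cases "y \<in> S")
  case False
  then have "green (l(y := c)) S (src n v) = green l S (src n v)" by (intro green_rate_cong) auto
  then show ?thesis using w by simp
next
  case True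
  have m1: "src n v b \<in> borel_measurable borel" for b using v(1) by measurable
  have fin: "green l' S (src n v) 0 t < \<infinity>" if "\<And>b. b \<in> S \<Longrightarrow> l' b \<le> - w" for l'
  proof -
    have "green l' S (src n v) 0 t \<le> ennreal ((2 / w) ^ nat \<bar>0 - n\<bar>) * v t"
      using that w n t v by (intro green_src_le) auto
    also have "\<dots> < \<infinity>" using v(4) by (simp add: ennreal_mult_less_top)
    finally show ?thesis .
  qed
  have pos: "0 < green l' S (src n v) 0 t" if "\<And>b. b \<in> S \<Longrightarrow> - m \<le> l' b" for l'
    using that n l t v by (intro green_direct_pos) auto
  have l': "- m \<le> (l(y := c)) b \<and> (l(y := c)) b \<le> - w" if "b \<in> S" for b
    using l that True by auto
  show ?thesis
  proof (cases "l y \<le> c")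
    case le: True
    have "\<bar>ln (enn2real (green (l(y := c)) S (src n v) 0 t)) - ln (enn2real (green l S (src n v) 0 t))\<bar> \<le> 2 * (c - l y) / w"
    proof (rule ln_enn2real_diff_le)
      show "green l S (src n v) 0 t \<le> green (l(y := c)) S (src n v) 0 t"
        using le t by (intro green_mono_set[OF m1]) auto
      show "green (l(y := c)) S (src n v) 0 t \<le> ennreal (1 + 2 * (c - l y) / w) * green l S (src n v) 0 t"
        using le t v n w l l' True by (intro green_single_site[where y = y]) auto
    qed (use pos fin l w le in auto)
    then show ?thesis using le by simp
  next
    case le: False
    have "\<bar>ln (enn2real (green l S (src n v) 0 t)) - ln (enn2real (green (l(y := c)) S (src n v) 0 t))\<bar> \<le> 2 * (l y - c) / w"
    proof (rule ln_enn2real_diff_le)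
      show "green (l(y := c)) S (src n v) 0 t \<le> green l S (src n v) 0 t"
        using le t by (intro green_mono_set[OF m1]) auto
      show "green l S (src n v) 0 t \<le> ennreal (1 + 2 * (l y - c) / w) * green (l(y := c)) S (src n v) 0 t"
        using le t v n w l l' True by (intro green_single_site[where y = y]) auto
    qed (use pos fin l' w le in auto)
    then show ?thesis using le by simp
  qed
qed

lemma loops_props:
  assumes "gap V n K L w" "w \<ge> 0" "K \<le> L" "0 < n" "L < n"
  shows "loops V n K \<in> borel_measurable borel" "mono_on {0..} (loops V n K)" "0 \<le> t \<Longrightarrow> loops V n K t < \<infinity>"
proof -
  show "loops V n K \<in> borel_measurable borel" unfolding loops_def by (rule green_measurable) measurable
  show "mono_on {0..} (loops V n K)" unfolding loops_def by (intro green_mono_on src_mono_on) (simp add: mono_on_def)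
  assume t: "0 \<le> t"
  have "loops V n K t \<le> ennreal (exp (2 * t))" unfolding loops_def
  proof (rule green_src_le_exp[OF _ t])
    fix a assume a: "a \<in> near n K"
    show "rate V n a \<le> 0"
    proof (cases "a = n")
      case False
      then have "V a \<le> V n - w" using assms a unfolding gap_def near_def by auto
      then show ?thesis using assms(2) by (simp add: rate_def)
    qed (simp add: rate_def)
  qed
  also have "\<dots> < \<infinity>" by simp
  finally show "loops V n K t < \<infinity>" .
qed

lemma gap_flip:
  assumes g: "gap V n K L w"
  shows "gap (flip_pot A V) n K L w"
proof -
  have n: "V (- n) = V n" "0 < V n" using g by (auto simp: gap_def)
  have fn: "flip_pot A V n = V n" "flip_pot A V (- n) = V n" using n by (auto simp: flip_pot_def)
  have "0 \<le> flip_pot A V b \<and> flip_pot A V b \<le> V n - w" if "\<bar>b\<bar> < n + int L" "\<bar>b\<bar> \<noteq> n" for b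
    using gapD[OF g, of b] gapD[OF g, of "- b"] that by (auto simp: flip_pot_def)
  moreover have "flip_pot A V (- b) = flip_pot A V b" if "b \<in> near n K" for b
    using g that unfolding gap_def flip_pot_def by simp
  ultimately show ?thesis using n by (simp add: gap_def fn)
qed

text \<open>An exchange is two rate changes, at \<open>y\<close> and at \<open>- y\<close>, each
  with constant 2/w. The source \<open>loops\<close> does not move because the field is symmetric
  near \<open>n\<close>. At y = n the exchange is trivial by \<open>gap\<close>, which the first
  case includes.\<close>

lemma log_passage_flip_le:
  assumes g: "gap V n K L w" and n: "0 < n" "L < n" "K \<le> L" "0 < L" and w: "w \<ge> 4" and t: "0 < t" and y: "0 < y"
  shows "\<bar>log_passage (flip_pot {y} V) n K L t - log_passage V n K L t\<bar> \<le> 4 * \<bar>V (int y) - V (- int y)\<bar> / w"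
proof (cases "V (- int y) = V (int y)")
  case True
  then have "flip_pot {y} V = V" by (auto simp: flip_pot_def fun_eq_iff abs_if)
  then show ?thesis using w by simp
next
  case False
  let ?V = "flip_pot {y} V" and ?S = "window n L - {n}" and ?v = "loops V n K"
  have yn: "int y \<noteq> n" using g False by (auto simp: gap_def)
  have nn: "?V n = V n" using yn n by (auto simp: flip_pot_def)
  have nearV: "?V b = V b" if "b \<in> near n K" for b using g that by (auto simp: gap_def flip_pot_def)
  have lp: "loops ?V n K = ?v" by (rule loops_cong) (auto simp: nearV nn)
  define l where "l = rate V n"
  define l1 where "l1 = l(int y := V (- int y) - V n)"
  define l2 where "l2 = l1(- int y := V (int y) - V n)"
  have l2: "rate ?V n = l2"
  proof
    fix b
    have "rate ?V n b = ?V b - V n" by (simp add: rate_def nn)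
    then show "rate ?V n b = l2 b"
      using y by (auto simp: l2_def l1_def l_def rate_def flip_pot_def)
  qed
  have bnd: "0 \<le> V b \<and> V b \<le> V n - w" "0 \<le> V (- b) \<and> V (- b) \<le> V n - w" if "b \<in> ?S" for b
  proof -
    have "\<bar>b\<bar> < n + int L" "\<bar>b\<bar> \<noteq> n" using that n by (auto simp: window_def)
    then show "0 \<le> V b \<and> V b \<le> V n - w" "0 \<le> V (- b) \<and> V (- b) \<le> V n - w"
      using gapD[OF g, of b] gapD[OF g, of "- b"] by auto
  qed
  have Vn: "0 < V n" using g by (simp add: gap_def)
  have v: "?v \<in> borel_measurable borel" "mono_on {0..} ?v" "?v t < \<infinity>"
    using loops_props[OF g _ n(3) n(1) n(2)] w t by auto
  have S: "{0..<n} \<subseteq> ?S" "n \<notin> ?S" using n by (auto simp: window_def)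
  have lb: "- V n \<le> l b \<and> l b \<le> - w" if "b \<in> ?S" for b using bnd(1)[OF that] by (simp add: l_def rate_def)
  have l1b: "- V n \<le> l1 b \<and> l1 b \<le> - w" if "b \<in> ?S" for b
    using lb[OF that] bnd(2)[OF that] by (auto simp: l1_def)
  let ?G = "\<lambda>l. ln (enn2real (green l ?S (src n ?v) 0 t))"
  have 1: "\<bar>?G l1 - ?G l\<bar> \<le> 2 * \<bar>V (- int y) - V n - l (int y)\<bar> / w"
    unfolding l1_def using v n S w Vn t lb bnd(2)[of "int y"] one_le_loops
    by (intro log_green_upd_le[where m = "V n"]) auto
  have 2: "\<bar>?G l2 - ?G l1\<bar> \<le> 2 * \<bar>V (int y) - V n - l1 (- int y)\<bar> / w"
    unfolding l2_def using v n S w Vn t l1b bnd(2)[of "- int y"] one_le_loops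
    by (intro log_green_upd_le[where m = "V n"]) auto
  have e: "V (- int y) - V n - l (int y) = V (- int y) - V (int y)" "V (int y) - V n - l1 (- int y) = V (int y) - V (- int y)"
    using y by (auto simp: l_def l1_def rate_def)
  have "\<bar>?G l2 - ?G l\<bar> \<le> 4 * \<bar>V (int y) - V (- int y)\<bar> / w"
    using 1 2 unfolding e by (simp add: abs_minus_commute[of "V (- int y)"])
  then show ?thesis unfolding log_passage_def passage_def lp l2 l_def .
qed

text \<open>On the window, reflecting a field means exchanging all pairs in \<open>U\<close>, so
  reflection after exchanging \<open>A\<close> is exchanging U - A. The difference is thus odd under
  complementation, and the constant 8 is 4 for each of its two terms.\<close>

lemma log_passage_flip_tail:
  assumes g: "gap V n K L w" and n: "0 < n" "L < n" "K \<le> L" "0 < L" and w: "w \<ge> 4" and t: "0 < t" and e: "e > 0"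
  defines "U \<equiv> {1..<nat n + L}"
  shows "real (card {A \<in> Pow U. e < \<bar>log_passage (flip_pot A V) n K L t - log_passage (\<lambda>b. flip_pot A V (- b)) n K L t\<bar>})
    \<le> 2 ^ card U * ((\<Sum>y\<in>U. (8 * \<bar>V (int y) - V (- int y)\<bar> / w)\<^sup>2) / (4 * e\<^sup>2))"
proof -
  let ?F = "\<lambda>A. log_passage (flip_pot A V) n K L t"
  define f where "f A = ?F A - ?F (U - A)" for A
  have lip: "\<bar>?F (insert y A) - ?F A\<bar> \<le> 4 * \<bar>V (int y) - V (- int y)\<bar> / w" if "y \<in> U" "y \<notin> A" for A y
  proof -
    have "\<bar>log_passage (flip_pot {y} (flip_pot A V)) n K L t - ?F A\<bar> \<le> 4 * \<bar>flip_pot A V (int y) - flip_pot A V (- int y)\<bar> / w"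
      using that n w t by (intro log_passage_flip_le gap_flip g) (auto simp: U_def)
    then show ?thesis using that(2) by (simp only: flip_pot_insert[OF that(2), symmetric]) (simp add: flip_pot_def)
  qed
  have eq: "log_passage (\<lambda>b. flip_pot A V (- b)) n K L t = ?F (U - A)" if "A \<subseteq> U" for A
  proof -
    have "passage (\<lambda>b. flip_pot A V (- b)) n K L = passage (flip_pot (U - A) V) n K L"
    proof (rule passage_cong)
      fix b assume "b \<in> window n L"
      \<comment> \<open>The site 0 is its own mirror image and belongs to no pair.\<close>
      then have "b = 0 \<or> nat \<bar>b\<bar> \<in> U" using n by (auto simp: window_def U_def)
      then show "flip_pot A V (- b) = flip_pot (U - A) V b" using that by (auto simp: flip_pot_def)
    qed (use n in auto)
    then show ?thesis by (simp add: log_passage_def)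
  qed
  have tail: "real (card {A \<in> Pow U. e < \<bar>f A\<bar>}) \<le> 2 ^ card U * ((\<Sum>y\<in>U. (8 * \<bar>V (int y) - V (- int y)\<bar> / w)\<^sup>2) / (4 * e\<^sup>2))"
  proof (rule cube_odd_tail)
    fix A y assume y: "y \<in> U" "A \<subseteq> U - {y}"
    have "U - A = insert y (U - insert y A)" using y by auto
    then have "\<bar>?F (U - A) - ?F (U - insert y A)\<bar> \<le> 4 * \<bar>V (int y) - V (- int y)\<bar> / w"
      using lip[of y "U - insert y A"] y by auto
    moreover have "\<bar>?F (insert y A) - ?F A\<bar> \<le> 4 * \<bar>V (int y) - V (- int y)\<bar> / w"
      using y by (intro lip) auto
    ultimately show "\<bar>f (insert y A) - f A\<bar> \<le> 8 * \<bar>V (int y) - V (- int y)\<bar> / w"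
      unfolding f_def by linarith
  next
    fix A assume "A \<subseteq> U" then show "f (U - A) = - f A" by (simp add: f_def double_diff)
  qed (auto simp: U_def e)
  have sets: "{A \<in> Pow U. e < \<bar>?F A - log_passage (\<lambda>b. flip_pot A V (- b)) n K L t\<bar>} = {A \<in> Pow U. e < \<bar>f A\<bar>}"
  proof (rule Collect_cong, rule conj_cong[OF refl])
    fix A assume "A \<in> Pow U"
    then show "(e < \<bar>?F A - log_passage (\<lambda>b. flip_pot A V (- b)) n K L t\<bar>) = (e < \<bar>f A\<bar>)"
      unfolding f_def by (subst eq) auto
  qed
  show ?thesis unfolding sets by (rule tail)
qed

section \<open>From the solution to the first-passage weight\<close>

text \<open>k^k/k! is one term of the exponential series at \<open>k\<close>.\<close>

lemma power_div_fact_le: "(real k / exp 1) ^ k / fact k \<le> 1"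
proof -
  have "(\<lambda>j. (real k) ^ j /\<^sub>R fact j) sums exp (real k)" by (rule exp_converges)
  then have "(\<Sum>j\<in>{k}. (real k) ^ j /\<^sub>R fact j) \<le> exp (real k)"
    using sum_le_suminf[of "\<lambda>j. (real k) ^ j /\<^sub>R fact j" "{k}"] by (auto simp: sums_iff)
  then have "real k ^ k / fact k \<le> exp (real k)" by (simp add: divide_inverse mult.commute)
  moreover have "(real k / exp 1) ^ k = real k ^ k / exp (real k)"
    using exp_of_nat_mult[of k "1::real"] by (simp only: power_divide mult_1_right)
  ultimately have "(real k / exp 1) ^ k / fact k = (real k ^ k / fact k) / exp (real k)"
    and "real k ^ k / fact k \<le> exp (real k)" by simp_all
  then show ?thesis by (simp only: divide_le_eq_1_pos[OF exp_gt_zero])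
qed

definition walk_mass :: "(int \<Rightarrow> real) \<Rightarrow> int \<Rightarrow> real \<Rightarrow> ennreal" where
  "walk_mass V n t = green (rate V n) UNIV (src n (\<lambda>_. 1)) 0 t"

lemma pam_u_eq_walk_mass:
  assumes t: "0 \<le> t"
  shows "pam_u V t n = enn2real (ennreal (exp ((V n - 2) * t)) * walk_mass V n t)"
proof -
  have "green (\<lambda>b. V b - 2) UNIV (src n (\<lambda>t. ennreal (exp ((V n - 2) * t)) * 1)) 0 t
     = ennreal (exp ((V n - 2) * t)) * green (\<lambda>b. V b - 2 - (V n - 2)) UNIV (src n (\<lambda>_. 1)) 0 t"
    unfolding green_def by (subst psum_exp_shift) auto
  then show ?thesis using t by (simp add: pam_u_eq_green walk_mass_def rate_def[abs_def])
qed

lemma pam_u_reflect: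
  assumes t: "0 \<le> t"
  shows "pam_u V t (- n) = pam_u (\<lambda>b. V (- b)) t n"
proof -
  have "psum (\<lambda>b. V b - 2) UNIV (src (- n) v) k 0 t = psum (\<lambda>b. V (- b) - 2) UNIV (src n v) k 0 t" for v k
    using psum_reflect[of "\<lambda>b. V (- b) - 2" n v k 0 t] by simp
  then show ?thesis using t by (simp add: pam_u_eq_green green_def)
qed

text \<open>Under this condition the walks with \<open>k\<close> jumps, for each \<open>k\<close> large enough to leave the window, weigh at most
  \<open>exp (-k)\<close> times the straight walk from \<open>0\<close> to \<open>n\<close>.\<close>

definition crude :: "(int \<Rightarrow> real) \<Rightarrow> int \<Rightarrow> nat \<Rightarrow> real \<Rightarrow> bool" where
  "crude V n L t \<longleftrightarrow> (\<forall>k\<ge>nat n + 2 * L. \<forall>b. \<bar>b\<bar> + \<bar>b - n\<bar> \<le> int k \<longrightarrow>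
     t * max 0 (V b - V n) + real_of_int n * ln (2 * V n) + real k \<le> real k * ln (real k / (2 * exp 1 * t)))"

lemma psum_crude_le:
  assumes cr: "crude V n L t" and k: "nat n + 2 * L \<le> k" "0 < k" and n: "0 < n" and t: "0 < t" and m: "0 < V n"
  shows "psum (rate V n) UNIV (src n (\<lambda>_. 1)) k 0 t \<le> ennreal (exp (- real k) * (1 / (2 * V n)) ^ nat n)"
proof -
  \<comment> \<open>\<open>M\<close> solves exp(M t) (2 e t / k)^k = exp(-k) (2 V n)^(-n), where (2
    e t / k)^k bounds (2 t)^k / k!. The condition \<open>crude\<close> says that no reachable rate
    exceeds it.\<close>
  define M where "M = (real k * ln (real k / (2 * exp 1 * t)) - real k - real_of_int n * ln (2 * V n)) / t"
  have 1: "max 0 (V b - V n) \<le> M" if "\<bar>b\<bar> + \<bar>b - n\<bar> \<le> int k" for b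
  proof -
    have "t * max 0 (V b - V n) + real_of_int n * ln (2 * V n) + real k \<le> real k * ln (real k / (2 * exp 1 * t))"
      using cr k that unfolding crude_def by blast
    moreover have "t * max 0 (V b - V n) = max 0 (V b - V n) * t" by (rule mult.commute)
    ultimately show ?thesis unfolding M_def pos_le_divide_eq[OF t] by linarith
  qed
  have "M \<ge> 0" using 1[of 0] k n by auto
  then have "psum (rate V n) UNIV (src n (\<lambda>_. 1)) k 0 t \<le> ennreal (2 ^ k) * (ennreal (exp (M * t)) * ennreal (t ^ k / fact k))"
    using 1 t by (intro psum_le_crude) (auto simp: rate_def)
  also have "\<dots> = ennreal (2 ^ k * (exp (M * t) * (t ^ k / fact k)))"
  proof -
    have "0 \<le> t ^ k / fact k" using t by simp
    then show ?thesis by (simp only: ennreal_mult[symmetric] exp_ge_zero zero_le_power zero_le_numeral mult_nonneg_nonneg)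
  qed
  also have "2 ^ k * (exp (M * t) * (t ^ k / fact k)) = (real k / exp 1) ^ k / fact k * (exp (- real k) * (1 / (2 * V n)) ^ nat n)"
  proof -
    have kt: "0 < real k / (2 * exp 1 * t)" using k t by simp
    have "M * t = real k * ln (real k / (2 * exp 1 * t)) + (- real k) + - (real_of_int n * ln (2 * V n))"
      using t by (simp add: M_def)
    then have "exp (M * t) = exp (real k * ln (real k / (2 * exp 1 * t))) * exp (- real k) * exp (- (real_of_int n * ln (2 * V n)))"
      by (simp only: exp_add)
    also have "exp (real k * ln (real k / (2 * exp 1 * t))) = (real k / (2 * exp 1 * t)) ^ k"
      using kt by (simp add: exp_of_nat_mult)
    also have "exp (- (real_of_int n * ln (2 * V n))) = (1 / (2 * V n)) ^ nat n"
    proof -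
      have "exp (real_of_int n * ln (2 * V n)) = (2 * V n) ^ nat n"
        using n m exp_of_nat_mult[of "nat n" "ln (2 * V n)"] by simp
      then show ?thesis by (simp add: exp_minus power_one_over inverse_eq_divide)
    qed
    finally have "2 ^ k * (exp (M * t) * (t ^ k / fact k)) = 2 ^ k * t ^ k * (real k / (2 * exp 1 * t)) ^ k / fact k * (exp (- real k) * (1 / (2 * V n)) ^ nat n)"
      by simp
    also have "2 ^ k * t ^ k * (real k / (2 * exp 1 * t)) ^ k = (2 * t * (real k / (2 * exp 1 * t))) ^ k"
      by (simp only: power_mult_distrib)
    also have "2 * t * (real k / (2 * exp 1 * t)) = real k / exp 1" using t by (simp add: field_simps)
    finally show ?thesis .
  qed
  also have "ennreal \<dots> \<le> ennreal (1 * (exp (- real k) * (1 / (2 * V n)) ^ nat n))"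
    using m by (intro ennreal_leI mult_right_mono power_div_fact_le) auto
  finally show ?thesis by simp
qed

lemma gap_reflect: "gap V n K L w \<Longrightarrow> gap (\<lambda>b. V (- b)) n K L w"
  unfolding gap_def by auto

text \<open>The straight walk with stays up to t/n. As rates are at least -V n and V n t is at least
  n, each stay contributes at least (1 - 1/e)/V n, which exceeds 1/(2 V n).\<close>

lemma green_window_ge:
  assumes g: "gap V n K L w" and n: "0 < n" "L < n" "0 < L" and m: "real_of_int n \<le> V n * t" and t: "0 < t"
  shows "ennreal ((1 / (2 * V n)) ^ nat n) \<le> green (rate V n) (window n L) (src n (\<lambda>_. 1)) 0 t"
proof -
  have Vn: "0 < V n" using g by (simp add: gap_def)
  let ?s = "t / real (nat n)"
  have "exp (- V n * ?s) \<le> exp (- 1)" using n m by (simp add: field_simps)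
  also have "exp (- 1 :: real) \<le> 1 / 2"
    using exp_ge_add_one_self[of 1] by (simp add: exp_minus field_simps)
  finally have "1 / 2 \<le> 1 - exp (- V n * ?s)" by simp
  then have "1 / 2 / V n \<le> (1 - exp (- V n * ?s)) / V n" using Vn by (intro divide_right_mono) auto
  then have "(1 / (2 * V n)) ^ nat n \<le> ((1 - exp (- V n * ?s)) / V n) ^ nat n"
    using Vn by (intro power_mono) (auto simp: field_simps)
  then have "ennreal ((1 / (2 * V n)) ^ nat n) \<le> ennreal (((1 - exp (- V n * ?s)) / V n) ^ nat n)"
    by (rule ennreal_leI)
  also have "\<dots> \<le> psum (rate V n) (window n L) (src n (\<lambda>_. 1)) (nat n) (n - int (nat n)) t"
  proof (rule psum_direct_ge)
    fix b assume b: "n - int (nat n) \<le> b" "b < n"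
    then show "b \<in> window n L \<and> - V n \<le> rate V n b"
      using n gapD[OF g, of b] by (auto simp: window_def rate_def)
  qed (use Vn t n in auto)
  also have "\<dots> \<le> green (rate V n) (window n L) (src n (\<lambda>_. 1)) 0 t"
    using n psum_le_green by simp
  finally show ?thesis .
qed

text \<open>\<open>passage\<close> loses two kinds of walks: those with n + 2 L jumps or more, which
  \<open>crude\<close> compares with the straight walk, and those whose loops leave
  \<open>near n K\<close>, which cost the exponential factor.\<close>

lemma walk_mass_vs_passage:
  assumes g: "gap V n K L w" and n: "0 < n" "L < n" "K \<le> L" "1 \<le> K" and w: "w \<ge> 4"
    and m: "real_of_int n \<le> V n * t" and t: "0 < t" and cr: "crude V n L t"
  shows "passage V n K L t \<le> walk_mass V n t"
    and "walk_mass V n t \<le> ennreal ((1 + 2 * exp (- real (nat n + 2 * L))) * exp (2 * (2 / w) ^ (2 * K - 1) * t)) * passage V n K L t"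
    and "0 < passage V n K L t" "passage V n K L t < \<infinity>"
proof -
  let ?G = "green (rate V n) (window n L) (src n (\<lambda>_. 1)) 0 t"
  have Vn: "0 < V n" using g by (simp add: gap_def)
  have L: "0 < L" using n by simp
  have nb: "n \<in> window n L" "near n K \<subseteq> window n L" using n by (auto simp: window_def near_def)
  have rw: "rate V n a \<le> - w" "- V n \<le> rate V n a" if "a \<in> window n L - {n}" for a
  proof -
    have "\<bar>a\<bar> < n + int L" "\<bar>a\<bar> \<noteq> n" using that n by (auto simp: window_def abs_if)
    then show "rate V n a \<le> - w" "- V n \<le> rate V n a"
      using gapD[OF g, of a] by (auto simp: rate_def)
  qed
  have "passage V n K L t \<le> ?G"
    unfolding passage_def loops_def using t nb by (intro green_first_passage_le) auto
  also have "?G \<le> walk_mass V n t"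
    unfolding walk_mass_def using t by (intro green_mono_set) auto
  finally show "passage V n K L t \<le> walk_mass V n t" .
  have pos: "0 \<le> 1 + 2 * exp (- real (nat n + 2 * L))" "0 \<le> exp (2 * (2 / w) ^ (2 * K - 1) * t)"
    by (auto intro: add_nonneg_nonneg)
  have "walk_mass V n t \<le> ennreal (1 + 2 * exp (- real (nat n + 2 * L))) * ?G"
    unfolding walk_mass_def
  proof (rule green_UNIV_le)
    show "{b. \<bar>b\<bar> + \<bar>b - n\<bar> < int (nat n + 2 * L)} \<subseteq> window n L"
      using n by (auto simp: window_def)
    fix k assume k: "nat n + 2 * L \<le> k"
    have "psum (rate V n) UNIV (src n (\<lambda>_. 1)) k 0 t \<le> ennreal (exp (- real k) * (1 / (2 * V n)) ^ nat n)"
      using k n t Vn by (intro psum_crude_le[OF cr]) auto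
    also have "\<dots> = ennreal (exp (- real k)) * ennreal ((1 / (2 * V n)) ^ nat n)"
      using Vn by (simp add: ennreal_mult)
    also have "\<dots> \<le> ennreal (exp (- real k)) * ?G"
      using n L m t by (intro mult_left_mono green_window_ge[OF g]) auto
    finally show "psum (rate V n) UNIV (src n (\<lambda>_. 1)) k 0 t \<le> ennreal (exp (- real k)) * ?G" .
  qed
  also have "\<dots> \<le> ennreal (1 + 2 * exp (- real (nat n + 2 * L))) *
       (ennreal (exp (2 * (2 / w) ^ (2 * K - 1) * t)) * passage V n K L t)"
  proof (rule mult_left_mono)
    show "?G \<le> ennreal (exp (2 * (2 / w) ^ (2 * K - 1) * t)) * passage V n K L t"
      unfolding passage_def loops_def using t nb n w rw(1)
      by (intro green_le_exp_first_passage) (auto simp: near_def rate_def)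
  qed simp
  finally show "walk_mass V n t \<le> ennreal ((1 + 2 * exp (- real (nat n + 2 * L))) * exp (2 * (2 / w) ^ (2 * K - 1) * t)) * passage V n K L t"
    by (simp only: ennreal_mult[OF pos(1) pos(2)] mult.assoc[of "ennreal x" "ennreal y" for x y])
  have lp: "loops V n K \<in> borel_measurable borel" "mono_on {0..} (loops V n K)" "loops V n K t < \<infinity>"
    using loops_props[OF g _ n(3) n(1) n(2)] w t by auto
  show "0 < passage V n K L t"
    unfolding passage_def using n rw Vn t one_le_loops by (intro green_direct_pos[where m = "V n"]) (auto simp: window_def)
  have "passage V n K L t \<le> ennreal ((2 / w) ^ nat \<bar>0 - n\<bar>) * loops V n K t"
    unfolding passage_def using lp w rw t by (intro green_src_le) auto
  also have "\<dots> < \<infinity>" using lp(3) by (simp add: ennreal_mult_less_top)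
  finally show "passage V n K L t < \<infinity>" .
qed

text \<open>The factors exp((V n - 2) t) cancel since V (-n) = V n. Both approximation errors lie in
  [0, \<open>?d\<close>], so their difference costs \<open>?d\<close> once, not twice.\<close>

lemma pam_u_log_ratio:
  assumes g: "gap V n K L w" and n: "0 < n" "L < n" "K \<le> L" "1 \<le> K" and w: "w \<ge> 4"
    and m: "real_of_int n \<le> V n * t" and t: "0 < t" and cr: "crude V n L t" "crude (\<lambda>b. V (- b)) n L t"
    and fl: "\<bar>log_passage V n K L t - log_passage (\<lambda>b. V (- b)) n K L t\<bar> \<le> e"
  shows "0 < pam_u V t n" "0 < pam_u V t (- n)"
    "\<bar>ln (pam_u V t n / pam_u V t (- n))\<bar> \<le> e + 2 * (2 / w) ^ (2 * K - 1) * t + 2 * exp (- real (nat n + 2 * L))"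
proof -
  let ?V = "\<lambda>b. V (- b)"
  let ?d = "2 * (2 / w) ^ (2 * K - 1) * t + 2 * exp (- real (nat n + 2 * L))"
  have eqn: "V (- n) = V n" using g by (simp add: gap_def)
  have main: "0 < pam_u W t n \<and> 0 \<le> ln (pam_u W t n) - ((W n - 2) * t + log_passage W n K L t)
      \<and> ln (pam_u W t n) - ((W n - 2) * t + log_passage W n K L t) \<le> ?d"
    if g: "gap W n K L w" and m: "real_of_int n \<le> W n * t" and cr: "crude W n L t" for W
  proof -
    note tp = walk_mass_vs_passage[OF g n w m t cr]
    obtain p where p: "passage W n K L t = ennreal p" "0 < p" using tp(3,4) by (cases "passage W n K L t") auto
    define c where "c = (1 + 2 * exp (- real (nat n + 2 * L))) * exp (2 * (2 / w) ^ (2 * K - 1) * t)"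
    have c0: "0 < c" unfolding c_def by (intro mult_pos_pos) (auto intro: add_pos_pos)
    have "ennreal (c * p) = ennreal c * ennreal p" using p c0 by (simp add: ennreal_mult)
    then have Tc: "walk_mass W n t \<le> ennreal (c * p)" using tp(2) unfolding p(1) c_def[symmetric] by (simp only:)
    then have "walk_mass W n t < \<infinity>" by (rule le_less_trans) simp
    then obtain T where T: "walk_mass W n t = ennreal T" "0 \<le> T" by (cases "walk_mass W n t") auto
    have pT: "p \<le> T" using tp(1) p T by simp
    have Tp: "T \<le> c * p" using Tc T p c0 by (simp add: ennreal_le_iff)
    have u: "pam_u W t n = exp ((W n - 2) * t) * T"
      using t T by (simp add: pam_u_eq_walk_mass enn2real_mult)
    have T0: "0 < T" using pT p by simp
    have lnu: "ln (pam_u W t n) = (W n - 2) * t + ln T" using T0 by (simp add: u ln_mult)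
    have lp: "log_passage W n K L t = ln p" using p by (simp add: log_passage_def)
    have "ln p \<le> ln T" using pT p by simp
    moreover have "ln T \<le> ln (c * p)" using Tp T0 by simp
    moreover have "ln (c * p) = ln c + ln p" using c0 p by (simp add: ln_mult)
    moreover have "ln c = ln (1 + 2 * exp (- real (nat n + 2 * L))) + 2 * (2 / w) ^ (2 * K - 1) * t"
    proof -
      have "0 < 1 + 2 * exp (- real (nat n + 2 * L))" by (intro add_pos_pos) auto
      then show ?thesis unfolding c_def by (simp only: ln_mult_pos[OF _ exp_gt_zero] ln_exp)
    qed
    moreover have "ln (1 + 2 * exp (- real (nat n + 2 * L))) \<le> 2 * exp (- real (nat n + 2 * L))"
      by (intro ln_add_one_self_le_self) simp
    moreover have "0 < pam_u W t n" using T0 by (simp add: u)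
    ultimately show ?thesis unfolding lnu lp by linarith
  qed
  have A: "0 < pam_u V t n \<and> 0 \<le> ln (pam_u V t n) - ((V n - 2) * t + log_passage V n K L t)
      \<and> ln (pam_u V t n) - ((V n - 2) * t + log_passage V n K L t) \<le> ?d"
    by (rule main[OF g m cr(1)])
  have B: "0 < pam_u ?V t n \<and> 0 \<le> ln (pam_u ?V t n) - ((V n - 2) * t + log_passage ?V n K L t)
      \<and> ln (pam_u ?V t n) - ((V n - 2) * t + log_passage ?V n K L t) \<le> ?d"
  proof -
    have "real_of_int n \<le> V (- n) * t" using m eqn by simp
    from main[of ?V, OF gap_reflect[OF g] this cr(2)] show ?thesis unfolding eqn .
  qed
  have r: "pam_u V t (- n) = pam_u ?V t n" using t by (simp add: pam_u_reflect)
  show "0 < pam_u V t n" "0 < pam_u V t (- n)" using A B r by auto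
  have "ln (pam_u V t n / pam_u V t (- n)) = ln (pam_u V t n) - ln (pam_u ?V t n)"
    unfolding r using A B by (simp add: ln_div)
  then show "\<bar>ln (pam_u V t n / pam_u V t (- n))\<bar> \<le> e + 2 * (2 / w) ^ (2 * K - 1) * t + 2 * exp (- real (nat n + 2 * L))"
    using A B fl by linarith
qed

subsection \<open>The neighbourhood of the maximiser\<close>

text \<open>Two regimes. If m is at most n/t, then ln m >= 1 - 1/m gives a distance cost of at least
  m - 1. Otherwise m exceeds a/\<Lambda>, so ln m is at least c \<Lambda> and the cost is at least
  m. This confines the maximiser to distance C r.\<close>

lemma far_value_le_one:
  assumes pos: "0 < t" "0 < \<Lambda>" "0 < (a::real)" and n: "a * t / \<Lambda> \<le> n" and m: "1 \<le> m" "m \<le> c * n * \<Lambda> / t"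
    and c: "c * \<Lambda> \<le> ln (a / \<Lambda>)"
  shows "m - n / t * ln m \<le> 1"
proof (cases "m \<le> n / t")
  case True
  have "1 - 1 / m \<le> ln m" using ln_le_minus_one[of "1 / m"] m(1) by (simp add: ln_div)
  then have "m * (1 - 1 / m) \<le> n / t * ln m" using True m(1) by (intro mult_mono) auto
  moreover have "m * (1 - 1 / m) = m - 1" using m(1) by (simp add: right_diff_distrib)
  ultimately show ?thesis by linarith
next
  case False
  have "a / \<Lambda> = (a * t / \<Lambda>) / t" using pos by simp
  also have "\<dots> \<le> n / t" using n pos by (intro divide_right_mono) auto
  finally have ge: "a / \<Lambda> \<le> n / t" .
  then have nt: "0 < n / t" using pos by (meson divide_pos_pos less_le_trans)
  have "c * \<Lambda> \<le> ln (a / \<Lambda>)" by (rule c)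
  also have "\<dots> \<le> ln m" using ge False pos by (intro ln_mono) auto
  finally have "n / t * (c * \<Lambda>) \<le> n / t * ln m" using nt by (intro mult_left_mono) auto
  then show ?thesis using m(2) by (simp add: mult.commute mult.left_commute)
qed

text \<open>\<open>a\<close> and \<open>r\<close> are the orders of height and distance,
  \<open>\<Lambda>\<close> stands for ln t, and H0 to H6 hold for a typical field. A site higher
  than c0 a / 2 is duplicated (H6 with itself) and hence competes in the maximisation. If it lies in
  the range of \<open>gap\<close>, H5 forces it well inside, and its smaller distance cost then
  forces its height below that of the maximiser by order \<open>a\<close>.\<close>

lemma max_point_props:
  fixes V :: "int \<Rightarrow> real" and n :: nat
  assumes pos: "0 < t" "0 < \<Lambda>" "0 < a" and r: "r = a * t / \<Lambda>"
    and C: "1 \<le> C" "0 < c0" "0 < d1" "0 < d" "d < d1" "0 < \<beta>"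
    and T: "c * \<Lambda> \<le> ln (a / \<Lambda>)" "1 < c0 * a" "\<beta> / 2 * \<Lambda> \<le> ln (c0 * a)" "C / c0 < \<Lambda>"
      "1 \<le> K" "K \<le> L" "real L \<le> d * r" "d * r \<le> 2 * real L" "real L \<le> C * r"
      "w \<le> c0 * a / 2" "w \<le> d * \<beta> / 2 * a"
    and H0: "\<And>z. 1 \<le> V z"
    and H1: "\<exists>y\<in>Dset V. c0 * a \<le> Psi V t (int y)"
    and H2: "\<And>z. real_of_int \<bar>z\<bar> \<le> d1 * r \<Longrightarrow> V z < c0 * a"
    and H3: "\<And>z. C * r < real_of_int \<bar>z\<bar> \<Longrightarrow> V z \<le> c * real_of_int \<bar>z\<bar> * \<Lambda> / t"
    and H5: "\<And>y z. real_of_int \<bar>y\<bar> \<le> 2 * C * r \<Longrightarrow> real_of_int \<bar>z\<bar> \<le> 2 * C * r \<Longrightarrow> \<bar>y\<bar> \<noteq> \<bar>z\<bar> \<Longrightarrow>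
        \<bar>\<bar>y\<bar> - \<bar>z\<bar>\<bar> \<le> 2 * int L \<Longrightarrow> c0 / 2 * a < V y \<Longrightarrow> V z \<le> c0 / 2 * a"
    and H6: "\<And>y z. real_of_int \<bar>y\<bar> \<le> 2 * C * r \<Longrightarrow> real_of_int \<bar>z\<bar> \<le> 2 * C * r \<Longrightarrow>
        \<bar>\<bar>y\<bar> - \<bar>z\<bar>\<bar> < int K \<Longrightarrow> c0 / 2 * a < V y \<Longrightarrow> V (- z) = V z"
    and n: "n \<in> Dset V" "\<And>y. y \<in> Dset V \<Longrightarrow> Psi V t (int y) \<le> Psi V t (int n)"
  shows "c0 * a \<le> V (int n)" "d1 * r < real n" "real n \<le> C * r" "gap V (int n) K L w" "real n \<le> V (int n) * t"
    and "\<And>b. real_of_int \<bar>b\<bar> \<le> 2 * C * r \<Longrightarrow> c0 / 2 * a < V b \<Longrightarrow>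
      V b - real_of_int \<bar>b\<bar> / t * ln (V b) \<le> V (int n) - real n / t * ln (V (int n))"
proof -
  define m where "m = V (int n)"
  have r0: "0 < r" using pos r by simp
  have rt: "r / t = a / \<Lambda>" using pos r by simp
  have Psi_n: "Psi V t (int n) = m - real n / t * ln m" by (simp add: Psi_def m_def)
  have m1: "1 \<le> m" using H0 by (simp add: m_def)
  have nonneg: "0 \<le> real n / t * ln m" using m1 pos by (intro mult_nonneg_nonneg) auto
  have Pn: "c0 * a \<le> m - real n / t * ln m" using H1 n(2) unfolding Psi_n by (meson order_trans)
  then have m: "c0 * a \<le> m" using nonneg by linarith
  then show "c0 * a \<le> V (int n)" by (simp add: m_def)
  show nd1: "d1 * r < real n" using H2[of "int n"] m unfolding m_def by force
  show nC: "real n \<le> C * r"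
  proof (rule ccontr)
    assume "\<not> real n \<le> C * r"
    then have far: "C * r < real n" by simp
    have mle: "m \<le> c * real n * \<Lambda> / t" using H3[of "int n"] far by (simp add: m_def)
    have "1 * r \<le> C * r" using C r0 by (intro mult_right_mono) auto
    then have "a * t / \<Lambda> \<le> real n" using far r by linarith
    from far_value_le_one[OF pos this m1 mle T(1)] have "m - real n / t * ln m \<le> 1" .
    then show False using Pn T(2) by linarith
  qed
  have c0a: "c0 / 2 * a < m" using m pos C by (smt (verit) mult_pos_pos field_sum_of_halves times_divide_eq_left)
  have nbig: "c0 / 2 * a < V (int n)" using c0a by (simp add: m_def)
  have LC: "\<And>b. \<bar>b\<bar> < int n + int L \<Longrightarrow> real_of_int \<bar>b\<bar> \<le> 2 * C * r"
  proof -
    fix b :: int assume "\<bar>b\<bar> < int n + int L"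
    then have "real_of_int \<bar>b\<bar> \<le> real n + real L" by linarith
    then show "real_of_int \<bar>b\<bar> \<le> 2 * C * r" using nC T(9) by linarith
  qed
  have n2: "real_of_int \<bar>int n\<bar> \<le> 2 * C * r" using LC[of "int n"] T(5,6) by simp
  show Psi_big: "V b - real_of_int \<bar>b\<bar> / t * ln (V b) \<le> V (int n) - real n / t * ln (V (int n))"
    if b: "real_of_int \<bar>b\<bar> \<le> 2 * C * r" "c0 / 2 * a < V b" for b
  proof -
    have eq: "V (- b) = V b" using H6[of b b] b T(5) by simp
    have "nat \<bar>b\<bar> \<in> Dset V" using eq by (auto simp: Dset_def abs_if)
    moreover have "V (int (nat \<bar>b\<bar>)) = V b" using eq by (auto simp: abs_if)
    ultimately show ?thesis using n(2)[of "nat \<bar>b\<bar>"] unfolding Psi_n by (simp add: Psi_def m_def)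
  qed
  have m_gap: "V b \<le> m - w" if b: "\<bar>b\<bar> < int n + int L" "\<bar>b\<bar> \<noteq> int n" for b
  proof (cases "c0 / 2 * a < V b")
    case False
    then show ?thesis using m T(10) by simp
  next
    case True
    define x where "x = V b"
    have bC: "real_of_int \<bar>b\<bar> \<le> 2 * C * r" using LC b by simp
    have "\<not> \<bar>\<bar>b\<bar> - \<bar>int n\<bar>\<bar> \<le> 2 * int L" using H5[OF bC n2] b True nbig by force
    \<comment> \<open>Below n + L, a modulus more than 2 L away from \<open>n\<close> can only be
      smaller.\<close>
    then have bn: "\<bar>b\<bar> < int n - 2 * int L" using b by linarith
    then have bn': "real_of_int \<bar>b\<bar> + 2 * real L \<le> real n" by linarith
    have P: "x - real_of_int \<bar>b\<bar> / t * ln x \<le> m - real n / t * ln m"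
      using Psi_big[OF bC True] by (simp add: x_def m_def)
    have lnm: "\<beta> / 2 * \<Lambda> \<le> ln m" using T(2,3) m by (smt (verit) ln_mono)
    show ?thesis
    proof (cases "x \<le> m")
      case True
      have x1: "1 \<le> x" using H0 by (simp add: x_def)
      have "real_of_int \<bar>b\<bar> / t * ln x \<le> real_of_int \<bar>b\<bar> / t * ln m"
        using True x1 pos by (intro mult_left_mono ln_mono) auto
      then have "real n / t * ln m - real_of_int \<bar>b\<bar> / t * ln m \<le> m - x" using P by linarith
      then have 1: "(real n - real_of_int \<bar>b\<bar>) / t * ln m \<le> m - x" by (simp add: diff_divide_distrib left_diff_distrib)
      have "w \<le> d * \<beta> / 2 * a" by (rule T(11))
      also have "\<dots> = (d * r) / t * (\<beta> / 2 * \<Lambda>)" using rt pos by (simp add: r)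
      also have "\<dots> \<le> (real n - real_of_int \<bar>b\<bar>) / t * ln m"
        using bn' T(8) lnm pos C r0 by (intro mult_mono divide_right_mono) auto
      finally show ?thesis using 1 by (simp add: x_def)
    next
      case False
      \<comment> \<open>A closer and higher site would beat the maximiser: its extra cost is at most
        C / (c0 \<Lambda>) < 1 times its extra height.\<close>
      then have xm: "0 < x - m" by simp
      have m0: "0 < m" using m1 by simp
      have "ln x - ln m = ln (x / m)" using xm m0 by (simp add: ln_div)
      also have "\<dots> \<le> x / m - 1" using xm m0 by (intro ln_le_minus_one) auto
      also have "\<dots> = (x - m) / m" using m0 by (simp add: diff_divide_distrib)
      also have "\<dots> \<le> (x - m) / (c0 * a)" using m xm T(2) pos C by (intro divide_left_mono mult_pos_pos) auto
      finally have ln1: "ln x - ln m \<le> (x - m) / (c0 * a)" .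
      have "x - m \<le> real_of_int \<bar>b\<bar> / t * ln x - real n / t * ln m" using P by linarith
      also have "\<dots> \<le> real n / t * ln x - real n / t * ln m"
        using bn' pos xm m1 by (intro diff_right_mono mult_right_mono divide_right_mono) auto
      also have "\<dots> = real n / t * (ln x - ln m)" by (simp add: right_diff_distrib)
      also have "\<dots> \<le> (C * r / t) * ((x - m) / (c0 * a))"
        using nC ln1 pos xm m1 by (intro mult_mono divide_right_mono) auto
      also have "\<dots> = (C / c0 / \<Lambda>) * (x - m)" using pos C by (simp add: r field_simps)
      also have "\<dots> < 1 * (x - m)"
      proof (rule mult_strict_right_mono)
        show "C / c0 / \<Lambda> < 1" using T(4) pos by (simp only: divide_less_eq_1_pos)
      qed (rule xm)
      finally show ?thesis by simp
    qed
  qed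
  show "gap V (int n) K L w"
    unfolding gap_def
  proof (intro conjI allI impI ballI)
    show "V (- int n) = V (int n)" using n(1) by (simp add: Dset_def)
    show "0 < V (int n)" using m1 by (simp add: m_def)
    fix b assume "\<bar>b\<bar> < int n + int L" "\<bar>b\<bar> \<noteq> int n"
    then show "V b \<le> V (int n) - w" "0 \<le> V b" using m_gap[of b] H0[of b] by (auto simp: m_def)
  next
    fix b assume b: "b \<in> near (int n) K"
    then have "\<bar>b\<bar> < int n + int L" using T(6) by (auto simp: near_def)
    then show "V (- b) = V b" using b nbig n2 LC[of b] by (intro H6[of "int n" b]) (auto simp: near_def)
  qed
  have "real n \<le> C * r" by (rule nC)
  also have "\<dots> = (C / \<Lambda>) * (a * t)" by (simp add: r)
  also have "\<dots> \<le> c0 * (a * t)" using T(4) pos C by (intro mult_right_mono) (auto simp: field_simps)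
  also have "\<dots> \<le> m * t" using mult_right_mono[OF m, of t] pos by simp
  finally show "real n \<le> V (int n) * t" by (simp add: m_def)
qed

text \<open>\<open>l\<close> bounds ln(k / (2 e t)) from below and \<open>l'\<close> bounds the
  logarithm of twice the heights within 2 C r from above. Both will be \<beta> ln t to leading
  order, so k l wins only because jumps are wasted: k >= n + d r and n <= C r give n <= (1 -
  \<theta>) k and |b| <= (1 - \<theta>/2) k. The three inequalities between \<open>l\<close> and
  \<open>l'\<close> belong to sites no higher than \<open>n\<close>, higher ones within 2 C r, and
  those beyond.\<close>

lemma crudeI:
  fixes V :: "int \<Rightarrow> real" and n :: nat
  assumes pos: "0 < t" "0 < \<Lambda>" "0 < a" and r: "r = a * t / \<Lambda>"
    and C: "1 \<le> C" "0 < c0" "0 < d1" "0 < d" "1 \<le> C'" "0 \<le> c"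
    and T: "d * r \<le> 2 * real L" "0 < L" "0 \<le> w"
    and \<theta>: "\<theta> = d / (C + d)" "l' = ln (2 * C' * a)" "l = ln (d1 * a / (2 * exp 1 * \<Lambda>))"
      "0 \<le> l'" "(1 - \<theta>) * l' + 1 \<le> l" "(1 - \<theta> / 2) * l' + 2 \<le> l" "c * \<Lambda> + l' / 3 + 1 \<le> l"
    and H0: "\<And>z. 1 \<le> V z"
    and H3: "\<And>z. C * r < real_of_int \<bar>z\<bar> \<Longrightarrow> V z \<le> c * real_of_int \<bar>z\<bar> * \<Lambda> / t"
    and H4: "\<And>z. real_of_int \<bar>z\<bar> \<le> 2 * C * r \<Longrightarrow> V z \<le> C' * a"
    and n: "c0 * a \<le> V (int n)" "d1 * r < real n" "real n \<le> C * r" "gap V (int n) K L w"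
    and P: "\<And>b. real_of_int \<bar>b\<bar> \<le> 2 * C * r \<Longrightarrow> c0 / 2 * a < V b \<Longrightarrow>
      V b - real_of_int \<bar>b\<bar> / t * ln (V b) \<le> V (int n) - real n / t * ln (V (int n))"
  shows "crude V (int n) L t"
  unfolding crude_def
proof (intro allI impI)
  fix k :: nat and b :: int
  assume k: "nat (int n) + 2 * L \<le> k" and b: "\<bar>b\<bar> + \<bar>b - int n\<bar> \<le> int k"
  define m where "m = V (int n)"
  have r0: "0 < r" using pos r by simp
  have rt: "r / t = a / \<Lambda>" using pos r by simp
  have m1: "1 \<le> m" using H0 by (simp add: m_def)
  have kn: "real n + 2 * real L \<le> real k" using k by simp
  have k0: "0 < real k" using kn T(2) by simp
  have mC: "m \<le> C' * a" using H4[of "int n"] n(3) C r0 unfolding m_def by simp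
  have l'm: "ln (2 * m) \<le> l'" unfolding \<theta>(2) using mC m1 by (intro ln_mono) auto
  have lk: "l \<le> ln (real k / (2 * exp 1 * t))"
  proof -
    have "d1 * a / (2 * exp 1 * \<Lambda>) = d1 * r / (2 * exp 1 * t)" using pos by (simp add: r)
    also have "\<dots> \<le> real k / (2 * exp 1 * t)" using n(2) kn pos by (intro divide_right_mono) auto
    finally show ?thesis unfolding \<theta>(3) using pos C by (intro ln_mono) auto
  qed
  have Cd: "0 < C + d" using C by simp
  have \<theta>01: "0 < \<theta>" "\<theta> < 1" using C Cd unfolding \<theta>(1) by auto
  have n\<theta>: "real n \<le> (1 - \<theta>) * real k"
  proof -
    have "1 - \<theta> = C / (C + d)" using Cd unfolding \<theta>(1) by (simp add: field_simps)
    moreover have "real n * (C + d) \<le> C * (real n + d * r)"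
      using mult_left_mono[OF n(3), of d] C by (simp add: algebra_simps)
    moreover have "C * (real n + d * r) \<le> C * real k" using kn T(1) C by (intro mult_left_mono) auto
    ultimately have "real n * (C + d) \<le> C * real k" by linarith
    then have "real n \<le> C * real k / (C + d)" by (simp only: pos_le_divide_eq[OF Cd])
    then show ?thesis using \<open>1 - \<theta> = C / (C + d)\<close> by simp
  qed
  have b2: "2 * real_of_int \<bar>b\<bar> \<le> real k + real n" using b by linarith
  have bk: "real_of_int \<bar>b\<bar> \<le> (1 - \<theta> / 2) * real k" using b2 n\<theta> by (simp add: algebra_simps)
  have nl: "real n * ln (2 * m) \<le> real n * l'" using l'm by (intro mult_left_mono) auto
  have kl: "real k * l \<le> real k * ln (real k / (2 * exp 1 * t))" using lk by (intro mult_left_mono) auto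
  have "t * max 0 (V b - m) + real n * ln (2 * m) + real k \<le> real k * l"
  proof (cases "V b \<le> m")
    case True
    have "real n * l' + real k \<le> (1 - \<theta>) * real k * l' + real k"
      using n\<theta> \<theta>(4) by (intro add_right_mono mult_right_mono) auto
    also have "\<dots> = real k * ((1 - \<theta>) * l' + 1)" by (simp add: algebra_simps)
    also have "\<dots> \<le> real k * l" using \<theta>(5) by (intro mult_left_mono) auto
    finally show ?thesis using True nl by simp
  next
    case False
    have mx: "max 0 (V b - m) = V b - m" using False by simp
    show ?thesis
    proof (cases "real_of_int \<bar>b\<bar> \<le> 2 * C * r")
      case True
      have big: "c0 / 2 * a < V b" using False n(1) pos C unfolding m_def
        by (smt (verit) mult_pos_pos field_sum_of_halves times_divide_eq_left)
      \<comment> \<open>Maximality bounds the excess height by a difference of distance costs, whose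
        term n ln m cancels against the price of the straight walk up to n ln 2.\<close>
      have "V b - real_of_int \<bar>b\<bar> / t * ln (V b) \<le> m - real n / t * ln m"
        using P[OF True big] by (simp add: m_def)
      then have "V b - m \<le> (real_of_int \<bar>b\<bar> * ln (V b) - real n * ln m) / t"
        by (simp add: diff_divide_distrib)
      then have "t * (V b - m) \<le> real_of_int \<bar>b\<bar> * ln (V b) - real n * ln m"
        using pos by (simp add: pos_le_divide_eq mult.commute)
      moreover have "real_of_int \<bar>b\<bar> * ln (V b) \<le> real_of_int \<bar>b\<bar> * l'"
      proof (rule mult_left_mono)
        have "V b \<le> 2 * C' * a" using H4[OF True] H0[of b] by simp
        then show "ln (V b) \<le> l'" unfolding \<theta>(2) using H0[of b] by (intro ln_mono) auto
      qed simp
      moreover have "real n * ln (2 * m) = real n * ln 2 + real n * ln m"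
        using m1 by (simp add: ln_mult distrib_left)
      moreover have "real n * ln 2 \<le> real k * 1"
        using kn ln_2_less_1 by (intro mult_mono) auto
      moreover have "real_of_int \<bar>b\<bar> * l' \<le> (1 - \<theta> / 2) * real k * l'"
        using bk \<theta>(4) by (intro mult_right_mono) auto
      moreover have "real k * ((1 - \<theta> / 2) * l' + 2) \<le> real k * l" using \<theta>(6) by (intro mult_left_mono) auto
      ultimately show ?thesis unfolding mx by (simp add: algebra_simps)
    next
      case far: False
      \<comment> \<open>From |b| > 2 C r >= 2 n and 2 |b| <= k + n.\<close>
      have n3: "real n \<le> real k / 3" using b2 far n(3) by linarith
      have "C * r < real_of_int \<bar>b\<bar>" using far C r0 mult_pos_pos[of C r] by linarith
      then have "V b \<le> c * real_of_int \<bar>b\<bar> * \<Lambda> / t" by (rule H3)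
      then have "t * V b \<le> c * real_of_int \<bar>b\<bar> * \<Lambda>" using pos by (simp add: pos_le_divide_eq mult.commute)
      also have "\<dots> \<le> c * real k * \<Lambda>"
        using b2 kn C pos by (intro mult_right_mono mult_left_mono) auto
      finally have 1: "t * V b \<le> real k * (c * \<Lambda>)" by (simp add: mult_ac)
      have 2: "real n * l' \<le> real k / 3 * l'" using n3 \<theta>(4) by (intro mult_right_mono)
      have 3: "0 \<le> t * m" using pos m1 by simp
      have "real k * (c * \<Lambda> + l' / 3 + 1) \<le> real k * l" using \<theta>(7) by (intro mult_left_mono) auto
      then show ?thesis unfolding mx using 1 2 3 nl by (simp add: algebra_simps)
    qed
  qed
  then show "t * max 0 (V b - V (int n)) + real_of_int (int n) * ln (2 * V (int n)) + real k \<le> real k * ln (real k / (2 * exp 1 * t))"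
    using kl by (simp add: m_def)
qed

subsection \<open>Probability estimates for the random field\<close>

locale dup_field = prob_space M for M :: "'a measure" +
  fixes \<alpha> :: real and p :: "nat \<Rightarrow> real"
    and xi0 :: "int \<Rightarrow> 'a \<Rightarrow> real" and coin :: "nat \<Rightarrow> 'a \<Rightarrow> bool"
  assumes alpha: "\<alpha> \<ge> 2"
    and p01: "0 \<le> p n" "p n \<le> 1"
    and indep: "indep_vars (\<lambda>_. borel)
           (\<lambda>i w. case i of Inl z \<Rightarrow> xi0 z w | Inr n \<Rightarrow> of_bool (coin n w)) UNIV"
    and tail: "x \<ge> 1 \<Longrightarrow> prob {w \<in> space M. xi0 z w > x} = x powr (- \<alpha>)"
    and coin_prob: "n \<ge> 1 \<Longrightarrow> prob {w \<in> space M. coin n w} = p n"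
begin

text \<open>Coins become numbers 0 and 1, so that field and coins form one real-valued family whose
  law is a product measure.\<close>

definition cfg :: "'a \<Rightarrow> int + nat \<Rightarrow> real" where
  "cfg w i = (case i of Inl z \<Rightarrow> xi0 z w | Inr n \<Rightarrow> of_bool (coin n w))"

definition pot :: "'a \<Rightarrow> int \<Rightarrow> real" where
  "pot w = potential (\<lambda>z. xi0 z w) (\<lambda>n. coin n w)"

lemma cfg_pot_cfg: "cfg_pot (cfg w) = pot w"
  by (simp add: cfg_pot_def pot_def cfg_def)

lemma cfg_indep: "indep_vars (\<lambda>_. borel) (\<lambda>i w. cfg w i) UNIV"
  using indep by (simp add: cfg_def)

lemma cfg_measurable [measurable]: "(\<lambda>w. cfg w i) \<in> borel_measurable M"
  using cfg_indep unfolding indep_vars_def by auto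

lemma xi0_measurable [measurable]: "xi0 z \<in> borel_measurable M"
  using cfg_measurable[of "Inl z"] by (simp add: cfg_def)

lemma coin_measurable [measurable]: "Measurable.pred M (coin n)"
proof -
  have "{w \<in> space M. coin n w} = {w \<in> space M. cfg w (Inr n) = 1}" by (auto simp: cfg_def)
  moreover have "\<dots> \<in> sets M" by measurable
  ultimately show ?thesis by (simp add: pred_def)
qed

lemma tail_coin: "n \<ge> 1 \<Longrightarrow> prob {w \<in> space M. \<not> coin n w} = 1 - p n"
  using prob_neg[of "coin n"] coin_prob[of n] by simp

lemma prob_Int_cfg:
  assumes "finite J" "J \<noteq> {}" "\<And>i. i \<in> J \<Longrightarrow> A i \<in> sets borel"
  shows "prob {w \<in> space M. \<forall>i\<in>J. cfg w i \<in> A i} = (\<Prod>i\<in>J. prob {w \<in> space M. cfg w i \<in> A i})"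
proof -
  have "prob (\<Inter>i\<in>J. (\<lambda>w. cfg w i) -` A i \<inter> space M) = (\<Prod>i\<in>J. prob ((\<lambda>w. cfg w i) -` A i \<inter> space M))"
    using assms by (intro indep_varsD[OF cfg_indep]) auto
  moreover have "(\<Inter>i\<in>J. (\<lambda>w. cfg w i) -` A i \<inter> space M) = {w \<in> space M. \<forall>i\<in>J. cfg w i \<in> A i}"
    using assms(2) by auto
  moreover have "(\<lambda>w. cfg w i) -` A i \<inter> space M = {w \<in> space M. cfg w i \<in> A i}" for i by auto
  ultimately show ?thesis by simp
qed

lemma prob_two_big:
  assumes "y \<noteq> z" "1 \<le> x"
  shows "prob {w \<in> space M. x < xi0 y w \<and> x < xi0 z w} = x powr (- \<alpha>) * x powr (- \<alpha>)"
  using prob_Int_cfg[of "{Inl y, Inl z}" "\<lambda>_. {x<..}"] assms by (simp add: cfg_def tail)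

lemma prob_big_coin:
  assumes "1 \<le> x" "1 \<le> n"
  shows "prob {w \<in> space M. x < xi0 y w \<and> \<not> coin n w} = x powr (- \<alpha>) * (1 - p n)"
  using prob_Int_cfg[of "{Inl y, Inr n}" "\<lambda>i. if i = Inl y then {x<..} else {0}"] assms
  by (simp add: cfg_def tail tail_coin)

lemma prob_two_big_coin:
  assumes "1 \<le> x" "1 \<le> x'" "1 \<le> n" "y \<noteq> z"
  shows "prob {w \<in> space M. x < xi0 y w \<and> \<not> coin n w \<and> x' < xi0 z w} = x powr (- \<alpha>) * (1 - p n) * x' powr (- \<alpha>)"
  using prob_Int_cfg[of "{Inl y, Inr n, Inl z}" "\<lambda>i. if i = Inl y then {x<..} else if i = Inl z then {x'<..} else {0}"] assms
  by (simp add: cfg_def tail tail_coin)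

lemma prob_all_small:
  assumes "1 \<le> x"
  shows "prob {w \<in> space M. \<forall>y\<in>{1..N}. xi0 (int y) w \<le> x} \<le> exp (- (real N * x powr (- \<alpha>)))"
proof (cases "N = 0")
  case True then show ?thesis by simp
next
  case False
  let ?J = "(\<lambda>y. Inl (int y)) ` {1..N} :: (int + nat) set"
  have inj: "inj_on (\<lambda>y. Inl (int y) :: int + nat) {1..N}" by (auto simp: inj_on_def)
  have one: "prob {w \<in> space M. xi0 z w \<le> x} = 1 - x powr (- \<alpha>)" for z
    using prob_neg[of "\<lambda>w. xi0 z w > x"] tail[OF assms, of z] by (simp add: not_less)
  have "prob {w \<in> space M. \<forall>i\<in>?J. cfg w i \<in> {..x}} = (\<Prod>i\<in>?J. prob {w \<in> space M. cfg w i \<in> {..x}})"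
    using False by (intro prob_Int_cfg) auto
  also have "\<dots> = (1 - x powr (- \<alpha>)) ^ N"
    by (subst prod.reindex[OF inj]) (simp add: cfg_def one)
  also have "\<dots> \<le> exp (- (x powr (- \<alpha>))) ^ N"
  proof (rule power_mono)
    show "0 \<le> 1 - x powr (- \<alpha>)" using one[of 0] by (metis measure_nonneg)
    show "1 - x powr (- \<alpha>) \<le> exp (- (x powr (- \<alpha>)))" using exp_ge_add_one_self[of "- (x powr (- \<alpha>))"] by simp
  qed
  also have "\<dots> = exp (- (real N * x powr (- \<alpha>)))" by (simp only: exp_of_nat_mult[symmetric] mult_minus_right)
  finally show ?thesis by (simp add: cfg_def)
qed

lemma prob_union_le:
  assumes "finite F" "\<And>i. i \<in> F \<Longrightarrow> {w \<in> space M. P i w} \<in> events" "\<And>i. i \<in> F \<Longrightarrow> prob {w \<in> space M. P i w} \<le> c i"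
  shows "prob {w \<in> space M. \<exists>i\<in>F. P i w} \<le> (\<Sum>i\<in>F. c i)"
proof -
  have "{w \<in> space M. \<exists>i\<in>F. P i w} = (\<Union>i\<in>F. {w \<in> space M. P i w})" by auto
  then have "prob {w \<in> space M. \<exists>i\<in>F. P i w} \<le> (\<Sum>i\<in>F. prob {w \<in> space M. P i w})"
    using assms by (auto intro: finite_measure_subadditive_finite)
  also have "\<dots> \<le> (\<Sum>i\<in>F. c i)" using assms by (intro sum_mono)
  finally show ?thesis .
qed

lemma prob_some_big:
  assumes "1 \<le> x" "finite F"
  shows "prob {w \<in> space M. \<exists>z\<in>F. x < xi0 z w} \<le> real (card F) * x powr (- \<alpha>)"
  using prob_union_le[of F "\<lambda>z w. x < xi0 z w" "\<lambda>_. x powr (- \<alpha>)"] assms by (simp add: tail)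

lemma prob_some_pair_big:
  assumes "1 \<le> x" "finite F" "\<And>y z. (y, z) \<in> F \<Longrightarrow> y \<noteq> z"
  shows "prob {w \<in> space M. \<exists>(y, z)\<in>F. x < xi0 y w \<and> x < xi0 z w} \<le> real (card F) * (x powr (- \<alpha>) * x powr (- \<alpha>))"
proof -
  have "prob {w \<in> space M. \<exists>q\<in>F. x < xi0 (fst q) w \<and> x < xi0 (snd q) w} \<le> (\<Sum>q\<in>F. x powr (- \<alpha>) * x powr (- \<alpha>))"
  proof (rule prob_union_le[OF assms(2)])
    fix q assume q: "q \<in> F"
    show "{w \<in> space M. x < xi0 (fst q) w \<and> x < xi0 (snd q) w} \<in> events" by measurable
    have "fst q \<noteq> snd q" using q assms(3)[of "fst q" "snd q"] by simp
    then show "prob {w \<in> space M. x < xi0 (fst q) w \<and> x < xi0 (snd q) w} \<le> x powr (- \<alpha>) * x powr (- \<alpha>)"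
      using assms(1) by (simp add: prob_two_big)
  qed
  then show ?thesis by (simp add: case_prod_unfold)
qed

text \<open>As \<alpha> >= 2, a factor R^(2 - \<alpha>) can be taken out; the remaining 1/k^2 is at
  most 1/(k - 1) - 1/k, which telescopes.\<close>

lemma powr_neg_sum_le:
  assumes R: "1 \<le> R"
  shows "summable (\<lambda>i. (real (R + 1 + i)) powr (- \<alpha>))" "(\<Sum>i. (real (R + 1 + i)) powr (- \<alpha>)) \<le> real R powr (1 - \<alpha>)"
proof -
  define f where "f i = real R powr (2 - \<alpha>) * (1 / real (R + i) - 1 / real (R + Suc i))" for i
  have le: "(real (R + 1 + i)) powr (- \<alpha>) \<le> f i" for i
  proof -
    have "(real (R + 1 + i)) powr (- \<alpha>) = (real (R + 1 + i)) powr (2 - \<alpha>) * (real (R + 1 + i)) powr (- 2)"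
      by (simp add: powr_add[symmetric])
    also have "\<dots> \<le> real R powr (2 - \<alpha>) * (1 / real (R + i) - 1 / real (R + Suc i))"
    proof (rule mult_mono)
      show "real (R + 1 + i) powr (2 - \<alpha>) \<le> real R powr (2 - \<alpha>)"
        using alpha R by (intro powr_mono2') auto
      have "real (R + 1 + i) powr (- 2) = 1 / (real (R + 1 + i))\<^sup>2"
        by (simp add: powr_minus powr_numeral inverse_eq_divide)
      also have "\<dots> \<le> 1 / (real (R + i) * real (R + Suc i))"
        using R by (intro divide_left_mono) (auto simp: power2_eq_square intro!: mult_mono)
      also have "\<dots> = 1 / real (R + i) - 1 / real (R + Suc i)" using R by (simp add: field_simps)
      finally show "real (R + 1 + i) powr (- 2) \<le> 1 / real (R + i) - 1 / real (R + Suc i)" .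
    qed auto
    finally show ?thesis by (simp add: f_def)
  qed
  have "(\<lambda>i. 1 / real (R + i)) \<longlonglongrightarrow> 0" by real_asymp
  then have "(\<lambda>i. 1 / real (R + i) - 1 / real (R + Suc i)) sums (1 / real (R + 0) - 0)"
    by (rule telescope_sums')
  then have s: "f sums (real R powr (2 - \<alpha>) * (1 / real R))"
    unfolding f_def by (intro sums_mult) simp
  have e: "real R powr (2 - \<alpha>) * (1 / real R) = real R powr (1 - \<alpha>)"
    using R powr_add[of "real R" "2 - \<alpha>" "- 1"] by (simp add: powr_minus inverse_eq_divide)
  have sf: "summable f" by (rule sums_summable[OF s])
  show sm: "summable (\<lambda>i. (real (R + 1 + i)) powr (- \<alpha>))"
  proof (rule summable_comparison_test'[OF sf])
    fix i show "norm ((real (R + 1 + i)) powr (- \<alpha>)) \<le> f i" using le[of i] by (simp only: real_norm_def abs_of_nonneg[OF powr_ge_zero])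
  qed
  have "(\<Sum>i. (real (R + 1 + i)) powr (- \<alpha>)) \<le> suminf f" by (rule suminf_le[OF le sm sf])
  also have "suminf f = real R powr (1 - \<alpha>)" using sums_unique[OF s] e by simp
  finally show "(\<Sum>i. (real (R + 1 + i)) powr (- \<alpha>)) \<le> real R powr (1 - \<alpha>)" .
qed

text \<open>Union bound over the two sites of each shell |z| = R + 1 + i.\<close>

lemma prob_far_big:
  assumes R: "1 \<le> R" and k: "0 < k" "1 \<le> k * real R"
  shows "{w \<in> space M. \<exists>z. real R < real_of_int \<bar>z\<bar> \<and> k * real_of_int \<bar>z\<bar> < xi0 z w} \<in> events"
    "prob {w \<in> space M. \<exists>z. real R < real_of_int \<bar>z\<bar> \<and> k * real_of_int \<bar>z\<bar> < xi0 z w} \<le> 2 * k powr (- \<alpha>) * real R powr (1 - \<alpha>)"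
proof -
  show "{w \<in> space M. \<exists>z. real R < real_of_int \<bar>z\<bar> \<and> k * real_of_int \<bar>z\<bar> < xi0 z w} \<in> events"
    by measurable
  define A where "A i = {w \<in> space M. \<exists>z\<in>{int (R + 1 + i), - int (R + 1 + i)}. k * real (R + 1 + i) < xi0 z w}" for i
  have Am: "A i \<in> events" for i unfolding A_def by measurable
  define g where "g i = 2 * k powr (- \<alpha>) * (real (R + 1 + i)) powr (- \<alpha>)" for i
  have PA: "prob (A i) \<le> g i" for i
  proof -
    have "k * real R \<le> k * real (R + 1 + i)" using k by (intro mult_left_mono) auto
    then have x: "1 \<le> k * real (R + 1 + i)" using k(2) by linarith
    have "prob (A i) \<le> real (card {int (R + 1 + i), - int (R + 1 + i)}) * (k * real (R + 1 + i)) powr (- \<alpha>)"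
      unfolding A_def using x by (intro prob_some_big) auto
    also have "\<dots> \<le> 2 * (k * real (R + 1 + i)) powr (- \<alpha>)"
      by (intro mult_right_mono) (auto simp: card_insert_if)
    also have "\<dots> = g i" unfolding g_def using k by (simp add: powr_mult)
    finally show ?thesis .
  qed
  have gs: "summable g" unfolding g_def by (intro summable_mult powr_neg_sum_le R)
  have sP: "summable (\<lambda>i. prob (A i))"
  proof (rule summable_comparison_test'[OF gs])
    fix i show "norm (prob (A i)) \<le> g i" using PA[of i] by simp
  qed
  have "{w \<in> space M. \<exists>z. real R < real_of_int \<bar>z\<bar> \<and> k * real_of_int \<bar>z\<bar> < xi0 z w} \<subseteq> (\<Union>i. A i)"
  proof safe
    fix w z assume w: "w \<in> space M" "real R < real_of_int \<bar>z\<bar>" "k * real_of_int \<bar>z\<bar> < xi0 z w"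
    define i where "i = nat \<bar>z\<bar> - R - 1"
    have i: "int (R + 1 + i) = \<bar>z\<bar>" using w(2) unfolding i_def by linarith
    then have "real (R + 1 + i) = real_of_int \<bar>z\<bar>" by (metis of_int_of_nat_eq)
    moreover have "z \<in> {int (R + 1 + i), - int (R + 1 + i)}" unfolding i by auto
    ultimately have "w \<in> A i" using w unfolding A_def by auto
    then show "w \<in> (\<Union>i. A i)" by auto
  qed
  then have "prob {w \<in> space M. \<exists>z. real R < real_of_int \<bar>z\<bar> \<and> k * real_of_int \<bar>z\<bar> < xi0 z w} \<le> prob (\<Union>i. A i)"
    using Am by (intro finite_measure_mono) auto
  also have "\<dots> \<le> (\<Sum>i. prob (A i))"
    using Am sP by (intro finite_measure_subadditive_countably) auto
  also have "\<dots> \<le> (\<Sum>i. g i)" using PA sP gs by (intro suminf_le)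
  also have "\<dots> = 2 * k powr (- \<alpha>) * (\<Sum>i. (real (R + 1 + i)) powr (- \<alpha>))"
    unfolding g_def by (intro suminf_mult powr_neg_sum_le R)
  also have "\<dots> \<le> 2 * k powr (- \<alpha>) * real R powr (1 - \<alpha>)"
    by (intro mult_left_mono powr_neg_sum_le R) auto
  finally show "prob {w \<in> space M. \<exists>z. real R < real_of_int \<bar>z\<bar> \<and> k * real_of_int \<bar>z\<bar> < xi0 z w} \<le> 2 * k powr (- \<alpha>) * real R powr (1 - \<alpha>)" .
qed

lemma AE_xi0_gt_1: "AE w in M. \<forall>z. 1 < xi0 z w"
proof (rule AE_all_countable[THEN iffD2], rule allI)
  fix z
  have "prob {w \<in> space M. 1 < xi0 z w} = 1" using tail[of 1 z] by simp
  then show "AE w in M. 1 < xi0 z w" by (subst (asm) prob_Collect_eq_1) auto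
qed

text \<open>The tail is 1 at 1, so all values exceed 1 almost surely and the tail on [1,
  \<infinity>) determines the distribution function.\<close>

lemma distr_xi0: "distr M borel (xi0 z) = distr M borel (xi0 z')"
proof (rule cdf_unique)
  show "real_distribution (distr M borel (xi0 z))" "real_distribution (distr M borel (xi0 z'))"
    by (auto intro!: real_distribution_distr)
  have "cdf (distr M borel (xi0 z)) x = (if x \<ge> 1 then 1 - x powr (- \<alpha>) else 0)" for z x
  proof -
    have m: "{w \<in> space M. xi0 z w > x} \<in> events" by measurable
    have "cdf (distr M borel (xi0 z)) x = prob {w \<in> space M. xi0 z w \<le> x}"
      unfolding cdf_def by (subst measure_distr) (auto intro!: arg_cong[where f = prob])
    also have "\<dots> = 1 - prob {w \<in> space M. xi0 z w > x}"
      using prob_neg[of "\<lambda>w. xi0 z w > x"] m by (simp add: not_less pred_def)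
    also have "\<dots> = (if x \<ge> 1 then 1 - x powr (- \<alpha>) else 0)"
    proof (cases "x \<ge> 1")
      case False
      have "AE w in M. xi0 z w > x" using AE_xi0_gt_1
      proof eventually_elim
        fix w assume "\<forall>z. 1 < xi0 z w"
        then have "1 < xi0 z w" by blast
        then show "x < xi0 z w" using False by linarith
      qed
      then have "prob {w \<in> space M. xi0 z w > x} = 1" by (subst prob_Collect_eq_1) (use m in auto)
      then show ?thesis using False by simp
    qed (simp add: tail)
    finally show ?thesis .
  qed
  then show "cdf (distr M borel (xi0 z)) = cdf (distr M borel (xi0 z'))" by auto
qed

lemma distr_cfg:
  "distr M (PiM UNIV (\<lambda>_. borel)) cfg = PiM UNIV (\<lambda>i. distr M borel (\<lambda>w. cfg w i))"
proof -
  have "distr M (PiM UNIV (\<lambda>_. borel)) (\<lambda>w. \<lambda>i\<in>UNIV. cfg w i) = PiM UNIV (\<lambda>i. distr M borel (\<lambda>w. cfg w i))"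
    by (rule indep_vars_iff_distr_eq_PiM[THEN iffD1, OF _ _ cfg_indep]) (simp_all add: cfg_measurable)
  then show ?thesis by (simp add: restrict_def)
qed

end

lemma flip_pot_flip_pot: "flip_pot A (flip_pot A V) = V"
  by (auto simp: fun_eq_iff flip_pot_def)

section \<open>Fluctuations at a fixed site\<close>

text \<open>Stated for a fixed \<open>n\<close> so that a union over candidate maximisers can
  follow. The bound \<open>h\<close> from below makes the event rare enough for that union; the
  bound \<open>B\<close> from above, with \<open>gap\<close>, truncates the field on the
  window.\<close>

definition fluct_event :: "int \<Rightarrow> nat \<Rightarrow> nat \<Rightarrow> real \<Rightarrow> real \<Rightarrow> real \<Rightarrow> real \<Rightarrow> real \<Rightarrow> (int + nat \<Rightarrow> real) set" where
  "fluct_event n K L w e t h B = {x. (\<forall>b. 1 < cfg_pot x b) \<and> gap (cfg_pot x) n K L w \<and> h < cfg_pot x n \<and> cfg_pot x n \<le> B \<and>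
     e < \<bar>log_passage (cfg_pot x) n K L t - log_passage (\<lambda>b. cfg_pot x (- b)) n K L t\<bar>}"

lemma cfg_pot_measurable [measurable]: "(\<lambda>x. cfg_pot x b) \<in> borel_measurable (PiM UNIV (\<lambda>_. borel))"
  unfolding cfg_pot_def potential_def by measurable

lemma fluct_event_sets: "fluct_event n K L w e t h B \<in> sets (PiM UNIV (\<lambda>_. borel))"
proof -
  define f where "f x = log_passage (cfg_pot x) n K L t" for x
  define g where "g x = log_passage (\<lambda>b. cfg_pot x (- b)) n K L t" for x
  have [measurable]: "f \<in> borel_measurable (PiM UNIV (\<lambda>_. borel))"
    unfolding f_def by (rule log_passage_measurable) measurable
  have [measurable]: "g \<in> borel_measurable (PiM UNIV (\<lambda>_. borel))"
    unfolding g_def by (rule log_passage_measurable) measurable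
  have 1: "{x \<in> space (PiM UNIV (\<lambda>_. borel)). cfg_pot x b = cfg_pot x b'} \<in> sets (PiM UNIV (\<lambda>_. borel))" for b b'
    by measurable
  have 2: "{x \<in> space (PiM UNIV (\<lambda>_. borel)). cfg_pot x b \<le> cfg_pot x b' - w} \<in> sets (PiM UNIV (\<lambda>_. borel))" for b b'
    by measurable
  have 3: "{x \<in> space (PiM UNIV (\<lambda>_. borel)). c \<le> cfg_pot x b} \<in> sets (PiM UNIV (\<lambda>_. borel))" for b c
    by measurable
  have 4: "{x \<in> space (PiM UNIV (\<lambda>_. borel)). c < cfg_pot x b} \<in> sets (PiM UNIV (\<lambda>_. borel))" for b c
    by measurable
  have 5: "{x \<in> space (PiM UNIV (\<lambda>_. borel)). cfg_pot x b \<le> B} \<in> sets (PiM UNIV (\<lambda>_. borel))" for b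
    by measurable
  have 6: "{x \<in> space (PiM UNIV (\<lambda>_. borel)). e < \<bar>f x - g x\<bar>} \<in> sets (PiM UNIV (\<lambda>_. borel))"
    by measurable
  have "{x \<in> space (PiM UNIV (\<lambda>_. borel)). (\<forall>b. 1 < cfg_pot x b) \<and> gap (cfg_pot x) n K L w \<and> h < cfg_pot x n \<and> cfg_pot x n \<le> B \<and>
     e < \<bar>f x - g x\<bar>} \<in> sets (PiM UNIV (\<lambda>_. borel))"
    unfolding gap_def Ball_def
    by (intro sets.sets_Collect_conj sets.sets_Collect_countable_All sets.sets_Collect_imp sets.sets_Collect_const 1 2 3 4 5 6)
  then show ?thesis by (simp add: fluct_event_def space_PiM f_def g_def)
qed

text \<open>Dyadic level sets replace a truncated second moment by finitely many tail
  probabilities.\<close>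

lemma square_le_dyadic:
  fixes v :: real
  assumes "1 < v" "v \<le> 2 ^ J"
  shows "v\<^sup>2 \<le> (\<Sum>j<J. 4 ^ Suc j * (if 2 ^ j < v then 1 else 0))"
  using assms(2)
proof (induction J)
  case 0 then show ?case using assms(1) by simp
next
  case (Suc J)
  have nn: "0 \<le> (\<Sum>j<J. 4 ^ Suc j * (if 2 ^ j < v then 1 else 0 :: real))" by (intro sum_nonneg) auto
  show ?case
  proof (cases "v \<le> 2 ^ J")
    case True
    then show ?thesis using Suc.IH by simp
  next
    case False
    have "v\<^sup>2 \<le> (2 ^ Suc J)\<^sup>2" using Suc.prems assms(1) by (intro power_mono) auto
    also have "\<dots> = 4 ^ Suc J" by (simp add: power2_eq_square power_mult_distrib[symmetric])
    finally show ?thesis using nn False by simp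
  qed
qed

context dup_field
begin

lemma cfg_measurable_PiM [measurable]: "cfg \<in> measurable M (PiM UNIV (\<lambda>_. borel))"
  by (rule measurable_PiM_single') auto

text \<open>\<open>H\<close> is the pointwise bound for \<open>emeasure_swap_average\<close>. It
  sums indicators \<open>g\<close> of three independent conditions: height above \<open>h\<close> at
  \<open>n\<close>, tails at \<open>y\<close>, and height above 2^j at one site of the pair of
  \<open>y\<close>. Its mean is therefore a sum of products.\<close>

lemma prob_fluct_event_le:
  fixes n L K J :: nat
  assumes n: "0 < n" "L < n" "K \<le> L" "0 < L" and w: "4 \<le> w" and e: "0 < e" and t: "0 < t"
    and h: "1 \<le> h" and B: "B \<le> 2 ^ J"
  shows "prob {x \<in> space M. cfg x \<in> fluct_event (int n) K L w e t h B}
    \<le> 32 / (w\<^sup>2 * e\<^sup>2) * h powr (- \<alpha>) * (\<Sum>j<J. 4 ^ Suc j * (2 ^ j) powr (- \<alpha>)) * (\<Sum>y\<in>{1..<n + L}. 1 - p y)"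
proof -
  define U where "U = {1..<n + L}"
  \<comment> \<open>16 is 8^2 / 4, from the constant 8 and the denominator 4 e^2 in
    \<open>log_passage_flip_tail\<close>. The two sites of a pair turn it into 32.\<close>
  define c where "c = 16 / (w\<^sup>2 * e\<^sup>2)"
  have c0: "0 \<le> c" by (simp add: c_def)
  define g :: "(int + nat \<Rightarrow> real) \<Rightarrow> nat \<Rightarrow> int \<Rightarrow> nat \<Rightarrow> real" where
    "g x y z j = (if h < x (Inl (int n)) \<and> x (Inr y) = 0 \<and> 2 ^ j < x (Inl z) then 1 else 0)" for x y z j
  define H where "H x = (\<Sum>y\<in>U - {n}. \<Sum>z\<in>{int y, - int y}. \<Sum>j<J. c * (4 ^ Suc j * g x y z j))" for x
  let ?\<Phi> = "fluct_event (int n) K L w e t h B"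
  let ?N = "\<lambda>i. distr M borel (\<lambda>w. cfg w i)"
  have sN: "sets (PiM UNIV ?N) = sets (PiM UNIV (\<lambda>_. borel))" by (intro sets_PiM_cong) auto
  have H0: "0 \<le> H x" for x unfolding H_def g_def using c0 by (intro sum_nonneg mult_nonneg_nonneg) auto
  have gm: "(\<lambda>x. g x y z j) \<in> borel_measurable (PiM UNIV (\<lambda>_. borel))" for y z j
    unfolding g_def by measurable
  have Hm: "H \<in> borel_measurable (PiM UNIV (\<lambda>_. borel))"
    using gm unfolding H_def by measurable
  have "emeasure (PiM UNIV ?N) ?\<Phi> \<le> (\<integral>\<^sup>+x. ennreal (H x) \<partial>PiM UNIV ?N)"
  proof (rule emeasure_swap_average)
    fix i :: "int + nat"
    show "prob_space (?N i)" by (rule prob_space_distr) measurable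
    show "sets (?N i) = sets borel" by simp
  next
    fix z z' :: int
    have "(\<lambda>w. cfg w (Inl z)) = xi0 z" for z by (simp add: cfg_def)
    then show "?N (Inl z) = ?N (Inl z')" using distr_xi0[of z z'] by simp
  next
    show "finite U" by (simp add: U_def)
    show "?\<Phi> \<in> sets (PiM UNIV ?N)" unfolding sN by (rule fluct_event_sets)
    show "H \<in> borel_measurable (PiM UNIV ?N)" using Hm by (simp only: measurable_cong_sets[OF sN refl])
  next
    fix x :: "int + nat \<Rightarrow> real"
    let ?V = "cfg_pot x"
    let ?S = "{A \<in> Pow U. swap_cfg A x \<in> ?\<Phi>}"
    show "real (card ?S) \<le> 2 ^ card U * H x"
    proof (cases "?S = {}")
      case True
      then show ?thesis using H0[of x] by (simp only: card.empty) simp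
    next
      case False
      then obtain A where A: "flip_pot A ?V \<in> {V. (\<forall>b. 1 < V b) \<and> gap V (int n) K L w \<and> h < V (int n) \<and> V (int n) \<le> B}"
        by (auto simp: fluct_event_def cfg_pot_swap)
      \<comment> \<open>Exchanging twice is the identity, so the gap of some exchanged field passes
        back to the field itself.\<close>
      have gp: "gap ?V (int n) K L w"
        using gap_flip[of "flip_pot A ?V" "int n" K L w A] A by (simp add: flip_pot_flip_pot)
      then have Vn: "flip_pot A ?V (int n) = ?V (int n)" by (simp add: gap_def flip_pot_def)
      have hB: "h < ?V (int n)" "?V (int n) \<le> B" using A Vn by auto
      have V1: "1 < ?V b" for b
      proof -
        have "\<forall>b. 1 < flip_pot A ?V b" using A by simp
        then have "1 < flip_pot A ?V b" "1 < flip_pot A ?V (- b)" by auto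
        then show ?thesis by (auto simp: flip_pot_def split: if_splits)
      qed
      have VB: "?V b \<le> 2 ^ J" if "\<bar>b\<bar> < int n + int L" "\<bar>b\<bar> \<noteq> int n" for b
        using gapD[OF gp that] hB(2) B w by linarith
      have site: "(8 * \<bar>?V (int y) - ?V (- int y)\<bar> / w)\<^sup>2 / (4 * e\<^sup>2)
          \<le> (\<Sum>z\<in>{int y, - int y}. \<Sum>j<J. c * (4 ^ Suc j * g x y z j))" if y: "y \<in> U - {n}" for y
      proof (cases "x (Inr y) = 0")
        case False
        then have "?V (- int y) = ?V (int y)" by (simp add: cfg_pot_def potential_def)
        then show ?thesis using c0 by (auto intro!: sum_nonneg mult_nonneg_nonneg simp: g_def)
      next
        case True
        have y0: "0 < y" "int y \<noteq> - int y" using y by (auto simp: U_def)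
        have Vy: "?V (int y) = x (Inl (int y))" "?V (- int y) = x (Inl (- int y))"
          using True y0 by (auto simp: cfg_pot_def potential_def)
        have hx: "h < x (Inl (int n))" using hB(1) by (simp add: cfg_pot_def potential_def)
        have gq: "g x y z j = (if 2 ^ j < x (Inl z) then 1 else 0)" for z j
          using True hx by (simp add: g_def)
        have sq: "(?V b)\<^sup>2 \<le> (\<Sum>j<J. 4 ^ Suc j * (if 2 ^ j < ?V b then 1 else 0))" if "b = int y \<or> b = - int y" for b
          using that y by (intro square_le_dyadic V1 VB) (auto simp: U_def)
        have "(8 * \<bar>?V (int y) - ?V (- int y)\<bar> / w)\<^sup>2 / (4 * e\<^sup>2) = c * (?V (int y) - ?V (- int y))\<^sup>2"
          by (simp add: c_def power_mult_distrib power_divide)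
        also have "\<dots> \<le> c * ((?V (int y))\<^sup>2 + (?V (- int y))\<^sup>2)"
        proof (rule mult_left_mono[OF _ c0])
          have "0 \<le> ?V (int y) * ?V (- int y)" using V1[of "int y"] V1[of "- int y"] by simp
          then show "(?V (int y) - ?V (- int y))\<^sup>2 \<le> (?V (int y))\<^sup>2 + (?V (- int y))\<^sup>2"
            by (simp add: power2_diff)
        qed
        also have "\<dots> \<le> c * ((\<Sum>j<J. 4 ^ Suc j * g x y (int y) j) + (\<Sum>j<J. 4 ^ Suc j * g x y (- int y) j))"
          using sq[of "int y"] sq[of "- int y"] unfolding gq Vy by (intro mult_left_mono[OF _ c0] add_mono) auto
        also have "\<dots> = (\<Sum>z\<in>{int y, - int y}. \<Sum>j<J. c * (4 ^ Suc j * g x y z j))"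
          using y0(2) by (simp add: sum_distrib_left distrib_left)
        finally show ?thesis .
      qed
      have U': "U = {1..<nat (int n) + L}" by (simp add: U_def)
      have "real (card ?S) \<le> real (card {A \<in> Pow U. e < \<bar>log_passage (flip_pot A ?V) (int n) K L t - log_passage (\<lambda>b. flip_pot A ?V (- b)) (int n) K L t\<bar>})"
      proof (rule of_nat_mono, rule card_mono)
        show "finite {A \<in> Pow U. e < \<bar>log_passage (flip_pot A ?V) (int n) K L t - log_passage (\<lambda>b. flip_pot A ?V (- b)) (int n) K L t\<bar>}"
          by (simp add: U_def)
      qed (auto simp: fluct_event_def cfg_pot_swap)
      also have "\<dots> \<le> 2 ^ card U * ((\<Sum>y\<in>U. (8 * \<bar>?V (int y) - ?V (- int y)\<bar> / w)\<^sup>2) / (4 * e\<^sup>2))"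
        unfolding U' using n w t e gp by (intro log_passage_flip_tail) auto
      also have "(\<Sum>y\<in>U. (8 * \<bar>?V (int y) - ?V (- int y)\<bar> / w)\<^sup>2) / (4 * e\<^sup>2)
        = (\<Sum>y\<in>U. (8 * \<bar>?V (int y) - ?V (- int y)\<bar> / w)\<^sup>2 / (4 * e\<^sup>2))" by (rule sum_divide_distrib)
      \<comment> \<open>The pair at \<open>n\<close> has equal values and drops out. This keeps
        \<open>y\<close> different from \<open>n\<close>, as independence of the three conditions in
        \<open>g\<close> requires.\<close>
      also have "\<dots> = (\<Sum>y\<in>U - {n}. (8 * \<bar>?V (int y) - ?V (- int y)\<bar> / w)\<^sup>2 / (4 * e\<^sup>2))"
        using gp by (intro sum.mono_neutral_right) (auto simp: U_def gap_def)
      also have "2 ^ card U * \<dots> \<le> 2 ^ card U * H x"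
        unfolding H_def by (intro mult_left_mono sum_mono site) auto
      finally show ?thesis by simp
    qed
  qed
  also have "(\<integral>\<^sup>+x. ennreal (H x) \<partial>PiM UNIV ?N) = (\<integral>\<^sup>+x. ennreal (H (cfg x)) \<partial>M)"
    unfolding distr_cfg[symmetric] using Hm by (subst nn_integral_distr) auto
  also have "\<dots> = ennreal (expectation (\<lambda>x. H (cfg x)))"
  proof (rule nn_integral_eq_integral)
    have "integrable M (\<lambda>x. g (cfg x) y z j)" for y z j
    proof (rule integrable_const_bound[where B = 1])
      show "(\<lambda>x. g (cfg x) y z j) \<in> borel_measurable M" by (rule measurable_compose[OF cfg_measurable_PiM gm])
    qed (simp add: g_def)
    then show "integrable M (\<lambda>x. H (cfg x))" unfolding H_def by auto
  qed (simp add: H0)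
  also have "expectation (\<lambda>x. H (cfg x)) = (\<Sum>y\<in>U - {n}. \<Sum>z\<in>{int y, - int y}. \<Sum>j<J. c * (4 ^ Suc j * (h powr (- \<alpha>) * (1 - p y) * (2 ^ j) powr (- \<alpha>))))"
  proof -
    have int: "integrable M (\<lambda>x. g (cfg x) y z j)" for y z j
    proof (rule integrable_const_bound[where B = 1])
      show "(\<lambda>x. g (cfg x) y z j) \<in> borel_measurable M" by (rule measurable_compose[OF cfg_measurable_PiM gm])
    qed (simp add: g_def)
    have ex: "expectation (\<lambda>x. g (cfg x) y z j) = h powr (- \<alpha>) * (1 - p y) * (2 ^ j) powr (- \<alpha>)"
      if "y \<in> U - {n}" "z \<in> {int y, - int y}" for y z j
    proof -
      let ?E = "{x \<in> space M. h < xi0 (int n) x \<and> \<not> coin y x \<and> 2 ^ j < xi0 z x}"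
      have "expectation (\<lambda>x. g (cfg x) y z j) = expectation (indicator ?E)"
        by (intro Bochner_Integration.integral_cong) (auto simp: g_def cfg_def indicator_def)
      also have "\<dots> = prob ?E"
      proof -
        have "?E \<in> events" by measurable
        then show ?thesis by simp
      qed
      also have "\<dots> = h powr (- \<alpha>) * (1 - p y) * (2 ^ j) powr (- \<alpha>)"
        using that h n by (intro prob_two_big_coin) (auto simp: U_def)
      finally show ?thesis .
    qed
    have "expectation (\<lambda>x. H (cfg x)) = (\<Sum>y\<in>U - {n}. \<Sum>z\<in>{int y, - int y}. \<Sum>j<J. c * (4 ^ Suc j * expectation (\<lambda>x. g (cfg x) y z j)))"
      unfolding H_def using int by (simp add: Bochner_Integration.integral_sum del: sum.insert power_Suc)
    also have "\<dots> = (\<Sum>y\<in>U - {n}. \<Sum>z\<in>{int y, - int y}. \<Sum>j<J. c * (4 ^ Suc j * (h powr (- \<alpha>) * (1 - p y) * (2 ^ j) powr (- \<alpha>))))"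
      by (intro sum.cong refl) (simp only: ex)
    finally show ?thesis .
  qed
  also have "\<dots> \<le> (\<Sum>y\<in>U. 2 * c * h powr (- \<alpha>) * (\<Sum>j<J. 4 ^ Suc j * (2 ^ j) powr (- \<alpha>)) * (1 - p y))"
  proof -
    have "(\<Sum>z\<in>{int y, - int y}. \<Sum>j<J. c * (4 ^ Suc j * (h powr (- \<alpha>) * (1 - p y) * (2 ^ j) powr (- \<alpha>))))
       = 2 * c * h powr (- \<alpha>) * (\<Sum>j<J. 4 ^ Suc j * (2 ^ j) powr (- \<alpha>)) * (1 - p y)" if "y \<in> U" for y
    proof -
      have ne: "int y \<noteq> - int y" using that by (auto simp: U_def)
      let ?q = "(c * h powr (- \<alpha>) * (1 - p y)) * (\<Sum>j<J. 4 ^ Suc j * (2 ^ j) powr (- \<alpha>))"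
      have "(\<Sum>j<J. c * (4 ^ Suc j * (h powr (- \<alpha>) * (1 - p y) * (2 ^ j) powr (- \<alpha>))))
        = (\<Sum>j<J. (c * h powr (- \<alpha>) * (1 - p y)) * (4 ^ Suc j * (2 ^ j) powr (- \<alpha>)))"
        by (intro sum.cong refl) (simp only: mult_ac)
      also have "\<dots> = ?q" by (rule sum_distrib_left[symmetric])
      finally have q: "(\<Sum>j<J. c * (4 ^ Suc j * (h powr (- \<alpha>) * (1 - p y) * (2 ^ j) powr (- \<alpha>)))) = ?q" .
      have "(\<Sum>z\<in>{int y, - int y}. ?q) = 2 * ?q" using ne by simp
      also have "\<dots> = 2 * c * h powr (- \<alpha>) * (\<Sum>j<J. 4 ^ Suc j * (2 ^ j) powr (- \<alpha>)) * (1 - p y)"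
        by (simp only: mult_ac)
      finally show ?thesis unfolding q .
    qed
    then have "(\<Sum>y\<in>U - {n}. \<Sum>z\<in>{int y, - int y}. \<Sum>j<J. c * (4 ^ Suc j * (h powr (- \<alpha>) * (1 - p y) * (2 ^ j) powr (- \<alpha>))))
      = (\<Sum>y\<in>U - {n}. 2 * c * h powr (- \<alpha>) * (\<Sum>j<J. 4 ^ Suc j * (2 ^ j) powr (- \<alpha>)) * (1 - p y))"
      by (intro sum.cong) auto
    also have "\<dots> \<le> (\<Sum>y\<in>U. 2 * c * h powr (- \<alpha>) * (\<Sum>j<J. 4 ^ Suc j * (2 ^ j) powr (- \<alpha>)) * (1 - p y))"
      using c0 p01 by (intro sum_mono2) (auto simp: U_def intro!: mult_nonneg_nonneg sum_nonneg)
    finally show ?thesis .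
  qed
  also have "(\<Sum>y\<in>U. 2 * c * h powr (- \<alpha>) * (\<Sum>j<J. 4 ^ Suc j * (2 ^ j) powr (- \<alpha>)) * (1 - p y))
     = 2 * c * h powr (- \<alpha>) * (\<Sum>j<J. 4 ^ Suc j * (2 ^ j) powr (- \<alpha>)) * (\<Sum>y\<in>U. 1 - p y)"
    by (rule sum_distrib_left[symmetric])
  finally have *: "emeasure (PiM UNIV ?N) ?\<Phi> \<le> ennreal (2 * c * h powr (- \<alpha>) * (\<Sum>j<J. 4 ^ Suc j * (2 ^ j) powr (- \<alpha>)) * (\<Sum>y\<in>U. 1 - p y))"
    by (simp add: ennreal_leI)
  have "emeasure (PiM UNIV ?N) ?\<Phi> = ennreal (prob {x \<in> space M. cfg x \<in> ?\<Phi>})"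
  proof -
    have "cfg -` ?\<Phi> \<inter> space M = {x \<in> space M. cfg x \<in> ?\<Phi>}" by auto
    then show ?thesis
      unfolding distr_cfg[symmetric] using fluct_event_sets
      by (subst emeasure_distr) (auto simp: emeasure_eq_measure)
  qed
  with * have "ennreal (prob {x \<in> space M. cfg x \<in> ?\<Phi>}) \<le> ennreal (2 * c * h powr (- \<alpha>) * (\<Sum>j<J. 4 ^ Suc j * (2 ^ j) powr (- \<alpha>)) * (\<Sum>y\<in>U. 1 - p y))"
    by simp
  moreover have "0 \<le> 2 * c * h powr (- \<alpha>) * (\<Sum>j<J. 4 ^ Suc j * (2 ^ j) powr (- \<alpha>)) * (\<Sum>y\<in>U. 1 - p y)"
    using c0 p01 by (intro mult_nonneg_nonneg sum_nonneg) auto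
  ultimately have "prob {x \<in> space M. cfg x \<in> ?\<Phi>} \<le> 2 * c * h powr (- \<alpha>) * (\<Sum>j<J. 4 ^ Suc j * (2 ^ j) powr (- \<alpha>)) * (\<Sum>y\<in>U. 1 - p y)"
    by (simp only: ennreal_le_iff)
  then show ?thesis by (simp add: c_def U_def)
qed

end

subsection \<open>Scales of the maximiser\<close>

text \<open>At time \<open>t\<close> the maximiser has height of order \<open>hscale\<close> and distance of order \<open>dscale\<close>.\<close>

definition hscale :: "real \<Rightarrow> real \<Rightarrow> real" where
  "hscale \<alpha> t = (t / ln t) powr (1 / (\<alpha> - 1))"

definition dscale :: "real \<Rightarrow> real \<Rightarrow> real" where
  "dscale \<alpha> t = hscale \<alpha> t * t / ln t"

text \<open>The two scales match: among about \<open>dscale\<close> independent Pareto variables the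
  largest is of order \<open>hscale\<close>.\<close>

lemma dscale_eq_powr:
  assumes "\<alpha> \<ge> 2" "1 < t"
  shows "dscale \<alpha> t = hscale \<alpha> t powr \<alpha>"
proof -
  have x: "0 < t / ln t" using assms by simp
  have "hscale \<alpha> t powr \<alpha> = (t / ln t) powr (1 / (\<alpha> - 1) * \<alpha>)" by (simp add: hscale_def powr_powr)
  also have "1 / (\<alpha> - 1) * \<alpha> = 1 / (\<alpha> - 1) + 1" using assms by (simp add: field_simps)
  also have "(t / ln t) powr (1 / (\<alpha> - 1) + 1) = (t / ln t) powr (1 / (\<alpha> - 1)) * (t / ln t)"
    using x by (simp only: powr_add powr_one[OF less_imp_le])
  finally show ?thesis by (simp add: dscale_def hscale_def)
qed

lemma dscale_powr_eq:
  assumes "\<alpha> \<ge> 2" "1 < t"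
  shows "dscale \<alpha> t powr (\<alpha> - 1) = (t / ln t) powr \<alpha>"
  using assms by (simp add: dscale_eq_powr hscale_def powr_powr)

lemma ln_hscale:
  assumes "1 < t"
  shows "ln (hscale \<alpha> t) = (1 / (\<alpha> - 1)) * (ln t - ln (ln t))"
  using assms by (simp add: hscale_def ln_powr ln_div)

lemma hscale_at_top: "\<alpha> \<ge> 2 \<Longrightarrow> filterlim (hscale \<alpha>) at_top at_top"
proof -
  assume a: "\<alpha> \<ge> 2"
  have "filterlim (\<lambda>t::real. t / ln t) at_top at_top" by real_asymp
  moreover have "filterlim (\<lambda>x::real. x powr (1 / (\<alpha> - 1))) at_top at_top"
  proof -
    have "0 < 1 / (\<alpha> - 1)" using a by simp
    then show ?thesis by real_asymp
  qed
  ultimately show "filterlim (hscale \<alpha>) at_top at_top" unfolding hscale_def[abs_def] by (rule filterlim_compose[rotated])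
qed

lemma dscale_at_top: "\<alpha> \<ge> 2 \<Longrightarrow> filterlim (dscale \<alpha>) at_top at_top"
proof -
  assume a: "\<alpha> \<ge> 2"
  have "filterlim (\<lambda>t::real. t / ln t) at_top at_top" by real_asymp
  then have "filterlim (\<lambda>t. hscale \<alpha> t * (t / ln t)) at_top at_top"
    using hscale_at_top[OF a] by (intro filterlim_at_top_mult_at_top)
  then show "filterlim (dscale \<alpha>) at_top at_top" by (simp add: dscale_def[abs_def])
qed

lemma eventually_log_affine:
  assumes "0 < A"
  shows "\<forall>\<^sub>F t in at_top. B * ln (ln t) + D \<le> A * ln (t::real)"
proof -
  have "((\<lambda>t::real. (B * ln (ln t) + D) / ln t) \<longlongrightarrow> 0) at_top" by real_asymp
  then have "\<forall>\<^sub>F t in at_top. (B * ln (ln t) + D) / ln t < A" using assms by (rule order_tendstoD)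
  moreover have "\<forall>\<^sub>F t in at_top. 1 < (t::real)" by (rule eventually_gt_at_top)
  ultimately show ?thesis
  proof eventually_elim
    case (elim t)
    then have "0 < ln t" by simp
    then show ?case using elim(1) by (simp add: pos_divide_less_eq)
  qed
qed

text \<open>All logarithms are \<beta> ln t plus multiples of ln ln t and constants, so only the
  coefficients of ln t matter. The inequalities with \<theta> leave \<beta> \<theta> and \<beta>
  \<theta> / 2 to spare, the last one \<beta> (1 - 1/8 - 1/3).\<close>

lemma eventually_scale_conditions:
  assumes "\<alpha> \<ge> 2" "0 < c0" "0 < d1" "0 < C'" "0 < \<theta>" "\<theta> < 1"
  defines "\<beta> \<equiv> 1 / (\<alpha> - 1)"
  shows "\<forall>\<^sub>F t in at_top. \<beta> / 8 * ln t \<le> ln (hscale \<alpha> t / ln t)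
      \<and> \<beta> / 2 * ln t \<le> ln (c0 * hscale \<alpha> t)
      \<and> (1 - \<theta>) * ln (2 * C' * hscale \<alpha> t) + 1 \<le> ln (d1 * hscale \<alpha> t / (2 * exp 1 * ln t))
      \<and> (1 - \<theta> / 2) * ln (2 * C' * hscale \<alpha> t) + 2 \<le> ln (d1 * hscale \<alpha> t / (2 * exp 1 * ln t))
      \<and> \<beta> / 8 * ln t + ln (2 * C' * hscale \<alpha> t) / 3 + 1 \<le> ln (d1 * hscale \<alpha> t / (2 * exp 1 * ln t))"
proof -
  have \<beta>: "0 < \<beta>" using assms by simp
  let ?D = "\<bar>ln c0\<bar> + \<bar>ln d1\<bar> + \<bar>ln (2 * C')\<bar> + ln 2 + 5"
  let ?B = "\<beta> + 1"
  have "\<forall>\<^sub>F t in at_top. ?B * ln (ln t) + ?D \<le> (\<beta> * \<theta> / 2) * ln t"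
    using \<beta> assms by (intro eventually_log_affine) auto
  moreover have "\<forall>\<^sub>F t in at_top. ?B * ln (ln t) + ?D \<le> (\<beta> / 4) * ln t"
    using \<beta> by (intro eventually_log_affine) auto
  moreover have "\<forall>\<^sub>F t in at_top. exp 1 < (t::real)" by (rule eventually_gt_at_top)
  ultimately show ?thesis
  proof eventually_elim
    case (elim t)
    have t1: "1 < t" using elim(3) by (smt (verit) one_less_exp_iff)
    have lt: "1 < ln t" using elim(3) t1 by (metis ln_exp ln_less_cancel_iff exp_gt_zero less_trans)
    define x where "x = ln t"
    define y where "y = ln (ln t)"
    have y0: "0 < y" using lt by (simp add: y_def)
    have h0: "0 < hscale \<alpha> t" using t1 lt by (simp add: hscale_def)
    have lh: "ln (hscale \<alpha> t) = \<beta> * x - \<beta> * y" using ln_hscale[OF t1, of \<alpha>] by (simp add: x_def y_def \<beta>_def right_diff_distrib diff_divide_distrib)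
    have e1: "ln (hscale \<alpha> t / ln t) = \<beta> * x - \<beta> * y - y" using h0 lt lh by (simp add: ln_div y_def)
    have e2: "ln (c0 * hscale \<alpha> t) = ln c0 + (\<beta> * x - \<beta> * y)" using h0 assms lh by (simp add: ln_mult)
    have e3: "ln (2 * C' * hscale \<alpha> t) = ln (2 * C') + (\<beta> * x - \<beta> * y)"
      using h0 assms lh ln_mult_pos[of "2 * C'" "hscale \<alpha> t"] by simp
    have e4: "ln (d1 * hscale \<alpha> t / (2 * exp 1 * ln t)) = ln d1 + (\<beta> * x - \<beta> * y) - (ln 2 + 1 + y)"
      using h0 assms lh lt by (simp add: ln_div ln_mult y_def)
    have i1: "\<beta> * y + y + ?D \<le> \<beta> * \<theta> / 2 * x" "\<beta> * y + y + ?D \<le> \<beta> / 4 * x"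
      using elim(1,2) by (simp_all add: x_def y_def distrib_right)
    have by0: "0 \<le> \<beta> * y" using \<beta> y0 by simp
    have l2: "0 \<le> ln (2::real)" by simp
    have bx: "0 \<le> \<beta> * x" using \<beta> lt by (simp add: x_def)
    have t0: "0 \<le> \<theta> * (\<beta> * y)" "\<theta> * (\<beta> * y) \<le> \<beta> * y" using by0 assms(5,6) mult_right_mono[of \<theta> 1 "\<beta> * y"] mult_nonneg_nonneg[of \<theta> "\<beta> * y"] by auto
    have lC: "\<bar>(1 - \<theta>) * ln (2 * C')\<bar> \<le> \<bar>ln (2 * C')\<bar>" "\<bar>(1 - \<theta> / 2) * ln (2 * C')\<bar> \<le> \<bar>ln (2 * C')\<bar>"
      using assms(5,6) by (auto simp: abs_mult intro!: mult_left_le_one_le)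
    have x1: "(1 - \<theta>) * (\<beta> * x - \<beta> * y) = \<beta> * x - \<beta> * y - 2 * (\<beta> * \<theta> / 2 * x) + \<theta> * (\<beta> * y)"
      "(1 - \<theta> / 2) * (\<beta> * x - \<beta> * y) = \<beta> * x - \<beta> * y - (\<beta> * \<theta> / 2 * x) + \<theta> * (\<beta> * y) / 2"
      by (simp_all add: algebra_simps)
    have i3: "0 \<le> \<beta> * \<theta> / 2 * x" using \<beta> assms(5) lt by (simp add: x_def)
    have f1: "\<beta> / 8 * ln t \<le> ln (hscale \<alpha> t / ln t)"
    proof -
      have "\<beta> / 8 * x \<le> \<beta> * x - \<beta> * y - y" using i1 bx l2 by linarith
      then show ?thesis by (simp only: e1) (simp only: x_def)
    qed
    have f2: "\<beta> / 2 * ln t \<le> ln (c0 * hscale \<alpha> t)"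
    proof -
      have "\<beta> / 2 * x \<le> ln c0 + (\<beta> * x - \<beta> * y)" using i1 bx l2 y0 by linarith
      then show ?thesis by (simp only: e2) (simp only: x_def)
    qed
    have f3: "(1 - \<theta>) * ln (2 * C' * hscale \<alpha> t) + 1 \<le> ln (d1 * hscale \<alpha> t / (2 * exp 1 * ln t))"
      unfolding e3 e4 distrib_left x1 using i1 bx l2 y0 lC t0 i3 by linarith
    have f4: "(1 - \<theta> / 2) * ln (2 * C' * hscale \<alpha> t) + 2 \<le> ln (d1 * hscale \<alpha> t / (2 * exp 1 * ln t))"
      unfolding e3 e4 distrib_left x1 using i1 bx l2 y0 lC t0 i3 by linarith
    have f5: "\<beta> / 8 * ln t + ln (2 * C' * hscale \<alpha> t) / 3 + 1 \<le> ln (d1 * hscale \<alpha> t / (2 * exp 1 * ln t))"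
    proof -
      have "\<beta> / 8 * x + (ln (2 * C') + (\<beta> * x - \<beta> * y)) / 3 + 1 \<le> ln d1 + (\<beta> * x - \<beta> * y) - (ln 2 + 1 + y)"
      proof -
        define X where "X = \<beta> * x"
        define Y where "Y = \<beta> * y"
        define P where "P = ln (2 * C')"
        have "\<beta> / 8 * x = X / 8" "\<beta> / 4 * x = X / 4" by (simp_all add: X_def)
        moreover have "P \<le> \<bar>P\<bar>" "- ln d1 \<le> \<bar>ln d1\<bar>" "0 \<le> \<bar>ln c0\<bar>" by auto
        ultimately show ?thesis
          using i1(2) bx l2 y0 by0 unfolding X_def[symmetric] Y_def[symmetric] P_def[symmetric] by argo
      qed
      then show ?thesis by (simp only: e3 e4) (simp only: x_def)
    qed
    show ?case by (intro conjI f1 f2 f3 f4 f5)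
  qed
qed

text \<open>This is where \<eta> = o(\<kappa>) enters. With a = \<open>hscale\<close> and r =
  \<open>dscale\<close>, \<kappa> at distance O(r) is O(a^2) if \<alpha> > 2, and then the dyadic
  sum is bounded. If \<alpha> = 2, \<kappa> is O(r / ln r) with r = a^2, and the dyadic sum has O(ln
  r) equal terms.\<close>

lemma eta_scale_bounds:
  assumes a: "\<alpha> \<ge> 2" and q: "\<And>n. 0 \<le> q n" and o: "eta q \<in> o(kappa \<alpha>)"
    and C: "1 \<le> C" and C': "0 < C'" and \<delta>: "0 < \<delta>"
  shows "\<forall>\<^sub>F t in at_top. eta q (nat \<lfloor>2 * C * dscale \<alpha> t\<rfloor>) \<le> \<delta> * dscale \<alpha> t
    \<and> (\<Sum>j<nat \<lceil>log 2 (C' * hscale \<alpha> t)\<rceil>. 4 ^ Suc j * (2 ^ j) powr (- \<alpha>)) * eta q (nat \<lfloor>2 * C * dscale \<alpha> t\<rfloor>) \<le> \<delta> * (hscale \<alpha> t)\<^sup>2"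
proof -
  define R where "R t = nat \<lfloor>2 * C * dscale \<alpha> t\<rfloor>" for t
  define Q where "Q J = (\<Sum>j<J. 4 ^ Suc j * (2 ^ j) powr (- \<alpha>))" for J
  have R_top: "filterlim R at_top at_top"
  proof -
    have "filterlim (\<lambda>t. 2 * C * dscale \<alpha> t) at_top at_top"
      using C dscale_at_top[OF a] by (intro filterlim_tendsto_pos_mult_at_top[OF tendsto_const]) auto
    then show ?thesis unfolding R_def
      by (intro filterlim_compose[OF filterlim_nat_sequentially] filterlim_compose[OF filterlim_floor_sequentially])
  qed
  have eta0: "0 \<le> eta q n" for n unfolding eta_def using q by (intro sum_nonneg) auto
  have ev_eta: "\<forall>\<^sub>F t in at_top. eta q (R t) \<le> c * \<bar>kappa \<alpha> (R t)\<bar>" if "0 < c" for c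
  proof -
    have "\<forall>\<^sub>F n in at_top. norm (eta q n) \<le> c * norm (kappa \<alpha> n)" using landau_o.smallD[OF o that] .
    from eventually_compose_filterlim[OF this R_top] show ?thesis
      by (rule eventually_mono) (use eta0 in auto)
  qed
  have ev1: "\<forall>\<^sub>F t in at_top. 1 < (t::real) \<and> max 1 C' \<le> hscale \<alpha> t \<and> exp 8 \<le> dscale \<alpha> t"
    using hscale_at_top[OF a] dscale_at_top[OF a] eventually_gt_at_top[of "1::real"]
    by (auto simp: filterlim_at_top intro!: eventually_conj)
  have Q0: "0 \<le> Q J" for J unfolding Q_def by (intro sum_nonneg) auto
  \<comment> \<open>Geometric with ratio 2^(2 - \<alpha>), which equals 1 exactly for \<alpha> = 2:
    the source of the logarithm in \<open>kappa\<close>.\<close>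
  have Qterm: "4 ^ Suc j * (2 ^ j) powr (- \<alpha>) = 4 * (2 powr (2 - \<alpha>)) ^ j" for j
  proof -
    have "(2::real) ^ j = 2 powr real j" by (simp add: powr_realpow)
    then have "(2 ^ j) powr (- \<alpha>) = 2 powr (- \<alpha> * real j)" by (simp add: powr_powr mult.commute)
    also have "\<dots> = (2 powr (- \<alpha>)) ^ j" using powr_realpow[of "2 powr (- \<alpha>)" j] by (simp add: powr_powr)
    finally have "4 ^ Suc j * (2 ^ j) powr (- \<alpha>) = 4 * (4 * 2 powr (- \<alpha>)) ^ j" by (simp add: power_mult_distrib)
    also have "4 * 2 powr (- \<alpha>) = 2 powr (2 - \<alpha>)" by (simp add: powr_diff powr_minus divide_inverse)
    finally show ?thesis .
  qed
  show ?thesis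
  proof (cases "\<alpha> > 2")
    case True
    define D where "D = (2 * C) powr (2 / \<alpha>)"
    define E where "E = 4 / (1 - 2 powr (2 - \<alpha>)) + 1"
    have D0: "0 < D" using C by (simp add: D_def)
    have x: "(2::real) powr (2 - \<alpha>) < 1" using True by (simp add: powr_less_one)
    have E1: "1 \<le> E" using x by (simp add: E_def)
    have QE: "Q J \<le> E" for J
    proof -
      have "Q J = 4 * (\<Sum>j<J. (2 powr (2 - \<alpha>)) ^ j)" unfolding Q_def Qterm by (simp add: sum_distrib_left)
      also have "(\<Sum>j<J. (2 powr (2 - \<alpha>)) ^ j) \<le> (\<Sum>j. (2 powr (2 - \<alpha>)) ^ j)"
        using x by (intro sum_le_suminf summable_geometric) auto
      also have "\<dots> = 1 / (1 - 2 powr (2 - \<alpha>))" using x by (intro suminf_geometric) auto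
      finally show ?thesis by (simp add: E_def)
    qed
    have c: "0 < \<delta> / (E * D)" using \<delta> D0 E1 by simp
    show ?thesis using ev_eta[OF c] ev1
    proof eventually_elim
      case (elim t)
      have h1: "1 \<le> hscale \<alpha> t" and t1: "1 < t" using elim by auto
      have dd: "dscale \<alpha> t = hscale \<alpha> t powr \<alpha>" using a t1 by (rule dscale_eq_powr)
      have d0: "0 < dscale \<alpha> t" using h1 dd by simp
      have "real (R t) \<le> 2 * C * dscale \<alpha> t" unfolding R_def using C d0 by simp
      then have "kappa \<alpha> (R t) \<le> (2 * C * dscale \<alpha> t) powr (2 / \<alpha>)"
        unfolding kappa_def using True by (simp add: powr_mono2)
      also have "\<dots> = D * dscale \<alpha> t powr (2 / \<alpha>)" using C d0 by (simp add: D_def powr_mult)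
      also have "dscale \<alpha> t powr (2 / \<alpha>) = (hscale \<alpha> t)\<^sup>2"
        unfolding dd using h1 a by (simp add: powr_powr powr_numeral)
      finally have k: "kappa \<alpha> (R t) \<le> D * (hscale \<alpha> t)\<^sup>2" .
      have k0: "0 \<le> kappa \<alpha> (R t)" using True by (simp add: kappa_def)
      have "eta q (R t) \<le> \<delta> / (E * D) * kappa \<alpha> (R t)" using elim(1) k0 by simp
      also have "\<dots> \<le> \<delta> / (E * D) * (D * (hscale \<alpha> t)\<^sup>2)" using k c by (intro mult_left_mono) auto
      also have "\<dots> = \<delta> / E * (hscale \<alpha> t)\<^sup>2" using D0 E1 by simp
      finally have 1: "eta q (R t) \<le> \<delta> / E * (hscale \<alpha> t)\<^sup>2" .
      have "\<delta> / E * (hscale \<alpha> t)\<^sup>2 \<le> \<delta> * dscale \<alpha> t"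
      proof (rule mult_mono)
        show "\<delta> / E \<le> \<delta>" using E1 \<delta> by (simp add: field_simps)
        have "(hscale \<alpha> t)\<^sup>2 = hscale \<alpha> t powr 2" using h1 by (simp add: powr_numeral)
        also have "\<dots> \<le> dscale \<alpha> t" unfolding dd using h1 a by (intro powr_mono) auto
        finally show "(hscale \<alpha> t)\<^sup>2 \<le> dscale \<alpha> t" .
      qed (use \<delta> in auto)
      then have "eta q (R t) \<le> \<delta> * dscale \<alpha> t" using 1 by linarith
      moreover have "Q J * eta q (R t) \<le> E * (\<delta> / E * (hscale \<alpha> t)\<^sup>2)" for J
        using 1 QE[of J] Q0 eta0 E1 by (intro mult_mono) auto
      then have "Q J * eta q (R t) \<le> \<delta> * (hscale \<alpha> t)\<^sup>2" for J using E1 by simp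
      ultimately show ?case unfolding R_def[symmetric] Q_def[symmetric] by simp
    qed
  next
    case False
    then have a2: "\<alpha> = 2" using a by simp
    have Q4: "Q J = 4 * real J" for J unfolding Q_def Qterm by (simp add: a2)
    have c: "0 < \<delta> / (16 * C)" using \<delta> C by simp
    show ?thesis using ev_eta[OF c] ev1
    proof eventually_elim
      case (elim t)
      define d where "d = dscale \<alpha> t"
      define h where "h = hscale \<alpha> t"
      have h1: "1 \<le> h" "C' \<le> h" and t1: "1 < t" and d8: "exp 8 \<le> d" using elim by (auto simp: d_def h_def)
      have dd: "d = h\<^sup>2" using dscale_eq_powr[OF a t1] h1 by (simp add: d_def h_def a2 powr_numeral)
      have dgt: "1 < d" using less_le_trans[OF _ d8, of 1] by simp
      then have d1: "1 \<le> d" by simp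
      have ld: "8 \<le> ln d" using d8 d1 by (simp add: ln_ge_iff)
      have "d \<le> 2 * C * d - 1" using mult_right_mono[OF C, of d] d1 by linarith
      also have "\<dots> \<le> real (R t)" unfolding R_def d_def[symmetric] using C d1 by linarith
      finally have Rd: "d \<le> real (R t)" .
      have R2: "real (R t) \<le> 2 * C * d" unfolding R_def d_def[symmetric] using C d1 by simp
      have lR: "ln d \<le> ln (real (R t))" using Rd d1 by simp
      have "kappa \<alpha> (R t) = real (R t) / ln (real (R t))" by (simp add: kappa_def a2)
      also have "\<dots> \<le> 2 * C * d / ln d" using R2 lR ld C dgt by (intro frac_le) auto
      finally have k: "kappa \<alpha> (R t) \<le> 2 * C * d / ln d" .
      have k0: "0 \<le> kappa \<alpha> (R t)" using lR ld by (simp add: kappa_def a2)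
      have "eta q (R t) \<le> \<delta> / (16 * C) * kappa \<alpha> (R t)" using elim(1) k0 by simp
      also have "\<dots> \<le> \<delta> / (16 * C) * (2 * C * d / ln d)" using k c by (intro mult_left_mono) auto
      also have "\<dots> = \<delta> * d / (8 * ln d)" using C by simp
      finally have 1: "eta q (R t) \<le> \<delta> * d / (8 * ln d)" .
      have "\<delta> * d / (8 * ln d) \<le> \<delta> * d / 1" using \<delta> dgt ld by (intro divide_left_mono) auto
      then have 2: "eta q (R t) \<le> \<delta> * d" using 1 by simp
      define J where "J = nat \<lceil>log 2 (C' * h)\<rceil>"
      have "log 2 (C' * h) \<le> log 2 d"
        using mult_right_mono[OF h1(2), of h] h1(1) C' d1 by (simp add: dd power2_eq_square)
      also have "log 2 d = ln d / ln 2" by (simp add: log_def)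
      also have "\<dots> \<le> ln d / (2 / 3)" using ld ln2_ge_two_thirds by (intro divide_left_mono) auto
      also have "ln d / (2 / 3) = 3 / 2 * ln d" by simp
      finally have "log 2 (C' * h) + 1 \<le> 3 / 2 * ln d + 1" by (rule add_right_mono)
      with of_int_ceiling_le_add_one have "real_of_int \<lceil>log 2 (C' * h)\<rceil> \<le> 3 / 2 * ln d + 1" by (rule order_trans)
      moreover have "real (nat k) \<le> max 0 (real_of_int k)" for k by (cases "0 \<le> k") auto
      ultimately have "real J \<le> max 0 (3 / 2 * ln d + 1)" unfolding J_def by (meson max.mono order_refl order_trans)
      then have "real J \<le> 3 / 2 * ln d + 1" using ld by simp
      then have "Q J \<le> 8 * ln d" unfolding Q4 using ld by linarith
      then have "Q J * eta q (R t) \<le> 8 * ln d * (\<delta> * d / (8 * ln d))"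
        using 1 Q0 eta0 ld by (intro mult_mono) auto
      also have "\<dots> = \<delta> * h\<^sup>2" using ld by (simp add: dd)
      finally show ?case using 2 unfolding R_def Q_def d_def h_def J_def by blast
    qed
  qed
qed

subsection \<open>The exceptional set\<close>

text \<open>x - (y/t) ln x increases for x >= y/t, so it is at least its value at B a, where the
  cost takes at most half of the height.\<close>

lemma value_ge_of_big:
  assumes pos: "0 < t" "0 < (a::real)" "0 < B" and x: "B * a < x" and y: "0 \<le> y" "y / t \<le> B * a" "y / t * ln (B * a) \<le> B * a / 2"
  shows "B / 2 * a \<le> x - y / t * ln x"
proof -
  have Ba: "0 < B * a" using pos by simp
  have x0: "0 < x" using x Ba by linarith
  have "ln x - ln (B * a) = ln (x / (B * a))" using x0 pos by (simp add: ln_div)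
  also have "\<dots> \<le> x / (B * a) - 1" using x Ba by (intro ln_le_minus_one divide_pos_pos) auto
  finally have lx: "ln x - ln (B * a) \<le> x / (B * a) - 1" .
  have "ln (B * a) \<le> ln x" using x Ba by simp
  then have "y / t * (ln x - ln (B * a)) \<le> (B * a) * (x / (B * a) - 1)"
    by (intro mult_mono y(2) lx less_imp_le[OF Ba]) simp
  also have "\<dots> = x - B * a" using Ba pos by (simp add: right_diff_distrib)
  finally have "y / t * ln x - y / t * ln (B * a) \<le> x - B * a" by (simp add: right_diff_distrib)
  then show ?thesis using y(3) by simp
qed

lemma abs_minus_one_le:
  assumes "0 < x" "\<bar>ln x\<bar> \<le> ln (1 + e)" "0 < e"
  shows "\<bar>x - 1\<bar> \<le> (e::real)"
proof -
  have "ln x \<le> ln (1 + e)" using assms(2) by linarith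
  then have 1: "x \<le> 1 + e" using assms by simp
  have "ln (1 / (1 + e)) \<le> ln x" using assms by (simp add: ln_div)
  then have "1 / (1 + e) \<le> x" using assms by (subst (asm) ln_le_cancel_iff) auto
  moreover have "1 - e \<le> 1 / (1 + e)"
  proof -
    have "(1 - e) * (1 + e) \<le> 1" by (simp add: algebra_simps)
    then show ?thesis using assms(3) by (subst pos_le_divide_eq) auto
  qed
  ultimately show ?thesis using 1 by linarith
qed

lemma ex_ge_tendsto_0:
  fixes f :: "real \<Rightarrow> real"
  assumes "(f \<longlongrightarrow> 0) at_top" "0 < \<delta>"
  shows "\<exists>x\<ge>x0. f x \<le> \<delta>"
proof -
  have "\<forall>\<^sub>F x in at_top. x0 \<le> x \<and> f x < \<delta>"
    by (intro eventually_conj eventually_ge_at_top order_tendstoD(2)[OF assms])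
  from eventually_happens'[OF trivial_limit_at_top_linorder this] show ?thesis by (meson less_imp_le)
qed

lemma ex_less_tendsto_0:
  fixes f :: "real \<Rightarrow> real"
  assumes "(f \<longlongrightarrow> 0) (at_right 0)" "0 < \<delta>" "0 < x0"
  shows "\<exists>x. 0 < x \<and> x < x0 \<and> f x \<le> \<delta>"
proof -
  have "\<forall>\<^sub>F x in at_right 0. x \<in> {0<..<x0} \<and> f x < \<delta>"
    by (intro eventually_conj eventually_at_right_real order_tendstoD(2)[OF assms(1)] assms)
  from eventually_happens'[OF trivial_limit_at_right_real this] show ?thesis by (auto intro: less_imp_le)
qed

lemma half_le_nat_floor: "2 \<le> x \<Longrightarrow> x / 2 \<le> real (nat \<lfloor>x\<rfloor>)"
  by linarith

lemma powr_neg_scale: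
  fixes \<alpha> :: real
  assumes "0 < x" "0 < a" "r = a powr \<alpha>"
  shows "(x * a) powr (- \<alpha>) = x powr (- \<alpha>) / r"
  using assms by (simp add: powr_mult powr_minus divide_inverse)

lemma le_int_nat_floor: "0 \<le> x \<Longrightarrow> k \<le> int (nat \<lfloor>x\<rfloor>) \<longleftrightarrow> real_of_int k \<le> x"
  by (simp add: le_floor_iff)

context dup_field
begin

lemma pot_nonneg_site: "0 \<le> z \<Longrightarrow> pot w z = xi0 z w"
  by (simp add: pot_def potential_def)

lemma pot_cases: "pot w z = xi0 z w \<or> pot w z = xi0 (- z) w"
  by (simp add: pot_def potential_def)

lemma pot_coin: "coin (nat \<bar>z\<bar>) w \<Longrightarrow> pot w (- z) = pot w z"
  by (cases "0 \<le> z") (auto simp: pot_def potential_def abs_if)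

section \<open>Deterministic argument off the exceptional set\<close>

text \<open>The conditions G0 to G8 concern the independent variables. They pass to the potential
  because \<open>pot w z\<close> is always one of \<open>xi0 z w\<close> and
  \<open>xi0 (- z) w\<close>. Existence of a maximiser has to be proved as well, since the
  assumption on \<open>Z\<close> is conditional on it.\<close>

lemma good_realisation:
  fixes Z K L R R2 D1 S :: nat
  assumes pos: "0 < t" "0 < \<Lambda>" "0 < a" and r: "r = a * t / \<Lambda>"
    and C: "1 \<le> C" "0 < B" "c0 = B / 2" "0 < d1" "0 < d" "d < d1" "0 < \<beta>" "1 \<le> C'" "c = \<beta> / 8"
    and T: "c * \<Lambda> \<le> ln (a / \<Lambda>)" "1 < c0 * a" "\<beta> / 2 * \<Lambda> \<le> ln (c0 * a)" "C / c0 < \<Lambda>"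
      "1 \<le> K" "K \<le> L" "real L \<le> d * r" "d * r \<le> 2 * real L" "real L \<le> C * r"
      "w0 \<le> c0 * a / 2" "w0 \<le> d * \<beta> / 2 * a" "4 \<le> w0"
    and \<theta>: "\<theta> = d / (C + d)" "l' = ln (2 * C' * a)" "l = ln (d1 * a / (2 * exp 1 * \<Lambda>))"
      "0 \<le> l'" "(1 - \<theta>) * l' + 1 \<le> l" "(1 - \<theta> / 2) * l' + 2 \<le> l" "c * \<Lambda> + l' / 3 + 1 \<le> l"
    and sz: "S = nat \<lfloor>s * r\<rfloor>" "s \<le> C" "s / \<Lambda> \<le> B" "s / \<Lambda> * ln (B * a) \<le> B / 2"
      "D1 = nat \<lfloor>d1 * r\<rfloor>" "R = nat \<lfloor>C * r\<rfloor>" "R2 = nat \<lfloor>2 * C * r\<rfloor>"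
    and e: "0 < e" "3 * e = ln (1 + eps)" "2 * (2 / w0) ^ (2 * K - 1) * t \<le> e" "2 * exp (- real L) \<le> e" "0 < eps"
    and G0: "\<And>z. 1 < xi0 z w"
    and G1: "\<exists>y\<in>{1..S}. B * a < xi0 (int y) w"
    and G2: "\<And>z. \<bar>z\<bar> \<le> int D1 \<Longrightarrow> xi0 z w \<le> c0 / 2 * a"
    and G3: "\<And>z. real R < real_of_int \<bar>z\<bar> \<Longrightarrow> xi0 z w \<le> c * \<Lambda> / t * real_of_int \<bar>z\<bar>"
    and G4: "\<And>z. \<bar>z\<bar> \<le> int R2 \<Longrightarrow> xi0 z w \<le> C' * a"
    and G5: "\<And>y z. \<bar>y\<bar> \<le> int R2 \<Longrightarrow> \<bar>z\<bar> \<le> int R2 \<Longrightarrow> \<bar>y\<bar> \<noteq> \<bar>z\<bar> \<Longrightarrow>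
        \<bar>\<bar>y\<bar> - \<bar>z\<bar>\<bar> \<le> 2 * int L \<Longrightarrow> c0 / 2 * a < xi0 y w \<Longrightarrow> xi0 z w \<le> c0 / 2 * a"
    and G6: "\<And>y z. 1 \<le> y \<Longrightarrow> y \<le> R2 \<Longrightarrow> \<bar>z\<bar> \<le> int R2 \<Longrightarrow> \<bar>\<bar>z\<bar> - int y\<bar> < int K \<Longrightarrow>
        c0 / 2 * a < xi0 z w \<Longrightarrow> coin y w"
    and G8: "\<And>n. L < n \<Longrightarrow> n \<le> R \<Longrightarrow> cfg w \<notin> fluct_event (int n) K L w0 e t (c0 / 2 * a) (C' * a)"
    and Z: "(\<exists>z\<in>Dset (pot w). \<forall>y\<in>Dset (pot w). Psi (pot w) t (int y) \<le> Psi (pot w) t (int z)) \<longrightarrow>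
       Z \<in> Dset (pot w) \<and> (\<forall>y\<in>Dset (pot w). Psi (pot w) t (int y) \<le> Psi (pot w) t (int Z))"
  shows "\<bar>pam_u (pot w) t (int Z) / pam_u (pot w) t (- int Z) - 1\<bar> \<le> eps"
proof -
  let ?V = "pot w"
  have r0: "0 < r" using pos r by simp
  have c0: "0 < c0" using C by simp
  have Cr: "0 < C * r" using C r0 by simp
  have big_eq: "\<bar>z\<bar> \<le> int R2 \<longleftrightarrow> real_of_int \<bar>z\<bar> \<le> 2 * C * r" for z
    unfolding sz(7) using Cr by (intro le_int_nat_floor) simp
  have H0: "1 < ?V z" for z using pot_cases[of w z] G0[of z] G0[of "- z"] by (elim disjE) simp_all
  have H0': "1 \<le> ?V z" for z using H0[of z] by simp
  have H2: "?V z < c0 * a" if "real_of_int \<bar>z\<bar> \<le> d1 * r" for z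
  proof -
    have "0 \<le> d1 * r" using C r0 by simp
    then have "\<bar>z\<bar> \<le> int D1" unfolding sz(5) using that by (simp only: le_int_nat_floor)
    then have "xi0 z w \<le> c0 / 2 * a" "xi0 (- z) w \<le> c0 / 2 * a" using G2[of z] G2[of "- z"] by auto
    moreover have "c0 / 2 * a < c0 * a" using c0 pos by simp
    ultimately show ?thesis using pot_cases[of w z] by (elim disjE) linarith+
  qed
  have H3: "?V z \<le> c * real_of_int \<bar>z\<bar> * \<Lambda> / t" if "C * r < real_of_int \<bar>z\<bar>" for z
  proof -
    have "real R < real_of_int \<bar>z\<bar>" unfolding sz(6) using that Cr by linarith
    then have "xi0 z w \<le> c * \<Lambda> / t * real_of_int \<bar>z\<bar>" "xi0 (- z) w \<le> c * \<Lambda> / t * real_of_int \<bar>z\<bar>"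
      using G3[of z] G3[of "- z"] by auto
    then have "?V z \<le> c * \<Lambda> / t * real_of_int \<bar>z\<bar>" using pot_cases[of w z] by (elim disjE) simp_all
    then show ?thesis by (simp add: mult_ac)
  qed
  have H4: "?V z \<le> C' * a" if "real_of_int \<bar>z\<bar> \<le> 2 * C * r" for z
    using that pot_cases[of w z] G4[of z] G4[of "- z"] unfolding big_eq[symmetric] by (elim disjE) simp_all
  have big: "\<exists>z'. \<bar>z'\<bar> = \<bar>z\<bar> \<and> x < xi0 z' w" if "x < ?V z" for z x
    using pot_cases[of w z]
  proof
    assume "?V z = xi0 (- z) w"
    then show ?thesis using that by (intro exI[of _ "- z"]) simp
  next
    assume "?V z = xi0 z w"
    then show ?thesis using that by (intro exI[of _ z]) simp
  qed
  have H5: "?V z \<le> c0 / 2 * a" if "real_of_int \<bar>y\<bar> \<le> 2 * C * r" "real_of_int \<bar>z\<bar> \<le> 2 * C * r" "\<bar>y\<bar> \<noteq> \<bar>z\<bar>"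
        "\<bar>\<bar>y\<bar> - \<bar>z\<bar>\<bar> \<le> 2 * int L" "c0 / 2 * a < ?V y" for y z
  proof (rule ccontr)
    assume "\<not> ?V z \<le> c0 / 2 * a"
    then have "c0 / 2 * a < ?V z" by simp
    from big[OF this] obtain z' where z': "\<bar>z'\<bar> = \<bar>z\<bar>" "c0 / 2 * a < xi0 z' w" by auto
    from big[OF that(5)] obtain y' where y': "\<bar>y'\<bar> = \<bar>y\<bar>" "c0 / 2 * a < xi0 y' w" by auto
    show False using G5[of y' z'] z' y' that(1-4) unfolding big_eq[symmetric] by force
  qed
  have H6: "?V (- z) = ?V z" if "real_of_int \<bar>y\<bar> \<le> 2 * C * r" "real_of_int \<bar>z\<bar> \<le> 2 * C * r"
        "\<bar>\<bar>y\<bar> - \<bar>z\<bar>\<bar> < int K" "c0 / 2 * a < ?V y" for y z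
  proof (cases "z = 0")
    case False
    from big[OF that(4)] obtain y' where y': "\<bar>y'\<bar> = \<bar>y\<bar>" "c0 / 2 * a < xi0 y' w" by auto
    have "coin (nat \<bar>z\<bar>) w"
      using G6[of "nat \<bar>z\<bar>" y'] y' that(1-3) False unfolding big_eq[symmetric] by auto
    then show ?thesis by (rule pot_coin)
  qed simp
  \<comment> \<open>A high site near 0, duplicated by H6 applied to itself; its score bounds the
    maximum from below.\<close>
  obtain y0 where y0: "1 \<le> y0" "y0 \<le> S" "B * a < xi0 (int y0) w" using G1 by auto
  have "int y0 \<le> \<lfloor>s * r\<rfloor>" using y0(1,2) unfolding sz(1) by linarith
  then have y0s: "real y0 \<le> s * r" by (simp add: le_floor_iff)
  have y0C: "real y0 \<le> C * r" using y0s sz(2) mult_right_mono[OF sz(2), of r] r0 by linarith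
  have Vy0: "B * a < ?V (int y0)" using y0 by (simp add: pot_nonneg_site)
  have c0B: "c0 / 2 * a < B * a" using C pos by simp
  have y0D: "y0 \<in> Dset ?V"
    using H6[of "int y0" "int y0"] y0C Cr Vy0 c0B T(5) by (simp add: Dset_def)
  have Psi0: "c0 * a \<le> Psi ?V t (int y0)"
  proof -
    have yt: "real y0 / t \<le> s / \<Lambda> * a"
    proof -
      have "real y0 / t \<le> s * r / t" using y0s pos by (intro divide_right_mono) auto
      also have "\<dots> = s / \<Lambda> * a" using pos by (simp add: r)
      finally show ?thesis .
    qed
    have lBa: "0 \<le> ln (B * a)" using T(2) C pos by (intro ln_ge_zero) (simp add: field_simps)
    have "B / 2 * a \<le> ?V (int y0) - real y0 / t * ln (?V (int y0))"
    proof (rule value_ge_of_big)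
      show "real y0 / t \<le> B * a" using yt mult_right_mono[OF sz(3), of a] pos by linarith
      have "real y0 / t * ln (B * a) \<le> s / \<Lambda> * a * ln (B * a)" using yt lBa by (intro mult_right_mono)
      also have "\<dots> = (s / \<Lambda> * ln (B * a)) * a" by (simp only: mult_ac)
      also have "\<dots> \<le> B / 2 * a" using sz(4) pos by (intro mult_right_mono) auto
      finally show "real y0 / t * ln (B * a) \<le> B * a / 2" by simp
    qed (use pos C Vy0 in auto)
    then show ?thesis unfolding C(3) by (simp add: Psi_def)
  qed
  have far: "Psi ?V t (int y) \<le> 1" if "C * r < real y" for y
  proof -
    have "a * t / \<Lambda> \<le> real y" using mult_right_mono[OF C(1), of r] r0 that unfolding r by simp
    then have "?V (int y) - real y / t * ln (?V (int y)) \<le> 1"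
      using that H3[of "int y"] by (intro far_value_le_one[OF pos _ H0' _ T(1)]) auto
    then show ?thesis by (simp add: Psi_def)
  qed
  \<comment> \<open>Beyond C r scores are at most 1, below that of \<open>y0\<close>, so the maximum
    over the finitely many closer sites is global.\<close>
  have ex: "\<exists>z\<in>Dset ?V. \<forall>y\<in>Dset ?V. Psi ?V t (int y) \<le> Psi ?V t (int z)"
  proof -
    define F where "F = {y \<in> Dset ?V. real y \<le> C * r}"
    have "F \<subseteq> {..nat \<lfloor>C * r\<rfloor>}" unfolding F_def by (auto simp: le_nat_floor)
    then have fin: "finite F" by (rule finite_subset) simp
    have y0F: "y0 \<in> F" using y0D y0C by (simp add: F_def)
    have "Max ((\<lambda>y. Psi ?V t (int y)) ` F) \<in> (\<lambda>y. Psi ?V t (int y)) ` F"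
      using fin y0F by (intro Max_in) auto
    then obtain z where z1: "z \<in> F" "Max ((\<lambda>y. Psi ?V t (int y)) ` F) = Psi ?V t (int z)" by auto
    have z: "z \<in> F" "\<And>y. y \<in> F \<Longrightarrow> Psi ?V t (int y) \<le> Psi ?V t (int z)"
      using z1(1) fin unfolding z1(2)[symmetric] by auto
    have "Psi ?V t (int y) \<le> Psi ?V t (int z)" if "y \<in> Dset ?V" for y
    proof (cases "real y \<le> C * r")
      case True then show ?thesis using that z(2) by (simp add: F_def)
    next
      case False
      then have "Psi ?V t (int y) \<le> 1" by (intro far) simp
      also have "1 \<le> Psi ?V t (int z)" using Psi0 T(2) z(2)[OF y0F] by linarith
      finally show ?thesis .
    qed
    then show ?thesis using z(1) by (auto simp: F_def)
  qed
  have ZD: "Z \<in> Dset ?V" and Zmax: "\<And>y. y \<in> Dset ?V \<Longrightarrow> Psi ?V t (int y) \<le> Psi ?V t (int Z)"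
    using Z ex by auto
  have H1: "\<exists>y\<in>Dset ?V. c0 * a \<le> Psi ?V t (int y)" using y0D Psi0 by blast
  note mp = max_point_props[where V = "pot w" and n = Z and t = t and \<Lambda> = \<Lambda> and a = a and r = r and C = C
      and ?c0.0 = c0 and ?d1.0 = d1 and d = d and \<beta> = \<beta> and c = c and K = K and L = L and w = w0]
  have big_Z: "c0 * a \<le> ?V (int Z)" by (rule mp(1); fact)
  have Zd1: "d1 * r < real Z" by (rule mp(2); fact)
  have ZC: "real Z \<le> C * r" by (rule mp(3); fact)
  have gp: "gap ?V (int Z) K L w0" by (rule mp(4); fact)
  have Zt: "real Z \<le> ?V (int Z) * t" by (rule mp(5); fact)
  have P: "?V b - real_of_int \<bar>b\<bar> / t * ln (?V b) \<le> ?V (int Z) - real Z / t * ln (?V (int Z))"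
    if "real_of_int \<bar>b\<bar> \<le> 2 * C * r" "c0 / 2 * a < ?V b" for b by (rule mp(6); fact)
  have L0: "0 < L" using T(5,6) by simp
  have c_nn: "0 \<le> c" using C by simp
  have w_nn: "0 \<le> w0" using T(12) by simp
  have cr1: "crude ?V (int Z) L t"
    by (rule crudeI[where V = "pot w" and n = Z and t = t and \<Lambda> = \<Lambda> and a = a and r = r and C = C
      and ?c0.0 = c0 and ?d1.0 = d1 and d = d and C' = C' and c = c and L = L and w = w0 and \<theta> = \<theta> and l' = l' and l = l]; fact)
  have Veq: "?V (- int Z) = ?V (int Z)" using gp by (simp add: gap_def)
  have cr2: "crude (\<lambda>b. ?V (- b)) (int Z) L t"
  proof (rule crudeI[where V = "\<lambda>b. pot w (- b)" and n = Z and t = t and \<Lambda> = \<Lambda> and a = a and r = r and C = C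
      and ?c0.0 = c0 and ?d1.0 = d1 and d = d and C' = C' and c = c and L = L and w = w0 and \<theta> = \<theta> and l' = l' and l = l])
    show "gap (\<lambda>b. ?V (- b)) (int Z) K L w0" by (rule gap_reflect[OF gp])
    show "?V (- b) - real_of_int \<bar>b\<bar> / t * ln (?V (- b)) \<le> ?V (- int Z) - real Z / t * ln (?V (- int Z))"
      if "real_of_int \<bar>b\<bar> \<le> 2 * C * r" "c0 / 2 * a < ?V (- b)" for b using P[of "- b"] that unfolding Veq by simp
    show "?V (- z) \<le> c * real_of_int \<bar>z\<bar> * \<Lambda> / t" if "C * r < real_of_int \<bar>z\<bar>" for z using H3[of "- z"] that by simp
    show "?V (- z) \<le> C' * a" if "real_of_int \<bar>z\<bar> \<le> 2 * C * r" for z using H4[of "- z"] that by simp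
    show "c0 * a \<le> ?V (- int Z)" using big_Z by (simp only: Veq)
    show "1 \<le> ?V (- z)" for z by (rule H0')
  qed fact+
  have LZ: "L < Z"
  proof -
    have "real L < d1 * r" using T(7) C(6) r0 mult_strict_right_mono[OF C(6) r0] by linarith
    then show ?thesis using Zd1 by linarith
  qed
  have ZR: "Z \<le> R" unfolding sz(6) using ZC by (simp add: le_nat_floor)
  have fl: "\<bar>log_passage ?V (int Z) K L t - log_passage (\<lambda>b. ?V (- b)) (int Z) K L t\<bar> \<le> e"
  proof -
    have "?V (int Z) \<le> C' * a" using H4[of "int Z"] ZC Cr by simp
    moreover have "c0 / 2 * a < ?V (int Z)"
    proof -
      have "c0 / 2 * a < c0 * a" using c0 pos by simp
      then show ?thesis using big_Z by linarith
    qed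
    ultimately show ?thesis using G8[OF LZ ZR] H0 gp unfolding fluct_event_def by (auto simp: cfg_pot_cfg not_less)
  qed
  have ratio: "0 < pam_u ?V t (int Z)" "0 < pam_u ?V t (- int Z)"
    "\<bar>ln (pam_u ?V t (int Z) / pam_u ?V t (- int Z))\<bar> \<le> e + 2 * (2 / w0) ^ (2 * K - 1) * t + 2 * exp (- real (nat (int Z) + 2 * L))"
    using pam_u_log_ratio[OF gp _ _ T(6,5,12) _ pos(1) cr1 cr2 fl] LZ Zt by auto
  have "exp (- real (nat (int Z) + 2 * L)) \<le> exp (- real L)" by simp
  then have "\<bar>ln (pam_u ?V t (int Z) / pam_u ?V t (- int Z))\<bar> \<le> ln (1 + eps)"
    using ratio(3) e(2-4) by linarith
  then show ?thesis using ratio(1,2) e(5) by (intro abs_minus_one_le) auto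
qed

section \<open>Probabilities of the exceptional events at the scales of the maximiser\<close>

text \<open>About s r sites exceed B a with probability B^(-\<alpha>)/r each, which makes
  \<open>b\<close> of them on average. The half pays for rounding.\<close>

lemma prob_no_near_big:
  assumes a: "0 < a" "r = a powr \<alpha>" and B: "0 < B" "1 \<le> B * a" and s: "s = b * B powr \<alpha>" "2 \<le> s * r"
  shows "prob {w \<in> space M. \<forall>y\<in>{1..nat \<lfloor>s * r\<rfloor>}. xi0 (int y) w \<le> B * a} \<le> exp (- b / 2)"
proof -
  have r0: "0 < r" using a by simp
  have "b / 2 = s * r / 2 * (B powr (- \<alpha>) / r)"
  proof -
    have "B powr \<alpha> * B powr (- \<alpha>) = 1" using B by (simp add: powr_add[symmetric])
    then have "s * B powr (- \<alpha>) = b" by (simp only: s mult.assoc mult_1_right)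
    then show ?thesis using r0 by (simp add: mult_ac)
  qed
  also have "\<dots> \<le> real (nat \<lfloor>s * r\<rfloor>) * (B powr (- \<alpha>) / r)"
    using half_le_nat_floor[OF s(2)] r0 by (intro mult_right_mono) auto
  also have "\<dots> = real (nat \<lfloor>s * r\<rfloor>) * (B * a) powr (- \<alpha>)"
    by (simp only: powr_neg_scale[OF B(1) a])
  finally have "b / 2 \<le> real (nat \<lfloor>s * r\<rfloor>) * (B * a) powr (- \<alpha>)" .
  then have "exp (- (real (nat \<lfloor>s * r\<rfloor>) * (B * a) powr (- \<alpha>))) \<le> exp (- b / 2)" by (simp only: exp_le_cancel_iff minus_divide_left[symmetric] neg_le_iff_le)
  then show ?thesis by (rule order_trans[OF prob_all_small[OF B(2)]])
qed

text \<open>The interval has 2 D + 1 sites; the summand \<open>k\<close> pays for the one in the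
  middle.\<close>

lemma prob_big_in_interval:
  assumes a: "0 < a" "r = a powr \<alpha>" and x: "0 < x" "1 \<le> x * a" and d: "0 \<le> d" "1 \<le> k * d * r" "0 \<le> k"
  shows "prob {w \<in> space M. \<exists>z\<in>{- int (nat \<lfloor>d * r\<rfloor>)..int (nat \<lfloor>d * r\<rfloor>)}. x * a < xi0 z w} \<le> (2 + k) * d * x powr (- \<alpha>)"
proof -
  let ?D = "nat \<lfloor>d * r\<rfloor>"
  have r0: "0 < r" using a by simp
  have "0 \<le> d * r" using d r0 by simp
  then have D: "real ?D \<le> d * r" by linarith
  have "real (card {- int ?D..int ?D}) = 2 * real ?D + 1" by simp
  also have "\<dots> \<le> (2 + k) * d * r" using D d(2) by (simp add: algebra_simps)
  finally have c: "real (card {- int ?D..int ?D}) \<le> (2 + k) * d * r" .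
  have "prob {w \<in> space M. \<exists>z\<in>{- int ?D..int ?D}. x * a < xi0 z w} \<le> real (card {- int ?D..int ?D}) * (x * a) powr (- \<alpha>)"
    using x by (intro prob_some_big) auto
  also have "\<dots> \<le> (2 + k) * d * r * (x * a) powr (- \<alpha>)" using c by (intro mult_right_mono) auto
  also have "\<dots> = (2 + k) * d * x powr (- \<alpha>)"
    using r0 unfolding powr_neg_scale[OF x(1) a] by simp
  finally show ?thesis .
qed

text \<open>\<open>l\<close> stands for t / ln t. Its power and that of \<open>r\<close> cancel, so
  the bound depends on \<open>c\<close> and \<open>C\<close> alone and vanishes as \<open>C\<close>
  grows.\<close>

lemma prob_far_big_scale:
  assumes a: "0 < a" "0 < l" "r = a * l" "r powr (\<alpha> - 1) = l powr \<alpha>" and c: "0 < c" and C: "0 < C" "2 \<le> C * r" "2 \<le> c * C * a"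
  shows "{w \<in> space M. \<exists>z. real (nat \<lfloor>C * r\<rfloor>) < real_of_int \<bar>z\<bar> \<and> c / l * real_of_int \<bar>z\<bar> < xi0 z w} \<in> events"
    "prob {w \<in> space M. \<exists>z. real (nat \<lfloor>C * r\<rfloor>) < real_of_int \<bar>z\<bar> \<and> c / l * real_of_int \<bar>z\<bar> < xi0 z w} \<le> 2 * c powr (- \<alpha>) * (C / 2) powr (1 - \<alpha>)"
proof -
  let ?R = "nat \<lfloor>C * r\<rfloor>"
  have r0: "0 < r" using a by simp
  have R: "C * r / 2 \<le> real ?R" by (rule half_le_nat_floor[OF C(2)])
  have R1: "1 \<le> ?R" using R C(2) by linarith
  have k: "0 < c / l" using a c by simp
  have "1 \<le> c / l * (C * r / 2)" using a c C by (simp add: mult_ac)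
  also have "\<dots> \<le> c / l * real ?R" using R k by (intro mult_left_mono) auto
  finally have kR: "1 \<le> c / l * real ?R" .
  show "{w \<in> space M. \<exists>z. real ?R < real_of_int \<bar>z\<bar> \<and> c / l * real_of_int \<bar>z\<bar> < xi0 z w} \<in> events"
    by (rule prob_far_big(1)[OF R1 k kR])
  have "prob {w \<in> space M. \<exists>z. real ?R < real_of_int \<bar>z\<bar> \<and> c / l * real_of_int \<bar>z\<bar> < xi0 z w}
    \<le> 2 * (c / l) powr (- \<alpha>) * real ?R powr (1 - \<alpha>)" by (rule prob_far_big(2)[OF R1 k kR])
  also have "\<dots> \<le> 2 * (c / l) powr (- \<alpha>) * (C / 2 * r) powr (1 - \<alpha>)"
    using R C r0 alpha by (intro mult_left_mono powr_mono2') auto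
  also have "(c / l) powr (- \<alpha>) = c powr (- \<alpha>) * r powr (\<alpha> - 1)"
    unfolding a(4) using c a(2) powr_divide[of c l "- \<alpha>"] by (simp add: powr_minus field_simps)
  also have "2 * (c powr (- \<alpha>) * r powr (\<alpha> - 1)) * (C / 2 * r) powr (1 - \<alpha>)
    = 2 * c powr (- \<alpha>) * (C / 2) powr (1 - \<alpha>) * (r powr (\<alpha> - 1) * r powr (1 - \<alpha>))"
    using C r0 by (simp only: powr_mult mult_ac)
  also have "r powr (\<alpha> - 1) * r powr (1 - \<alpha>) = 1" using r0 by (simp add: powr_add[symmetric])
  finally show "prob {w \<in> space M. \<exists>z. real ?R < real_of_int \<bar>z\<bar> \<and> c / l * real_of_int \<bar>z\<bar> < xi0 z w} \<le> 2 * c powr (- \<alpha>) * (C / 2) powr (1 - \<alpha>)" by simp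
qed

text \<open>For given \<open>y\<close>, the admissible \<open>z\<close> lie in two intervals of 4 L
  + 1 integers around |y| and - |y|.\<close>

lemma card_pairs_le:
  fixes R L :: nat
  defines "F \<equiv> {(y, z). \<bar>y\<bar> \<le> int R \<and> \<bar>z\<bar> \<le> int R \<and> \<bar>y\<bar> \<noteq> \<bar>z\<bar> \<and> \<bar>\<bar>y\<bar> - \<bar>z\<bar>\<bar> \<le> 2 * int L}"
  shows "finite F" "card F \<le> (2 * R + 1) * (2 * (4 * L + 1))"
proof -
  define G where "G y = {\<bar>y\<bar> - 2 * int L..\<bar>y\<bar> + 2 * int L} \<union> {- \<bar>y\<bar> - 2 * int L..- \<bar>y\<bar> + 2 * int L}" for y :: int
  have sub: "F \<subseteq> Sigma {- int R..int R} G" unfolding F_def G_def by auto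
  have finG: "finite (G y)" for y unfolding G_def by simp
  have fin: "finite (Sigma {- int R..int R} G)" using finG by (intro finite_SigmaI) auto
  then show "finite F" using sub by (rule finite_subset[rotated])
  have cG: "card (G y) \<le> 2 * (4 * L + 1)" for y
    unfolding G_def by (rule order_trans[OF card_Un_le]) simp
  have "card F \<le> card (Sigma {- int R..int R} G)" by (rule card_mono[OF fin sub])
  also have "\<dots> = (\<Sum>y\<in>{- int R..int R}. card (G y))" using finG by (intro card_SigmaI) auto
  also have "\<dots> \<le> (\<Sum>y\<in>{- int R..int R}. 2 * (4 * L + 1))" by (intro sum_mono cG)
  also have "\<dots> = card {- int R..int R} * (2 * (4 * L + 1))" by (simp only: sum_constant of_nat_id)
  also have "card {- int R..int R} = 2 * R + 1" by simp
  finally show "card F \<le> (2 * R + 1) * (2 * (4 * L + 1))" .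
qed

text \<open>O(r) times O(d r) pairs, each of probability O(1/r^2): proportional to \<open>d\<close>,
  hence small when the window is narrow.\<close>

lemma prob_big_pair_scale:
  assumes a: "0 < a" "r = a powr \<alpha>" and x: "0 < x" "1 \<le> x * a" and C: "0 < C" "0 < d" "1 \<le> C * r" "1 \<le> d * r"
    and F: "F = {(y, z). \<bar>y\<bar> \<le> int (nat \<lfloor>2 * C * r\<rfloor>) \<and> \<bar>z\<bar> \<le> int (nat \<lfloor>2 * C * r\<rfloor>) \<and> \<bar>y\<bar> \<noteq> \<bar>z\<bar> \<and> \<bar>\<bar>y\<bar> - \<bar>z\<bar>\<bar> \<le> 2 * int (nat \<lfloor>d * r\<rfloor>)}"
  shows "prob {w \<in> space M. \<exists>(y, z)\<in>F. x * a < xi0 y w \<and> x * a < xi0 z w} \<le> 50 * C * d * (x powr (- \<alpha>))\<^sup>2"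
proof -
  have r0: "0 < r" using a by simp
  note c = card_pairs_le[where R = "nat \<lfloor>2 * C * r\<rfloor>" and L = "nat \<lfloor>d * r\<rfloor>", folded F]
  have "real (card F) \<le> real ((2 * nat \<lfloor>2 * C * r\<rfloor> + 1) * (2 * (4 * nat \<lfloor>d * r\<rfloor> + 1)))"
    using c(2) by (simp only: of_nat_le_iff)
  also have "\<dots> = (2 * real (nat \<lfloor>2 * C * r\<rfloor>) + 1) * (2 * (4 * real (nat \<lfloor>d * r\<rfloor>) + 1))"
    by (simp only: of_nat_mult of_nat_add of_nat_1 of_nat_numeral)
  also have "\<dots> \<le> (5 * (C * r)) * (2 * (5 * (d * r)))"
  proof (rule mult_mono)
    have "real (nat \<lfloor>2 * C * r\<rfloor>) \<le> 2 * C * r" "real (nat \<lfloor>d * r\<rfloor>) \<le> d * r" using C by auto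
    then have "2 * real (nat \<lfloor>2 * C * r\<rfloor>) + 1 \<le> 5 * (C * r)" "4 * real (nat \<lfloor>d * r\<rfloor>) + 1 \<le> 5 * (d * r)"
      using C(3,4) by linarith+
    then show "2 * real (nat \<lfloor>2 * C * r\<rfloor>) + 1 \<le> 5 * (C * r)" "2 * (4 * real (nat \<lfloor>d * r\<rfloor>) + 1) \<le> 2 * (5 * (d * r))"
      by simp_all
  qed (use C r0 in auto)
  finally have "real (card F) \<le> 50 * C * d * r\<^sup>2" by (simp add: power2_eq_square mult_ac)
  then have "real (card F) * ((x * a) powr (- \<alpha>) * (x * a) powr (- \<alpha>)) \<le> 50 * C * d * r\<^sup>2 * ((x * a) powr (- \<alpha>) * (x * a) powr (- \<alpha>))"
    by (intro mult_right_mono) auto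
  also have "\<dots> = 50 * C * d * (x powr (- \<alpha>))\<^sup>2"
    using r0 unfolding powr_neg_scale[OF x(1) a] by (simp add: power2_eq_square)
  finally show ?thesis
    using prob_some_pair_big[OF x(2) c(1)] unfolding F by fastforce
qed

text \<open>Height at \<open>z\<close> and coin at \<open>y\<close> are independent, and the sites
  with modulus within \<open>K\<close> of \<open>y\<close> lie in two intervals of 2 K + 1
  integers.\<close>

lemma prob_big_near_unpaired:
  assumes x: "1 \<le> h"
  shows "prob {w \<in> space M. \<exists>y\<in>{1..R}. \<exists>z\<in>{z. \<bar>\<bar>z\<bar> - int y\<bar> < int K}. h < xi0 z w \<and> \<not> coin y w}
    \<le> real (4 * K + 2) * h powr (- \<alpha>) * eta (\<lambda>n. 1 - p n) R"
proof -
  define G where "G y = {z. \<bar>\<bar>z\<bar> - int y\<bar> < int K}" for y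
  have sub: "G y \<subseteq> {int y - int K..int y + int K} \<union> {- int y - int K..- int y + int K}" for y
    unfolding G_def by auto
  have fin: "finite (G y)" for y by (rule finite_subset[OF sub]) simp
  have card: "card (G y) \<le> 4 * K + 2" for y
  proof -
    have "card (G y) \<le> card ({int y - int K..int y + int K} \<union> {- int y - int K..- int y + int K})"
      by (rule card_mono[OF _ sub]) simp
    also have "\<dots> \<le> card {int y - int K..int y + int K} + card {- int y - int K..- int y + int K}"
      by (rule card_Un_le)
    also have "\<dots> = 4 * K + 2" by simp
    finally show ?thesis .
  qed
  have "prob {w \<in> space M. \<exists>y\<in>{1..R}. \<exists>z\<in>G y. h < xi0 z w \<and> \<not> coin y w}
    \<le> (\<Sum>y\<in>{1..R}. real (4 * K + 2) * h powr (- \<alpha>) * (1 - p y))"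
  proof (rule prob_union_le)
    fix y assume y: "y \<in> {1..R}"
    show "{w \<in> space M. \<exists>z\<in>G y. h < xi0 z w \<and> \<not> coin y w} \<in> events" by measurable
    have "prob {w \<in> space M. \<exists>z\<in>G y. h < xi0 z w \<and> \<not> coin y w} \<le> (\<Sum>z\<in>G y. h powr (- \<alpha>) * (1 - p y))"
    proof (rule prob_union_le[OF fin])
      fix z
      show "{w \<in> space M. h < xi0 z w \<and> \<not> coin y w} \<in> events" by measurable
      show "prob {w \<in> space M. h < xi0 z w \<and> \<not> coin y w} \<le> h powr (- \<alpha>) * (1 - p y)"
        using prob_big_coin[OF x, of y z] y by simp
    qed
    also have "\<dots> = real (card (G y)) * (h powr (- \<alpha>) * (1 - p y))" by simp
    also have "\<dots> \<le> real (4 * K + 2) * (h powr (- \<alpha>) * (1 - p y))"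
      using card p01(2)[of y] by (intro mult_right_mono of_nat_mono mult_nonneg_nonneg) simp_all
    finally show "prob {w \<in> space M. \<exists>z\<in>G y. h < xi0 z w \<and> \<not> coin y w} \<le> real (4 * K + 2) * h powr (- \<alpha>) * (1 - p y)"
      by (simp only: mult_ac)
  qed simp
  then show ?thesis unfolding G_def eta_def by (simp only: sum_distrib_left)
qed

lemma prob_fluct_union_le:
  fixes L K J R R' :: nat
  assumes n: "K \<le> L" "0 < L" "R + L \<le> R' + 1" and w: "4 \<le> w" and e: "0 < e" and t: "0 < t"
    and h: "1 \<le> h" and B: "B \<le> 2 ^ J"
  shows "{x \<in> space M. \<exists>n\<in>{L<..R}. cfg x \<in> fluct_event (int n) K L w e t h B} \<in> events"
    "prob {x \<in> space M. \<exists>n\<in>{L<..R}. cfg x \<in> fluct_event (int n) K L w e t h B}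
    \<le> real R * (32 / (w\<^sup>2 * e\<^sup>2) * h powr (- \<alpha>) * ((\<Sum>j<J. 4 ^ Suc j * (2 ^ j) powr (- \<alpha>)) * eta (\<lambda>n. 1 - p n) R'))"
proof -
  define Q where "Q = (\<Sum>j<J. 4 ^ Suc j * (2 ^ j) powr (- \<alpha>))"
  define c where "c = 32 / (w\<^sup>2 * e\<^sup>2) * h powr (- \<alpha>) * Q"
  have c0: "0 \<le> c" unfolding c_def Q_def by (intro mult_nonneg_nonneg sum_nonneg) auto
  have m: "{x \<in> space M. cfg x \<in> fluct_event (int n) K L w e t h B} \<in> events" for n
  proof -
    have "cfg \<in> measurable M (PiM UNIV (\<lambda>_. borel))"
      by (rule measurable_PiM_single') (auto simp: space_PiM)
    from measurable_sets[OF this fluct_event_sets] show ?thesis by (simp add: vimage_def Int_def conj_commute)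
  qed
  have "{x \<in> space M. \<exists>n\<in>{L<..R}. cfg x \<in> fluct_event (int n) K L w e t h B}
    = (\<Union>n\<in>{L<..R}. {x \<in> space M. cfg x \<in> fluct_event (int n) K L w e t h B})" by auto
  then show "{x \<in> space M. \<exists>n\<in>{L<..R}. cfg x \<in> fluct_event (int n) K L w e t h B} \<in> events"
    using m by auto
  have "prob {x \<in> space M. \<exists>n\<in>{L<..R}. cfg x \<in> fluct_event (int n) K L w e t h B}
    \<le> (\<Sum>n\<in>{L<..R}. c * eta (\<lambda>n. 1 - p n) R')"
  proof (rule prob_union_le)
    fix i assume i: "i \<in> {L<..R}"
    have "prob {x \<in> space M. cfg x \<in> fluct_event (int i) K L w e t h B} \<le> c * (\<Sum>y\<in>{1..<i + L}. 1 - p y)"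
      unfolding c_def Q_def by (rule prob_fluct_event_le) (use i n w e t h B in auto)
    also have "\<dots> \<le> c * (\<Sum>y\<in>{1..R'}. 1 - p y)"
      using c0 p01 i n by (intro mult_left_mono sum_mono2) auto
    finally show "prob {x \<in> space M. cfg x \<in> fluct_event (int i) K L w e t h B} \<le> c * eta (\<lambda>n. 1 - p n) R'"
      by (simp add: eta_def)
  qed (auto simp: m)
  also have "\<dots> = real (R - L) * (c * eta (\<lambda>n. 1 - p n) R')" by simp
  also have "\<dots> \<le> real R * (c * eta (\<lambda>n. 1 - p n) R')"
    using c0 p01 by (intro mult_right_mono) (auto simp: eta_def intro!: mult_nonneg_nonneg sum_nonneg)
  finally show "prob {x \<in> space M. \<exists>n\<in>{L<..R}. cfg x \<in> fluct_event (int n) K L w e t h B}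
    \<le> real R * (32 / (w\<^sup>2 * e\<^sup>2) * h powr (- \<alpha>) * ((\<Sum>j<J. 4 ^ Suc j * (2 ^ j) powr (- \<alpha>)) * eta (\<lambda>n. 1 - p n) R'))"
    by (simp only: c_def Q_def mult.assoc)
qed

section \<open>Choice of the constants\<close>

text \<open>The order of choice matters: \<open>b\<close>, \<open>B\<close> and \<open>s\<close>
  provide a high site near 0, then \<open>C\<close> controls the far field, \<open>C'\<close> the
  heights up to 2 C r, \<open>d1\<close> the surroundings of 0, \<open>d\<close> the separation of
  high sites. The bound \<open>x\<close> for \<eta> comes last, since it depends on all of these.
  Seven events receive eps'/8 each; \<open>A0\<close> is null.\<close>

lemma eventually_small_exceptional_set:
  assumes o: "eta (\<lambda>n. 1 - p n) \<in> o(kappa \<alpha>)" and eps: "0 < eps" and eps': "0 < eps'"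
  shows "\<forall>\<^sub>F t in at_top. \<exists>A\<in>events. prob A \<le> eps' \<and> (\<forall>w\<in>space M - A. \<forall>Z.
    ((\<exists>z\<in>Dset (pot w). \<forall>y\<in>Dset (pot w). Psi (pot w) t (int y) \<le> Psi (pot w) t (int z)) \<longrightarrow>
       Z \<in> Dset (pot w) \<and> (\<forall>y\<in>Dset (pot w). Psi (pot w) t (int y) \<le> Psi (pot w) t (int Z))) \<longrightarrow>
    \<bar>pam_u (pot w) t (int Z) / pam_u (pot w) t (- int Z) - 1\<bar> \<le> eps)"
proof -
  define \<delta> where "\<delta> = eps' / 8"
  have \<delta>: "0 < \<delta>" using eps' by (simp add: \<delta>_def)
  have \<alpha>0: "0 < \<alpha>" "0 < \<alpha> - 1" "0 < 1 - 1 / \<alpha>" using alpha by auto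
  define \<beta> where "\<beta> = 1 / (\<alpha> - 1)"
  have \<beta>: "0 < \<beta>" using alpha by (simp add: \<beta>_def)
  define c where "c = \<beta> / 8"
  have c: "0 < c" using \<beta> by (simp add: c_def)
  define e where "e = ln (1 + eps) / 3"
  have e: "0 < e" using eps by (simp add: e_def)
  \<comment> \<open>Makes 2 K - 1 >= \<alpha> + 1, so a^(2 K - 1) is at least a r, hence at least a
    t for large t, and the loop error (2 / w0)^(2 K - 1) t is O(1/a).\<close>
  define K where "K = nat \<lceil>\<alpha>\<rceil>"
  have K: "\<alpha> \<le> real K" "1 \<le> K" using alpha unfolding K_def by linarith+
  have "((\<lambda>b::real. exp (- b / 2)) \<longlongrightarrow> 0) at_top" by real_asymp
  from ex_ge_tendsto_0[OF this \<delta>, of 1] obtain b where b: "1 \<le> b" "exp (- b / 2) \<le> \<delta>" by auto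
  \<comment> \<open>Since \<alpha> > 1, the range s = b B^\<alpha> to be searched shrinks faster
    than \<open>B\<close>. For small \<open>B\<close> the distance cost of the high site is then at
    most half of B a.\<close>
  have "((\<lambda>B::real. 4 * \<beta> * b * B powr (\<alpha> - 1)) \<longlongrightarrow> 0) (at_right 0)"
    using \<alpha>0 by real_asymp
  from ex_less_tendsto_0[OF this zero_less_one zero_less_one]
  obtain B where B: "0 < B" "4 * \<beta> * b * B powr (\<alpha> - 1) \<le> 1" by auto
  define s where "s = b * B powr \<alpha>"
  have s: "0 < s" using b B by (simp add: s_def)
  have sB: "4 * \<beta> * s \<le> B"
  proof -
    have "B powr \<alpha> = B powr (\<alpha> - 1) * B" using B powr_add[of B "\<alpha> - 1" 1] by simp
    then have "4 * \<beta> * s = (4 * \<beta> * b * B powr (\<alpha> - 1)) * B" by (simp add: s_def)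
    also have "\<dots> \<le> 1 * B" using B by (intro mult_right_mono) auto
    finally show ?thesis by simp
  qed
  define c0 where "c0 = B / 2"
  have c0: "0 < c0" using B by (simp add: c0_def)
  define k where "k = (c0 / 2) powr (- \<alpha>)"
  have k: "0 < k" using c0 by (simp add: k_def)
  have "((\<lambda>C. 2 * c powr (- \<alpha>) * (C / 2) powr (1 - \<alpha>)) \<longlongrightarrow> 0) at_top"
    using \<alpha>0 by real_asymp
  from ex_ge_tendsto_0[OF this \<delta>, of "max 1 s"]
  obtain C where C: "1 \<le> C" "s \<le> C" "2 * c powr (- \<alpha>) * (C / 2) powr (1 - \<alpha>) \<le> \<delta>" by auto
  have "((\<lambda>C'. 5 * C * C' powr (- \<alpha>)) \<longlongrightarrow> 0) at_top"
    using \<alpha>0 by real_asymp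
  from ex_ge_tendsto_0[OF this \<delta>, of 1]
  obtain C' where C': "1 \<le> C'" "5 * C * C' powr (- \<alpha>) \<le> \<delta>" by auto
  have "((\<lambda>d. 3 * d * k) \<longlongrightarrow> 0) (at_right 0)" by real_asymp
  from ex_less_tendsto_0[OF this \<delta> zero_less_one] obtain d1 where d1: "0 < d1" "3 * d1 * k \<le> \<delta>" by auto
  have "((\<lambda>d. 50 * C * d * k\<^sup>2) \<longlongrightarrow> 0) (at_right 0)" by real_asymp
  from ex_less_tendsto_0[OF this \<delta>, of "min d1 C"]
  obtain d where d: "0 < d" "d < d1" "d < C" "50 * C * d * k\<^sup>2 \<le> \<delta>" using d1 C by auto
  define v where "v = min (c0 / 2) (d * \<beta> / 2)"
  have v: "0 < v" "v \<le> c0 / 2" "v \<le> d * \<beta> / 2" using c0 d \<beta> by (simp_all add: v_def)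
  \<comment> \<open>The two summands will bound the fluctuation event \<open>A8\<close> and the coin
    event \<open>A6\<close>.\<close>
  have "((\<lambda>x. C * (32 / (v\<^sup>2 * e\<^sup>2) * k) * x + real (4 * K + 2) * k * x) \<longlongrightarrow> 0) (at_right 0)" by real_asymp
  from ex_less_tendsto_0[OF this \<delta> zero_less_one]
  obtain x where x: "0 < x" "C * (32 / (v\<^sup>2 * e\<^sup>2) * k) * x + real (4 * K + 2) * k * x \<le> \<delta>" by auto
  have x12: "C * (32 / (v\<^sup>2 * e\<^sup>2) * k) * x \<le> \<delta>" "real (4 * K + 2) * k * x \<le> \<delta>"
  proof -
    have "0 \<le> C * (32 / (v\<^sup>2 * e\<^sup>2) * k) * x" "0 \<le> real (4 * K + 2) * k * x" using C k x by auto
    then show "C * (32 / (v\<^sup>2 * e\<^sup>2) * k) * x \<le> \<delta>" "real (4 * K + 2) * k * x \<le> \<delta>" using x(2) by linarith+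
  qed
  define \<theta> where "\<theta> = d / (C + d)"
  have \<theta>: "0 < \<theta>" "\<theta> < 1" using d C by (auto simp: \<theta>_def)
  define y where "y = 2 * (2 / v) ^ (2 * K - 1)"
  define a1 where "a1 = Max {1, 1 / c0, 4 / v, 2 / (c * C), 2 / c0, 1 / B, y / e}"
  define r1 where "r1 = Max {1, 2 / s, 1 / d1, (real K + 2) / d, ln (2 / e) / d + 1 / d, 2 / C, 2 / d}"
  define l1 where "l1 = Max {1, C / c0, s / B}"
  have ev1: "\<forall>\<^sub>F t in at_top. a1 < hscale \<alpha> t" using hscale_at_top[OF alpha] by (simp add: filterlim_at_top_dense)
  have ev2: "\<forall>\<^sub>F t in at_top. r1 < dscale \<alpha> t" using dscale_at_top[OF alpha] by (simp add: filterlim_at_top_dense)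
  have "filterlim (\<lambda>t::real. ln t) at_top at_top" by real_asymp
  then have ev3: "\<forall>\<^sub>F t in at_top. l1 < ln (t::real)" by (simp add: filterlim_at_top_dense)
  have ev4: "\<forall>\<^sub>F t in at_top. (- \<beta>) * ln (ln t) + ln B \<le> \<beta> * ln (t::real)" by (rule eventually_log_affine[OF \<beta>])
  have ev5: "\<forall>\<^sub>F t in at_top. exp 1 < (t::real)" by (rule eventually_gt_at_top)
  have C'0: "0 < C'" using C' by simp
  note ev6 = eventually_scale_conditions[OF alpha c0 d1(1) C'0 \<theta>, folded \<beta>_def]
  have q0: "\<And>n. 0 \<le> 1 - p n" using p01 by simp
  note ev7 = eta_scale_bounds[OF alpha q0 o C(1) C'0 x(1)]
  show ?thesis using ev1 ev2 ev3 ev4 ev5 ev6 ev7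
  proof eventually_elim
    case (elim t)
    define a where "a = hscale \<alpha> t"
    define r where "r = dscale \<alpha> t"
    define \<Lambda> where "\<Lambda> = ln t"
    define L where "L = nat \<lfloor>d * r\<rfloor>"
    define w0 where "w0 = v * a"
    define J where "J = nat \<lceil>log 2 (C' * a)\<rceil>"
    define S where "S = nat \<lfloor>s * r\<rfloor>"
    define D1 where "D1 = nat \<lfloor>d1 * r\<rfloor>"
    define R where "R = nat \<lfloor>C * r\<rfloor>"
    define R2 where "R2 = nat \<lfloor>2 * C * r\<rfloor>"
    have t1: "1 < t" using elim(5) exp_ge_add_one_self[of 1] by linarith
    have a_gt: "1 < a" "1 / c0 < a" "4 / v < a" "2 / (c * C) < a" "2 / c0 < a" "1 / B < a" "y / e < a"
      using elim(1) unfolding a1_def a_def by simp_all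
    have r_gt: "1 < r" "2 / s < r" "1 / d1 < r" "(real K + 2) / d < r" "ln (2 / e) / d + 1 / d < r" "2 / C < r" "2 / d < r"
      using elim(2) unfolding r1_def r_def by simp_all
    have l_gt: "1 < \<Lambda>" "C / c0 < \<Lambda>" "s / B < \<Lambda>" using elim(3) unfolding l1_def \<Lambda>_def by simp_all
    have a0: "0 < a" and r0: "0 < r" and l0: "0 < \<Lambda>" using a_gt r_gt l_gt by simp_all
    have a_mult: "1 < c0 * a" "4 < v * a" "2 < c * C * a" "1 < c0 / 2 * a" "1 < B * a" "y < e * a"
      using a_gt c0 v c C B e by (simp_all add: pos_divide_less_eq mult_ac)
    have r_mult: "2 < s * r" "1 < d1 * r" "real K + 2 < d * r" "2 < C * r" "2 < d * r"
      using r_gt s d1 d C by (simp_all add: pos_divide_less_eq mult_ac)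
    have dr: "ln (2 / e) + 1 < d * r"
      using r_gt(5) d by (simp add: add_divide_distrib[symmetric] pos_divide_less_eq mult_ac)
    have ra: "r = a * t / \<Lambda>" unfolding r_def a_def \<Lambda>_def dscale_def ..
    have rpow: "r = a powr \<alpha>" unfolding r_def a_def by (rule dscale_eq_powr[OF alpha t1])
    have rl: "r = a * (t / \<Lambda>)" by (simp add: ra)
    have tl: "0 < t / \<Lambda>" using t1 l0 by simp
    have rl': "r powr (\<alpha> - 1) = (t / \<Lambda>) powr \<alpha>" unfolding r_def \<Lambda>_def by (rule dscale_powr_eq[OF alpha t1])
    have L: "real L \<le> d * r" "d * r \<le> 2 * real L" "d * r - 1 \<le> real L" "K \<le> L"
      using r_mult half_le_nat_floor[of "d * r"] unfolding L_def by linarith+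
    have LC: "real L \<le> C * r" using L(1) mult_right_mono[of d C r] d r0 by linarith
    note H = elim(6)[folded a_def r_def \<Lambda>_def]
    note E = elim(7)[folded a_def r_def \<Lambda>_def, folded R2_def J_def]
    define A0 where "A0 = {w \<in> space M. \<not> (\<forall>z. 1 < xi0 z w)}"
    define A1 where "A1 = {w \<in> space M. \<forall>y\<in>{1..S}. xi0 (int y) w \<le> B * a}"
    define A2 where "A2 = {w \<in> space M. \<exists>z\<in>{- int D1..int D1}. c0 / 2 * a < xi0 z w}"
    define A3 where "A3 = {w \<in> space M. \<exists>z. real R < real_of_int \<bar>z\<bar> \<and> c / (t / \<Lambda>) * real_of_int \<bar>z\<bar> < xi0 z w}"
    define A4 where "A4 = {w \<in> space M. \<exists>z\<in>{- int R2..int R2}. C' * a < xi0 z w}"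
    define F where "F = {(y, z). \<bar>y\<bar> \<le> int R2 \<and> \<bar>z\<bar> \<le> int R2 \<and> \<bar>y\<bar> \<noteq> \<bar>z\<bar> \<and> \<bar>\<bar>y\<bar> - \<bar>z\<bar>\<bar> \<le> 2 * int L}"
    define A5 where "A5 = {w \<in> space M. \<exists>(y, z)\<in>F. c0 / 2 * a < xi0 y w \<and> c0 / 2 * a < xi0 z w}"
    define A6 where "A6 = {w \<in> space M. \<exists>y\<in>{1..R2}. \<exists>z\<in>{z. \<bar>\<bar>z\<bar> - int y\<bar> < int K}. c0 / 2 * a < xi0 z w \<and> \<not> coin y w}"
    define A8 where "A8 = {w \<in> space M. \<exists>n\<in>{L<..R}. cfg w \<in> fluct_event (int n) K L w0 e t (c0 / 2 * a) (C' * a)}"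
    define A where "A = A0 \<union> A1 \<union> A2 \<union> A3 \<union> A4 \<union> A5 \<union> A6 \<union> A8"
    have P0: "A0 \<in> events" "prob A0 \<le> 0"
    proof -
      show m: "A0 \<in> events" unfolding A0_def by measurable
      show "prob A0 \<le> 0" using AE_xi0_gt_1 m unfolding A0_def by (subst (asm) AE_iff_measurable[OF m[unfolded A0_def] refl]) (simp add: measure_def)
    qed
    have P1: "A1 \<in> events" "prob A1 \<le> \<delta>"
    proof -
      show "A1 \<in> events" unfolding A1_def by measurable
      have "prob A1 \<le> exp (- b / 2)" unfolding A1_def S_def
        by (rule prob_no_near_big[OF a0 rpow B(1) _ s_def]) (use a_mult r_mult in auto)
      then show "prob A1 \<le> \<delta>" using b(2) by linarith
    qed
    have P2: "A2 \<in> events" "prob A2 \<le> \<delta>"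
    proof -
      show "A2 \<in> events" unfolding A2_def by measurable
      have "prob A2 \<le> (2 + 1) * d1 * (c0 / 2) powr (- \<alpha>)" unfolding A2_def D1_def
        by (rule prob_big_in_interval[OF a0 rpow]) (use a_mult r_mult c0 d1 in auto)
      then show "prob A2 \<le> \<delta>" using d1(2) by (simp add: k_def)
    qed
    have P3: "A3 \<in> events" "prob A3 \<le> \<delta>"
    proof -
      show "A3 \<in> events" unfolding A3_def R_def
        by (rule prob_far_big_scale(1)[OF a0 tl rl rl' c]) (use C r_mult a_mult in auto)
      have "prob A3 \<le> 2 * c powr (- \<alpha>) * (C / 2) powr (1 - \<alpha>)" unfolding A3_def R_def
        by (rule prob_far_big_scale(2)[OF a0 tl rl rl' c]) (use C r_mult a_mult in auto)
      then show "prob A3 \<le> \<delta>" using C(3) by linarith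
    qed
    have P4: "A4 \<in> events" "prob A4 \<le> \<delta>"
    proof -
      show "A4 \<in> events" unfolding A4_def by measurable
      have "1 * 1 \<le> C' * a" using C' a_gt by (intro mult_mono) auto
      \<comment> \<open>With d = 2 C and k = 1/2 in \<open>prob_big_in_interval\<close>, which gives
        the 5 C in the choice of \<open>C'\<close>.\<close>
      then have "prob A4 \<le> (2 + 1 / 2) * (2 * C) * C' powr (- \<alpha>)" unfolding A4_def R2_def
        by (intro prob_big_in_interval[OF a0 rpow]) (use a_mult r_mult C C' in auto)
      then show "prob A4 \<le> \<delta>" using C'(2) by simp
    qed
    have P5: "A5 \<in> events" "prob A5 \<le> \<delta>"
    proof -
      have "finite F" unfolding F_def by (rule card_pairs_le)
      then show "A5 \<in> events" unfolding A5_def case_prod_unfold by measurable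
      have "prob A5 \<le> 50 * C * d * ((c0 / 2) powr (- \<alpha>))\<^sup>2" unfolding A5_def
        by (rule prob_big_pair_scale[OF a0 rpow _ _ _ _ _ _ F_def[unfolded R2_def L_def]]) (use a_mult r_mult c0 C d in auto)
      then show "prob A5 \<le> \<delta>" using d(4) by (simp add: k_def)
    qed
    have hpow: "(c0 / 2 * a) powr (- \<alpha>) = k / r" unfolding k_def by (rule powr_neg_scale[OF _ a0 rpow]) (use c0 in simp)
    have P6: "A6 \<in> events" "prob A6 \<le> \<delta>"
    proof -
      show "A6 \<in> events" unfolding A6_def by measurable
      have "prob A6 \<le> real (4 * K + 2) * (c0 / 2 * a) powr (- \<alpha>) * eta (\<lambda>n. 1 - p n) R2" unfolding A6_def
        by (rule prob_big_near_unpaired) (use a_mult in simp)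
      also have "\<dots> \<le> real (4 * K + 2) * (c0 / 2 * a) powr (- \<alpha>) * (x * r)"
        using E by (intro mult_left_mono) auto
      also have "\<dots> = real (4 * K + 2) * k * x" unfolding hpow using r0 by simp
      finally show "prob A6 \<le> \<delta>" using x12(2) by linarith
    qed
    have P8: "A8 \<in> events" "prob A8 \<le> \<delta>"
    proof -
      let ?e = "(\<Sum>j<J. 4 ^ Suc j * (2 ^ j) powr (- \<alpha>)) * eta (\<lambda>n. 1 - p n) R2"
      have Rr: "real R \<le> C * r" unfolding R_def using r_mult(4) by linarith
      have n: "K \<le> L" "0 < L" using L K by auto
      have "real R + real L \<le> 2 * C * r" using Rr LC by linarith
      then have "R + L \<le> R2 + 1" unfolding R2_def by linarith
      note n = n this
      have "C' * a = 2 powr (log 2 (C' * a))" using C' a0 by simp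
      also have "\<dots> \<le> 2 powr (real J)" unfolding J_def by (intro powr_mono) linarith+
      finally have CJ: "C' * a \<le> 2 ^ J" by (simp add: powr_realpow)
      have w: "4 \<le> w0" using a_mult by (simp add: w0_def)
      have h: "1 \<le> c0 / 2 * a" using a_mult by simp
      have t0: "0 < t" using t1 by simp
      note f = prob_fluct_union_le[OF n w e t0 h CJ]
      show "A8 \<in> events" unfolding A8_def by (rule f(1))
      have "prob A8 \<le> real R * (32 / (w0\<^sup>2 * e\<^sup>2) * (c0 / 2 * a) powr (- \<alpha>) * ?e)"
        unfolding A8_def by (rule f(2))
      \<comment> \<open>All scales cancel: C r candidates against k / r for the height at
        \<open>n\<close>, and x a^2 for the truncated squares against w0^2 = v^2 a^2.\<close>
      also have "\<dots> \<le> (C * r) * (32 / (w0\<^sup>2 * e\<^sup>2) * (c0 / 2 * a) powr (- \<alpha>) * (x * a\<^sup>2))"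
      proof (rule mult_mono[OF Rr])
        show "32 / (w0\<^sup>2 * e\<^sup>2) * (c0 / 2 * a) powr (- \<alpha>) * ?e \<le> 32 / (w0\<^sup>2 * e\<^sup>2) * (c0 / 2 * a) powr (- \<alpha>) * (x * a\<^sup>2)"
          using E by (intro mult_left_mono) auto
        have "0 \<le> ?e" unfolding eta_def using q0 by (intro mult_nonneg_nonneg sum_nonneg) auto
        then show "0 \<le> 32 / (w0\<^sup>2 * e\<^sup>2) * (c0 / 2 * a) powr (- \<alpha>) * ?e"
          by (rule mult_nonneg_nonneg[rotated]) (intro mult_nonneg_nonneg powr_ge_zero divide_nonneg_nonneg zero_le_power2, simp)
      qed (use C r0 in simp)
      also have "\<dots> = C * (32 / (v\<^sup>2 * e\<^sup>2) * k) * x"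
        unfolding hpow w0_def using r0 a0 v e by (simp add: power_mult_distrib)
      finally show "prob A8 \<le> \<delta>" using x12(1) by linarith
    qed
    have Am: "A \<in> events" unfolding A_def using P0(1) P1(1) P2(1) P3(1) P4(1) P5(1) P6(1) P8(1) by (intro sets.Un)
    have un: "prob (X \<union> Y) \<le> x + y" if "X \<in> events" "prob X \<le> x" "Y \<in> events" "prob Y \<le> y" for X Y x y
      using measure_Un_le[OF that(1,3)] that(2,4) by linarith
    have "prob A \<le> 0 + \<delta> + \<delta> + \<delta> + \<delta> + \<delta> + \<delta> + \<delta>"
      unfolding A_def using P0 P1 P2 P3 P4 P5 P6 P8 by (intro un sets.Un)
    also have "\<dots> \<le> eps'" using eps' by (simp add: \<delta>_def)
    finally have PA: "prob A \<le> eps'" .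
    have lnBa: "ln (B * a) \<le> 2 * \<beta> * \<Lambda>"
    proof -
      have "ln (B * a) = ln B + \<beta> * (\<Lambda> - ln \<Lambda>)"
        using B a0 ln_hscale[OF t1, of \<alpha>] by (simp add: ln_mult a_def \<beta>_def \<Lambda>_def)
      then show ?thesis using elim(4) unfolding \<Lambda>_def[symmetric] by (simp add: algebra_simps)
    qed
    have slB: "s / \<Lambda> * ln (B * a) \<le> B / 2"
    proof -
      have "s / \<Lambda> * ln (B * a) \<le> s / \<Lambda> * (2 * \<beta> * \<Lambda>)" using lnBa s l0 by (intro mult_left_mono) auto
      also have "\<dots> = 2 * \<beta> * s" using l0 by simp
      finally show ?thesis using sB by linarith
    qed
    have al: "\<Lambda> \<le> a"
    proof -
      have "0 \<le> ln (a / \<Lambda>)" using H \<beta> l0 by (smt (verit) mult_nonneg_nonneg divide_nonneg_nonneg)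
      then have "1 \<le> a / \<Lambda>" using a0 l0 by (simp add: ln_ge_zero_iff)
      then show ?thesis using l0 by simp
    qed
    have pw: "2 * (2 / w0) ^ (2 * K - 1) * t \<le> e"
    proof -
      have "real (2 * K - 1) = 2 * real K - 1" using K by (simp add: of_nat_diff)
      then have "a powr (\<alpha> + 1) \<le> a powr (real (2 * K - 1))" using a_gt K(1) alpha by (intro powr_mono) auto
      also have "\<dots> = a ^ (2 * K - 1)" using a0 by (simp only: powr_realpow)
      finally have ap: "a * r \<le> a ^ (2 * K - 1)" using a0 by (simp add: powr_add rpow mult.commute)
      have "a * t \<le> a * r"
        using al l0 a0 t1 unfolding ra by (simp add: pos_le_divide_eq mult.commute mult_left_mono mult_right_mono)
      then have at: "a * t \<le> a ^ (2 * K - 1)" using ap by linarith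
      have "2 * (2 / w0) ^ (2 * K - 1) * t = y * t / a ^ (2 * K - 1)"
        unfolding y_def w0_def by (simp add: power_divide power_mult_distrib)
      also have "\<dots> \<le> y * t / (a * t)"
        using at a0 t1 v by (intro divide_left_mono mult_pos_pos) (auto simp: y_def)
      also have "\<dots> = y / a" using t1 by simp
      also have "\<dots> \<le> e" using a_mult(6) a0 by (simp add: pos_divide_le_eq)
      finally show ?thesis .
    qed
    have eL: "2 * exp (- real L) \<le> e"
    proof -
      have "exp (- real L) \<le> exp (- ln (2 / e))" using dr L(3) by simp
      also have "\<dots> = e / 2" using e by (simp add: exp_minus)
      finally show ?thesis by simp
    qed
    have l': "0 \<le> ln (2 * C' * a)"
    proof (rule ln_ge_zero)
      have "1 * 1 \<le> (2 * C') * a" using C' a_gt by (intro mult_mono) auto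
      then show "1 \<le> 2 * C' * a" by simp
    qed
    show ?case
    proof (intro bexI[OF _ Am] conjI PA ballI allI impI)
      fix w Z
      assume w: "w \<in> space M - A"
        and Z: "(\<exists>z\<in>Dset (pot w). \<forall>y\<in>Dset (pot w). Psi (pot w) t (int y) \<le> Psi (pot w) t (int z)) \<longrightarrow>
          Z \<in> Dset (pot w) \<and> (\<forall>y\<in>Dset (pot w). Psi (pot w) t (int y) \<le> Psi (pot w) t (int Z))"
      have ws: "w \<in> space M" and wn: "w \<notin> A0" "w \<notin> A1" "w \<notin> A2" "w \<notin> A3" "w \<notin> A4" "w \<notin> A5" "w \<notin> A6" "w \<notin> A8"
        using w unfolding A_def by auto
      show "\<bar>pam_u (pot w) t (int Z) / pam_u (pot w) t (- int Z) - 1\<bar> \<le> eps"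
      proof (rule good_realisation[where a = a and t = t and \<Lambda> = \<Lambda> and r = r and C = C and B = B and ?c0.0 = c0
            and ?d1.0 = d1 and d = d and \<beta> = \<beta> and C' = C' and c = c and K = K and L = L and ?w0.0 = w0 and \<theta> = \<theta>
            and l' = "ln (2 * C' * a)" and l = "ln (d1 * a / (2 * exp 1 * \<Lambda>))" and S = S and s = s and ?D1.0 = D1
            and R = R and ?R2.0 = R2 and e = e and w = w])
        show "1 < xi0 z w" for z using wn(1) ws unfolding A0_def by simp
        show "\<exists>y\<in>{1..S}. B * a < xi0 (int y) w" using wn(2) ws unfolding A1_def by (auto simp: not_le)
        show "xi0 z w \<le> c0 / 2 * a" if "\<bar>z\<bar> \<le> int D1" for z 
        proof -
          have "z \<in> {- int D1..int D1}" using that by auto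
          then show ?thesis using wn(3) ws unfolding A2_def by (simp only: mem_Collect_eq) (meson not_le)
        qed
        show "xi0 z w \<le> c * \<Lambda> / t * real_of_int \<bar>z\<bar>" if "real R < real_of_int \<bar>z\<bar>" for z
        proof -
          have "\<not> c / (t / \<Lambda>) * real_of_int \<bar>z\<bar> < xi0 z w"
            using wn(4) ws that unfolding A3_def by blast
          then show ?thesis by simp
        qed
        show "xi0 z w \<le> C' * a" if "\<bar>z\<bar> \<le> int R2" for z 
        proof -
          have "z \<in> {- int R2..int R2}" using that by auto
          then show ?thesis using wn(5) ws unfolding A4_def by (simp only: mem_Collect_eq) (meson not_le)
        qed
        show "xi0 z w \<le> c0 / 2 * a" if "\<bar>y\<bar> \<le> int R2" "\<bar>z\<bar> \<le> int R2" "\<bar>y\<bar> \<noteq> \<bar>z\<bar>"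
          "\<bar>\<bar>y\<bar> - \<bar>z\<bar>\<bar> \<le> 2 * int L" "c0 / 2 * a < xi0 y w" for y z
        proof -
          have "(y, z) \<in> F" unfolding F_def using that by simp
          then show ?thesis using wn(6) ws that(5) unfolding A5_def by (auto simp: not_less)
        qed
        show "coin y w" if "1 \<le> y" "y \<le> R2" "\<bar>z\<bar> \<le> int R2" "\<bar>\<bar>z\<bar> - int y\<bar> < int K" "c0 / 2 * a < xi0 z w" for y z
          using wn(7) ws that unfolding A6_def by auto
        show "cfg w \<notin> fluct_event (int n) K L w0 e t (c0 / 2 * a) (C' * a)" if "L < n" "n \<le> R" for n
          using wn(8) ws that unfolding A8_def by auto
        show "(\<exists>z\<in>Dset (pot w). \<forall>y\<in>Dset (pot w). Psi (pot w) t (int y) \<le> Psi (pot w) t (int z)) \<longrightarrow>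
          Z \<in> Dset (pot w) \<and> (\<forall>y\<in>Dset (pot w). Psi (pot w) t (int y) \<le> Psi (pot w) t (int Z))" by (rule Z)
        show "0 < t" using t1 by simp
        show "c * \<Lambda> \<le> ln (a / \<Lambda>)" using H by (simp only: c_def)
        show "\<beta> / 2 * \<Lambda> \<le> ln (c0 * a)" using H by blast
        show "w0 \<le> c0 * a / 2" using mult_right_mono[OF v(2), of a] a0 by (simp add: w0_def)
        show "w0 \<le> d * \<beta> / 2 * a" using mult_right_mono[OF v(3), of a] a0 by (simp add: w0_def)
        show "4 \<le> w0" using a_mult by (simp add: w0_def)
        show "(1 - \<theta>) * ln (2 * C' * a) + 1 \<le> ln (d1 * a / (2 * exp 1 * \<Lambda>))"
          "(1 - \<theta> / 2) * ln (2 * C' * a) + 2 \<le> ln (d1 * a / (2 * exp 1 * \<Lambda>))"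
          "c * \<Lambda> + ln (2 * C' * a) / 3 + 1 \<le> ln (d1 * a / (2 * exp 1 * \<Lambda>))" using H by (simp_all only: c_def)
        show "s / \<Lambda> \<le> B" using l_gt(3) B l0 by (simp add: pos_divide_less_eq pos_divide_le_eq mult.commute)
        show "3 * e = ln (1 + eps)" by (simp add: e_def)
      qed (fact l0 a0 ra C(1) B(1) c0_def d1(1) d(1) d(2) \<beta> C'(1) c_def a_mult(1) l_gt(2) K(2) L(4) L(1) L(2) LC \<theta>_def refl l'
            S_def C(2) slB D1_def R_def R2_def e pw eL eps)+
    qed
  qed
qed

end

section \<open>Convergence in probability through measurable covers\<close>

theorem theorem1p2:
  fixes M :: "'a measure" and \<alpha> :: real
    and p :: "nat \<Rightarrow> real"
    and xi0 :: "int \<Rightarrow> 'a \<Rightarrow> real" and coin :: "nat \<Rightarrow> 'a \<Rightarrow> bool"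
    and Z :: "real \<Rightarrow> 'a \<Rightarrow> nat"
  assumes "prob_space M"
    and "\<alpha> \<ge> 2"
    and "\<forall>n. 0 \<le> p n \<and> p n \<le> 1"
    and "\<exists>N. \<forall>n m. N \<le> n \<longrightarrow> n \<le> m \<longrightarrow> p n \<le> p m"
    and "p \<longlonglongrightarrow> 1"
    and "prob_space.indep_vars M (\<lambda>_. borel)
           (\<lambda>i w. case i of Inl z \<Rightarrow> xi0 z w | Inr n \<Rightarrow> of_bool (coin n w)) UNIV"
    and "\<forall>z x. x \<ge> 1 \<longrightarrow> measure M {w \<in> space M. xi0 z w > x} = x powr (- \<alpha>)"
    and "\<forall>n\<ge>1. measure M {w \<in> space M. coin n w} = p n"
    and "(eta (\<lambda>n. 1 - p n)) \<in> o(kappa \<alpha>)"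
    and "\<forall>t. Z t \<in> measurable M (count_space UNIV)"
    and "\<forall>t w. (\<exists>z\<in>Dset (potential (\<lambda>z. xi0 z w) (\<lambda>n. coin n w)).
                 \<forall>y\<in>Dset (potential (\<lambda>z. xi0 z w) (\<lambda>n. coin n w)).
                   Psi (potential (\<lambda>z. xi0 z w) (\<lambda>n. coin n w)) t (int y)
                   \<le> Psi (potential (\<lambda>z. xi0 z w) (\<lambda>n. coin n w)) t (int z))
           \<longrightarrow> Z t w \<in> Dset (potential (\<lambda>z. xi0 z w) (\<lambda>n. coin n w)) \<and>
               (\<forall>y\<in>Dset (potential (\<lambda>z. xi0 z w) (\<lambda>n. coin n w)).
                   Psi (potential (\<lambda>z. xi0 z w) (\<lambda>n. coin n w)) t (int y)
                   \<le> Psi (potential (\<lambda>z. xi0 z w) (\<lambda>n. coin n w)) t (int (Z t w)))"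
  shows "\<forall>\<epsilon>>0. \<exists>A. (\<forall>t. A t \<in> sets M \<and>
            {w \<in> space M. \<bar>pam_u (potential (\<lambda>z. xi0 z w) (\<lambda>n. coin n w)) t (int (Z t w))
                 / pam_u (potential (\<lambda>z. xi0 z w) (\<lambda>n. coin n w)) t (- int (Z t w)) - 1\<bar> > \<epsilon>}
              \<subseteq> A t)
          \<and> ((\<lambda>t. measure M (A t)) \<longlongrightarrow> 0) at_top"
proof (intro allI impI)
  fix \<epsilon> :: real assume \<epsilon>: "0 < \<epsilon>"
  interpret dup_field M \<alpha> p xi0 coin
    by (rule dup_field.intro[OF assms(1)], unfold_locales) (use assms in auto)
  note Z_max = assms(11)[folded pot_def, THEN spec, THEN spec]
  define bad where "bad t = {w \<in> space M. \<bar>pam_u (pot w) t (int (Z t w)) / pam_u (pot w) t (- int (Z t w)) - 1\<bar> > \<epsilon>}" for t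
  \<comment> \<open>A good cover of \<open>bad t\<close> is only available for large \<open>t\<close> and depends on the target probability;
    nearly optimal covers do not.\<close>
  have "\<exists>A\<in>events. bad t \<subseteq> A \<and> (\<forall>X\<in>events. bad t \<subseteq> X \<longrightarrow> prob A \<le> prob X + exp (- t))" for t
  proof -
    define I where "I = prob ` {X \<in> events. bad t \<subseteq> X}"
    have ne: "I \<noteq> {}" unfolding I_def bad_def by (auto intro!: exI[of _ "space M"])
    have bdd: "bdd_below I" unfolding I_def by (intro bdd_belowI[of _ 0]) auto
    have "Inf I < Inf I + exp (- t)" by simp
    from cInf_lessD[OF ne this] obtain A where A: "A \<in> events" "bad t \<subseteq> A" "prob A < Inf I + exp (- t)"
      unfolding I_def by auto
    have "Inf I \<le> prob X" if "X \<in> events" "bad t \<subseteq> X" for X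
      using that bdd by (intro cInf_lower) (auto simp: I_def)
    then show ?thesis using A by (intro bexI[of _ A]) fastforce+
  qed
  then obtain A where A: "\<And>t. A t \<in> events" "\<And>t. bad t \<subseteq> A t"
      "\<And>t X. X \<in> events \<Longrightarrow> bad t \<subseteq> X \<Longrightarrow> prob (A t) \<le> prob X + exp (- t)"
    by metis
  have "((\<lambda>t. prob (A t)) \<longlongrightarrow> 0) at_top"
  proof (rule order_tendstoI)
    fix x :: real assume "0 < x"
    then have "\<forall>\<^sub>F t in at_top. \<exists>A\<in>events. prob A \<le> x / 2 \<and> (\<forall>w\<in>space M - A. \<forall>Z.
        ((\<exists>z\<in>Dset (pot w). \<forall>y\<in>Dset (pot w). Psi (pot w) t (int y) \<le> Psi (pot w) t (int z)) \<longrightarrow>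
           Z \<in> Dset (pot w) \<and> (\<forall>y\<in>Dset (pot w). Psi (pot w) t (int y) \<le> Psi (pot w) t (int Z))) \<longrightarrow>
        \<bar>pam_u (pot w) t (int Z) / pam_u (pot w) t (- int Z) - 1\<bar> \<le> \<epsilon>)"
      using eventually_small_exceptional_set[OF assms(9) \<epsilon>, of "x / 2"] by simp
    moreover have "\<forall>\<^sub>F t in at_top. exp (- t) < x / 2"
    proof -
      have "((\<lambda>t::real. exp (- t)) \<longlongrightarrow> 0) at_top" by real_asymp
      then show ?thesis using \<open>0 < x\<close> by (intro order_tendstoD(2)) auto
    qed
    ultimately show "\<forall>\<^sub>F t in at_top. prob (A t) < x"
    proof eventually_elim
      case (elim t)
      then obtain X where X: "X \<in> events" "prob X \<le> x / 2"
        "\<And>w Z. w \<in> space M - X \<Longrightarrow>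
        (\<exists>z\<in>Dset (pot w). \<forall>y\<in>Dset (pot w). Psi (pot w) t (int y) \<le> Psi (pot w) t (int z)) \<longrightarrow>
           Z \<in> Dset (pot w) \<and> (\<forall>y\<in>Dset (pot w). Psi (pot w) t (int y) \<le> Psi (pot w) t (int Z)) \<Longrightarrow>
        \<bar>pam_u (pot w) t (int Z) / pam_u (pot w) t (- int Z) - 1\<bar> \<le> \<epsilon>" by blast
      have "bad t \<subseteq> X"
      proof (rule subsetI, rule ccontr)
        fix w assume w: "w \<in> bad t" "w \<notin> X"
        have "\<bar>pam_u (pot w) t (int (Z t w)) / pam_u (pot w) t (- int (Z t w)) - 1\<bar> \<le> \<epsilon>"
          by (rule X(3)[OF _ Z_max]) (use w in \<open>simp add: bad_def\<close>)
        then show False using w(1) by (simp add: bad_def)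
      qed
      then show ?case using A(3)[OF X(1)] X(2) elim(2) by fastforce
    qed
  next
    fix x :: real assume "x < 0"
    then have "x < prob (A t)" for t using measure_nonneg[of M "A t"] by linarith
    then show "\<forall>\<^sub>F t in at_top. x < prob (A t)" by simp
  qed
  then show "\<exists>A. (\<forall>t. A t \<in> events \<and>
      {w \<in> space M. \<bar>pam_u (potential (\<lambda>z. xi0 z w) (\<lambda>n. coin n w)) t (int (Z t w))
           / pam_u (potential (\<lambda>z. xi0 z w) (\<lambda>n. coin n w)) t (- int (Z t w)) - 1\<bar> > \<epsilon>} \<subseteq> A t)
    \<and> ((\<lambda>t. prob (A t)) \<longlongrightarrow> 0) at_top"
    using A(1,2) unfolding bad_def pot_def by (intro exI[of _ A]) auto
qed

end
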